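(* Let $w>0$ be real and let $\alpha,\beta>0$ with $\alpha\beta\le1$. Let $S=S^{\alpha,\beta}$ be the frame operator of the Gabor system generated by the Cauchy kernel $g(t)=\frac1{t-iw}$, and let $h=h_{\alpha,\beta}$ be the distribution defined in the context. Then for $f\in L^2(\mathbb{R})$, $$Sf(x)=\frac{\pi}{\alpha\,\sin\left(\frac{\pi}{\alpha}(x-iw)\right)}\left(\frac{f(t)}{\sin\left(\frac{\pi}{\alpha}(t+iw)\right)}\ast h\right)(x).$$ The inverse operator $S^{-1}$ is given by $$S^{-1}f(t)=\frac{\alpha}{\pi}\sin\left(\frac{\pi}{\alpha}(t+iw)\right)\left(f(x)\sin\left(\frac{\pi}{\alpha}(x-iw)\right)\ast\tilde h\right)(t),$$ where $\tilde h$ is the distribution with $\hat{\tilde h}\,\hat h=1$. In particular, if $\alpha\beta\ge\frac12$, then the canonical dual window $\gamma=S^{-1}g$ is $$\gamma(t)=\frac{\alpha}{\pi}\sin\left(\frac{\pi}{\alpha}(t+iw)\right)\left[\frac{\sin(\pi(\beta-\varepsilon)(t+iw))}{\pi(t+iw)}+\frac{\cos(\pi\beta(t-iw))}{\cosh(2\pi w\beta)}\cdot\frac{\sin(\pi\varepsilon(t+iw))}{\pi(t+iw)}\right],$$ where $\varepsilon=\frac1\alpha-\beta$.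
   Context: For $m,n\in\mathbb{Z}$ put $g_{m,n}(t)=\dfrac{e^{2\pi i\beta n t}}{t-\alpha m-iw}$. The system $\{g_{m,n}\}_{m,n\in\mathbb{Z}}$ is known to be a frame in $L^2(\mathbb{R})$ for all $\alpha\beta\le1$. With $\langle f,g\rangle=\int_{\mathbb{R}}f\overline g$, its frame operator is $$Sf=S^{\alpha,\beta}f=\sum_{m,n\in\mathbb{Z}}\langle f,g_{m,n}\rangle g_{m,n},\qquad f\in L^2(\mathbb{R}),$$ which is bounded and invertible on $L^2(\mathbb{R})$; the canonical dual window is $\gamma=S^{-1}g$. The Fourier transform is $\hat f(\xi)=\int_{-\infty}^\infty f(t)e^{-2\pi i\xi t}\,dt$, extended to tempered distributions. The distribution $h=h_{\alpha,\beta}$ is defined by $$\hat h(\xi)=\pi\sum_{m\in\mathbb{Z}}\chi_{[-(2\alpha)^{-1},(2\alpha)^{-1}]+\beta m}(\xi)\,e^{4\pi w(\xi-\beta m)},$$ where $\chi_E$ is the indicator function of $E$; equivalently, $h(x)=\frac{\sin(\frac{\pi}{\alpha}(x-2iw))}{x-2iw}\,D(\beta x)$, where $D=\sum_{n\in\mathbb{Z}}\delta_n$ is the Dirac comb. Since $\alpha\beta\le 1$, $\hat h$ is bounded above and bounded away from $0$. The convolutions with $h$ and $\tilde h$ of a function in $L^2(\mathbb{R})$ are understood in the distributional sense, i.e. as multiplication by $\hat h$ and by $\hat{\tilde h}=1/\hat h$, respectively, on the Fourier side. In $\left(F(t)\ast h\right)(x)$ the letter $t$ is only the variable of the function $F$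 being convolved. *)

theory Defs
  imports "HOL-Analysis.Analysis"
begin

section \<open>The space of square-integrable complex functions on the real line\<close>

definition sq_integrable :: "(real \<Rightarrow> complex) \<Rightarrow> bool" where
  "sq_integrable f \<longleftrightarrow>
     f \<in> borel_measurable lborel \<and> integrable lborel (\<lambda>t. (cmod (f t))\<^sup>2)"

definition l2_rel :: "(real \<Rightarrow> complex) \<Rightarrow> (real \<Rightarrow> complex) \<Rightarrow> bool" where
  "l2_rel f g \<longleftrightarrow> sq_integrable f \<and> sq_integrable g \<and> (AE t in lborel. f t = g t)"

lemma sq_integrable_measurable [measurable_dest]:
  "sq_integrable f \<Longrightarrow> f \<in> borel_measurable borel"
  by (simp add: sq_integrable_def)

lemma sq_integrable_zero: "sq_integrable (\<lambda>_. 0)"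
  by (simp add: sq_integrable_def)

lemma sq_integrable_scale:
  assumes "sq_integrable f"
  shows "sq_integrable (\<lambda>t. c * f t)"
  using assms by (auto simp: sq_integrable_def norm_mult power_mult_distrib)

lemma sq_integrable_bounded_mult:
  assumes "sq_integrable f" and [measurable]: "b \<in> borel_measurable borel" and "bounded (range b)"
  shows "sq_integrable (\<lambda>t. b t * f t)"
proof -
  have [measurable]: "f \<in> borel_measurable borel"
    using assms(1) by (rule sq_integrable_measurable)
  obtain B where B: "\<And>t. cmod (b t) \<le> B"
    using assms(3) by (auto simp: bounded_iff)
  have "integrable lborel (\<lambda>t. B\<^sup>2 * (cmod (f t))\<^sup>2)"
    using assms(1) by (simp add: sq_integrable_def)
  then have "integrable lborel (\<lambda>t. (cmod (b t * f t))\<^sup>2)"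
    by (rule Bochner_Integration.integrable_bound)
       (auto simp: norm_mult power_mult_distrib intro!: AE_I2 mult_right_mono power_mono B)
  then show ?thesis
    by (simp add: sq_integrable_def)
qed

lemma sq_integrable_add:
  assumes "sq_integrable f" "sq_integrable g"
  shows "sq_integrable (\<lambda>t. f t + g t)"
proof -
  have [measurable]: "f \<in> borel_measurable borel" "g \<in> borel_measurable borel"
    using assms by (auto intro: sq_integrable_measurable)
  have *: "(cmod (a + b))\<^sup>2 \<le> 2 * (cmod a)\<^sup>2 + 2 * (cmod b)\<^sup>2" for a b
  proof -
    have "(cmod (a + b))\<^sup>2 \<le> (cmod a + cmod b)\<^sup>2"
      by (intro power_mono norm_triangle_ineq) auto
    also have "\<dots> \<le> 2 * (cmod a)\<^sup>2 + 2 * (cmod b)\<^sup>2"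
      using sum_squares_bound[of "cmod a" "cmod b"] by (simp add: power2_sum)
    finally show ?thesis .
  qed
  have "integrable lborel (\<lambda>t. 2 * (cmod (f t))\<^sup>2 + 2 * (cmod (g t))\<^sup>2)"
    using assms by (auto simp: sq_integrable_def)
  then have "integrable lborel (\<lambda>t. (cmod (f t + g t))\<^sup>2)"
    by (rule Bochner_Integration.integrable_bound) (auto simp: * intro!: AE_I2)
  then show ?thesis
    by (simp add: sq_integrable_def)
qed

lemma sq_integrable_uminus: "sq_integrable f \<Longrightarrow> sq_integrable (\<lambda>t. - f t)"
  using sq_integrable_scale[of f "-1"] by simp

lemma sq_integrable_diff:
  "sq_integrable f \<Longrightarrow> sq_integrable g \<Longrightarrow> sq_integrable (\<lambda>t. f t - g t)"
  using sq_integrable_add[OF _ sq_integrable_uminus, of f g] by simp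

lemma l2_relD:
  assumes "l2_rel f g"
  shows "sq_integrable f" "sq_integrable g" "AE t in lborel. f t = g t"
  using assms by (simp_all add: l2_rel_def)

lemma l2_relI:
  "sq_integrable f \<Longrightarrow> sq_integrable g \<Longrightarrow> AE t in lborel. f t = g t \<Longrightarrow> l2_rel f g"
  by (simp add: l2_rel_def)

lemma l2_rel_cong1:
  assumes "l2_rel f g" "\<And>u. sq_integrable u \<Longrightarrow> sq_integrable (\<lambda>t. F (u t))"
  shows "l2_rel (\<lambda>t. F (f t)) (\<lambda>t. F (g t))"
proof (rule l2_relI)
  show "AE t in lborel. F (f t) = F (g t)"
    using l2_relD(3)[OF assms(1)] by eventually_elim simp
qed (use assms l2_relD in blast)+

lemma l2_rel_cong2:
  assumes "l2_rel f f'" "l2_rel g g'"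
    "\<And>u v. sq_integrable u \<Longrightarrow> sq_integrable v \<Longrightarrow> sq_integrable (\<lambda>t. F (u t) (v t))"
  shows "l2_rel (\<lambda>t. F (f t) (g t)) (\<lambda>t. F (f' t) (g' t))"
proof (rule l2_relI)
  show "AE t in lborel. F (f t) (g t) = F (f' t) (g' t)"
    using l2_relD(3)[OF assms(1)] l2_relD(3)[OF assms(2)] by eventually_elim simp
qed (use assms l2_relD in blast)+

quotient_type l2 = "real \<Rightarrow> complex" / partial: l2_rel
proof (rule part_equivpI)
  show "\<exists>f. l2_rel f f"
    using sq_integrable_zero by (auto simp: l2_rel_def)
  show "symp l2_rel"
  proof (rule sympI)
    fix f g assume fg: "l2_rel f g"
    have "AE t in lborel. g t = f t"
      using l2_relD(3)[OF fg] by eventually_elim simp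
    then show "l2_rel g f"
      using l2_relD[OF fg] by (simp add: l2_rel_def)
  qed
  show "transp l2_rel"
  proof (rule transpI)
    fix f g k assume fg: "l2_rel f g" and gk: "l2_rel g k"
    have "AE t in lborel. f t = k t"
      using l2_relD(3)[OF fg] l2_relD(3)[OF gk] by eventually_elim simp
    then show "l2_rel f k"
      using l2_relD[OF fg] l2_relD[OF gk] by (simp add: l2_rel_def)
  qed
qed

instantiation l2 :: real_vector
begin

lift_definition zero_l2 :: l2 is "\<lambda>_. 0"
  by (simp add: l2_rel_def sq_integrable_zero)

lift_definition plus_l2 :: "l2 \<Rightarrow> l2 \<Rightarrow> l2" is "\<lambda>f g t. f t + g t"
  by (rule l2_rel_cong2[where F = "(+)"]) (assumption | rule sq_integrable_add)+

lift_definition uminus_l2 :: "l2 \<Rightarrow> l2" is "\<lambda>f t. - f t"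
  by (rule l2_rel_cong1[where F = uminus]) (assumption | rule sq_integrable_uminus)+

lift_definition minus_l2 :: "l2 \<Rightarrow> l2 \<Rightarrow> l2" is "\<lambda>f g t. f t - g t"
  by (rule l2_rel_cong2[where F = "(-)"]) (assumption | rule sq_integrable_diff)+

lift_definition scaleR_l2 :: "real \<Rightarrow> l2 \<Rightarrow> l2" is "\<lambda>c f t. of_real c * f t"
  by (rule l2_rel_cong1[where F = "(*) _"]) (assumption | rule sq_integrable_scale)+

instance
proof
  note closure = sq_integrable_zero sq_integrable_add sq_integrable_uminus
    sq_integrable_diff sq_integrable_scale
  fix a b :: real and x y z :: l2
  show "x + y + z = x + (y + z)"
    by transfer (simp add: l2_rel_def closure add.assoc)
  show "x + y = y + x"
    by transfer (simp add: l2_rel_def closure add.commute)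
  show "0 + x = x"
    by transfer simp
  show "- x + x = 0"
    by transfer (simp add: l2_rel_def closure)
  show "x - y = x + - y"
    by transfer (simp add: l2_rel_def closure)
  show "a *\<^sub>R (x + y) = a *\<^sub>R x + a *\<^sub>R y"
    by transfer (simp add: l2_rel_def closure distrib_left)
  show "(a + b) *\<^sub>R x = a *\<^sub>R x + b *\<^sub>R x"
    by transfer (simp add: l2_rel_def closure distrib_right)
  show "a *\<^sub>R b *\<^sub>R x = (a * b) *\<^sub>R x"
    by transfer (simp add: l2_rel_def closure mult.assoc)
  show "1 *\<^sub>R x = x"
    by transfer simp
qed

end

lift_definition scaleC_l2 :: "complex \<Rightarrow> l2 \<Rightarrow> l2" is "\<lambda>c f t. c * f t"
  by (rule l2_rel_cong1[where F = "(*) _"]) (assumption | rule sq_integrable_scale)+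

lift_definition l2_inner :: "l2 \<Rightarrow> l2 \<Rightarrow> complex" is
  "\<lambda>f g. LINT t|lborel. f t * cnj (g t)"
proof -
  fix f f' g g' assume rel: "l2_rel f f'" "l2_rel g g'"
  have [measurable]: "f \<in> borel_measurable borel" "f' \<in> borel_measurable borel"
    "g \<in> borel_measurable borel" "g' \<in> borel_measurable borel"
    using l2_relD[OF rel(1)] l2_relD[OF rel(2)] by (auto intro: sq_integrable_measurable)
  have [measurable]: "cnj \<in> borel_measurable borel"
    by (intro borel_measurable_continuous_onI continuous_intros)
  have "AE t in lborel. f t * cnj (g t) = f' t * cnj (g' t)"
    using l2_relD(3)[OF rel(1)] l2_relD(3)[OF rel(2)] by eventually_elim simp
  then show "(LINT t|lborel. f t * cnj (g t)) = (LINT t|lborel. f' t * cnj (g' t))"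
    by (intro integral_cong_AE) auto
qed

instantiation l2 :: real_normed_vector
begin

lift_definition norm_l2 :: "l2 \<Rightarrow> real" is "\<lambda>f. sqrt (LINT t|lborel. (cmod (f t))\<^sup>2)"
proof -
  fix f g assume rel: "l2_rel f g"
  have [measurable]: "f \<in> borel_measurable borel" "g \<in> borel_measurable borel"
    using l2_relD[OF rel] by (auto intro: sq_integrable_measurable)
  have "AE t in lborel. (cmod (f t))\<^sup>2 = (cmod (g t))\<^sup>2"
    using l2_relD(3)[OF rel] by eventually_elim simp
  then have "(LINT t|lborel. (cmod (f t))\<^sup>2) = (LINT t|lborel. (cmod (g t))\<^sup>2)"
    by (intro integral_cong_AE) auto
  then show "sqrt (LINT t|lborel. (cmod (f t))\<^sup>2) = sqrt (LINT t|lborel. (cmod (g t))\<^sup>2)"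
    by simp
qed

definition dist_l2 :: "l2 \<Rightarrow> l2 \<Rightarrow> real" where
  "dist_l2 f g = norm (f - g)"

definition sgn_l2 :: "l2 \<Rightarrow> l2" where
  "sgn_l2 f = f /\<^sub>R norm f"

definition uniformity_l2 :: "(l2 \<times> l2) filter" where
  "uniformity_l2 = (INF e\<in>{0<..}. principal {(f, g). dist f g < e})"

definition open_l2 :: "l2 set \<Rightarrow> bool" where
  "open_l2 U \<longleftrightarrow> (\<forall>f\<in>U. eventually (\<lambda>(f', g). f' = f \<longrightarrow> g \<in> U) uniformity)"

instance
proof
  fix f g :: l2 and c :: real
  show "dist f g = norm (f - g)"
    by (rule dist_l2_def)
  show "sgn f = f /\<^sub>R norm f"
    by (rule sgn_l2_def)
  show "(uniformity :: (l2 \<times> l2) filter) = (INF e\<in>{0<..}. principal {(f, g). dist f g < e})"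
    by (rule uniformity_l2_def)
  show "open U \<longleftrightarrow> (\<forall>f\<in>U. eventually (\<lambda>(f', g). f' = f \<longrightarrow> g \<in> U) uniformity)" for U :: "l2 set"
    by (rule open_l2_def)
  show zero: "norm f = 0 \<longleftrightarrow> f = 0" for f :: l2
  proof transfer
    fix f assume "l2_rel f f"
    then have f: "sq_integrable f" by (simp add: l2_rel_def)
    have "(LINT t|lborel. (cmod (f t))\<^sup>2) = 0 \<longleftrightarrow> (AE t in lborel. (cmod (f t))\<^sup>2 = 0)"
      using f by (intro integral_nonneg_eq_0_iff_AE) (auto simp: sq_integrable_def)
    then show "sqrt (LINT t|lborel. (cmod (f t))\<^sup>2) = 0 \<longleftrightarrow> l2_rel f (\<lambda>_. 0)"
      using f by (simp add: l2_rel_def sq_integrable_zero)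
  qed
  show "norm (c *\<^sub>R f) = \<bar>c\<bar> * norm f"
    by transfer (simp add: norm_mult power_mult_distrib real_sqrt_mult)
  have nonneg: "norm f \<ge> 0" for f :: l2
    by transfer simp
  show "norm (f + g) \<le> norm f + norm g"
  proof (cases "norm f = 0 \<or> norm g = 0")
    case True
    then show ?thesis using zero nonneg by auto
  next
    case False
    then have "norm f > 0" "norm g > 0"
      using nonneg[of f] nonneg[of g] by auto
    then show ?thesis
    proof transfer
      fix f g
      assume rel: "l2_rel f f" "l2_rel g g"
      define I where "I u = (LINT t|lborel. (cmod (u t))\<^sup>2)" for u :: "real \<Rightarrow> complex"
      define a b where "a = sqrt (I f)" and "b = sqrt (I g)"
      assume "sqrt (LINT t|lborel. (cmod (f t))\<^sup>2) > 0" "sqrt (LINT t|lborel. (cmod (g t))\<^sup>2) > 0"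
      then have pos: "a > 0" "b > 0"
        by (auto simp: a_def b_def I_def)
      have I: "I f = a\<^sup>2" "I g = b\<^sup>2"
        by (auto simp: a_def b_def I_def)
      have int: "integrable lborel (\<lambda>t. (cmod (f t))\<^sup>2)" "integrable lborel (\<lambda>t. (cmod (g t))\<^sup>2)"
        using rel by (auto simp: l2_rel_def sq_integrable_def)
      have le: "(cmod (u + v))\<^sup>2 \<le> (1 + b / a) * (cmod u)\<^sup>2 + (1 + a / b) * (cmod v)\<^sup>2" for u v
      proof -
        have "(cmod (u + v))\<^sup>2 \<le> (cmod u + cmod v)\<^sup>2"
          by (intro power_mono norm_triangle_ineq) auto
        also have "\<dots> = (1 + b / a) * (cmod u)\<^sup>2 + (1 + a / b) * (cmod v)\<^sup>2
            - (b * cmod u - a * cmod v)\<^sup>2 / (a * b)"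
          using pos by (simp add: field_simps power2_eq_square)
        also have "\<dots> \<le> (1 + b / a) * (cmod u)\<^sup>2 + (1 + a / b) * (cmod v)\<^sup>2"
          using pos by simp
        finally show ?thesis .
      qed
      have "I (\<lambda>t. f t + g t) \<le>
          (LINT t|lborel. (1 + b / a) * (cmod (f t))\<^sup>2 + (1 + a / b) * (cmod (g t))\<^sup>2)"
        unfolding I_def
      proof (rule integral_mono)
        show "integrable lborel (\<lambda>t. (cmod (f t + g t))\<^sup>2)"
          using rel sq_integrable_add[of f g] by (auto simp: l2_rel_def sq_integrable_def)
      qed (use int le in auto)
      also have "\<dots> = (1 + b / a) * I f + (1 + a / b) * I g"
        using int by (simp add: I_def)
      also have "\<dots> = (a + b)\<^sup>2"
        using pos by (simp add: I field_simps power2_eq_square)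
      finally have "sqrt (I (\<lambda>t. f t + g t)) \<le> a + b"
        using pos by (simp add: real_le_lsqrt)
      then show "sqrt (LINT t|lborel. (cmod (f t + g t))\<^sup>2) \<le>
          sqrt (LINT t|lborel. (cmod (f t))\<^sup>2) + sqrt (LINT t|lborel. (cmod (g t))\<^sup>2)"
        by (simp add: I_def a_def b_def)
    qed
  qed
qed

end

section \<open>Distributions and the Fourier transform\<close>

definition vderiv :: "(real \<Rightarrow> complex) \<Rightarrow> real \<Rightarrow> complex" where
  "vderiv \<phi> = (\<lambda>x. vector_derivative \<phi> (at x))"

definition schwartz :: "(real \<Rightarrow> complex) set" where
  "schwartz = {\<phi>. \<forall>n. (\<forall>x. (vderiv ^^ n) \<phi> differentiable at x) \<and>
                      (\<forall>k::nat. bounded (range (\<lambda>x. of_real (x ^ k) * (vderiv ^^ n) \<phi> x)))}"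

text \<open>A distribution is represented by its action on test functions; only its values on
  \<^const>\<open>schwartz\<close> are relevant.  All pairings are bilinear (no complex conjugation).\<close>

type_synonym distribution = "(real \<Rightarrow> complex) \<Rightarrow> complex"

definition distr_of :: "(real \<Rightarrow> complex) \<Rightarrow> distribution" where
  "distr_of u = (\<lambda>\<phi>. LINT x|lborel. u x * \<phi> x)"

definition distr_eq :: "distribution \<Rightarrow> distribution \<Rightarrow> bool" where
  "distr_eq T U \<longleftrightarrow> (\<forall>\<phi>\<in>schwartz. T \<phi> = U \<phi>)"

definition fourier :: "(real \<Rightarrow> complex) \<Rightarrow> real \<Rightarrow> complex" where
  "fourier \<phi> \<xi> = (LINT t|lborel. \<phi> t * exp (- 2 * of_real pi * \<i> * of_real \<xi> * of_real t))"

definition inv_fourier :: "(real \<Rightarrow> complex) \<Rightarrow> real \<Rightarrow> complex" where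
  "inv_fourier \<phi> x = (LINT \<xi>|lborel. \<phi> \<xi> * exp (2 * of_real pi * \<i> * of_real x * of_real \<xi>))"

definition fourier_distr :: "distribution \<Rightarrow> distribution" where
  "fourier_distr T = (\<lambda>\<phi>. T (fourier \<phi>))"

definition inv_fourier_distr :: "distribution \<Rightarrow> distribution" where
  "inv_fourier_distr T = (\<lambda>\<phi>. T (inv_fourier \<phi>))"

text \<open>\<open>is_l2_convolution F T G\<close>: the Fourier transform of \<open>T\<close> is (integration against) a bounded
  function \<open>M\<close>, and \<open>G\<close> is the square-integrable function whose Fourier transform is \<open>M\<close> times the
  Fourier transform \<open>K\<close> of \<open>F\<close>.\<close>

definition is_l2_convolution :: "l2 \<Rightarrow> distribution \<Rightarrow> l2 \<Rightarrow> bool" where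
  "is_l2_convolution F T G \<longleftrightarrow>
     (\<exists>M K. M \<in> borel_measurable lborel \<and> bounded (range M) \<and>
        distr_eq (fourier_distr T) (distr_of M) \<and>
        distr_eq (fourier_distr (distr_of (rep_l2 F))) (distr_of (rep_l2 K)) \<and>
        distr_eq (fourier_distr (distr_of (rep_l2 G))) (distr_of (\<lambda>\<xi>. M \<xi> * rep_l2 K \<xi>)))"

definition l2_convolution :: "l2 \<Rightarrow> distribution \<Rightarrow> l2" (infixl "\<star>" 70) where
  "F \<star> T = (THE G. is_l2_convolution F T G)"

section \<open>The Gabor system of the Cauchy kernel\<close>

definition cauchy_atom :: "real \<Rightarrow> real \<Rightarrow> real \<Rightarrow> int \<Rightarrow> int \<Rightarrow> real \<Rightarrow> complex" where
  "cauchy_atom \<alpha> \<beta> w m n t =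
     exp (2 * of_real pi * \<i> * of_real \<beta> * of_int n * of_real t)
       / (of_real t - of_real \<alpha> * of_int m - \<i> * of_real w)"

text \<open>The sum is unconditional and taken in the norm of \<^typ>\<open>l2\<close>.\<close>

definition frame_op :: "real \<Rightarrow> real \<Rightarrow> real \<Rightarrow> l2 \<Rightarrow> l2" where
  "frame_op \<alpha> \<beta> w f =
     (\<Sum>\<^sub>\<infinity>(m, n)\<in>UNIV. scaleC_l2 (l2_inner f (abs_l2 (cauchy_atom \<alpha> \<beta> w m n)))
                                 (abs_l2 (cauchy_atom \<alpha> \<beta> w m n)))"

definition cauchy_window :: "real \<Rightarrow> l2" where
  "cauchy_window w = abs_l2 (\<lambda>t. 1 / (of_real t - \<i> * of_real w))"

definition canonical_dual_window :: "real \<Rightarrow> real \<Rightarrow> real \<Rightarrow> l2" where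
  "canonical_dual_window \<alpha> \<beta> w = inv (frame_op \<alpha> \<beta> w) (cauchy_window w)"

definition h_hat :: "real \<Rightarrow> real \<Rightarrow> real \<Rightarrow> real \<Rightarrow> real" where
  "h_hat \<alpha> \<beta> w \<xi> =
     pi * (\<Sum>\<^sub>\<infinity>m::int. indicator {- (1 / (2 * \<alpha>)) .. 1 / (2 * \<alpha>)} (\<xi> - \<beta> * of_int m)
                     * exp (4 * pi * w * (\<xi> - \<beta> * of_int m)))"

definition h_distr :: "real \<Rightarrow> real \<Rightarrow> real \<Rightarrow> distribution" where
  "h_distr \<alpha> \<beta> w = inv_fourier_distr (distr_of (\<lambda>\<xi>. of_real (h_hat \<alpha> \<beta> w \<xi>)))"

definition h_tilde_distr :: "real \<Rightarrow> real \<Rightarrow> real \<Rightarrow> distribution" where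
  "h_tilde_distr \<alpha> \<beta> w = inv_fourier_distr (distr_of (\<lambda>\<xi>. of_real (1 / h_hat \<alpha> \<beta> w \<xi>)))"

end

theory Submission
  imports Defs
begin

text \<open>
  Put \<open>F(t) = f(t) / sin(\<pi>(t + iw)/\<alpha>)\<close>.  Since \<open>sin(\<pi>(t - iw)/\<alpha>) / (t - \<alpha>m - iw)\<close> is band-limited to
  \<open>[-1/(2\<alpha>), 1/(2\<alpha>)]\<close>, Plancherel turns the coefficient of \<open>f\<close> at \<open>(m, n)\<close> into the \<open>m\<close>-th Fourier
  coefficient, up to a unimodular factor, of \<open>\<pi> exp(2\<pi>w(\<xi> - \<beta>n))\<close> times the Fourier transform of
  \<open>F\<close> on the interval of length \<open>1/\<alpha>\<close> centred at \<open>\<beta>n\<close>.  Parseval on each of these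
  intervals, summed over \<open>n\<close>, identifies the quadratic form of the frame operator with \<open>\<pi>/\<alpha>\<close> times
  the integral of \<open>h_hat\<close> against the squared modulus of the transform of \<open>F\<close>; polarization gives the operator.
  All of it rests on Parseval for Fourier series: integrating Parseval over all modulations of a
  compactly supported function yields Plancherel.
\<close>

section \<open>The Hilbert space of square-integrable functions\<close>

text \<open>Since \<open>w > 0\<close>, neither sine vanishes on the real line, and both sines and
  their reciprocals are bounded multipliers. That the phases \<open>t + iw\<close> and
  \<open>t - iw\<close> are conjugate makes the quadratic form depend on \<open>F\<close> alone. The
  frame operator thus factors into invertible maps: two multipliers, the transform and its inverse,
  and multiplication by \<open>h_hat\<close>. Its inverse can be read off. Here \<alpha>\<beta>
  \<le> 1 enters: it lets the intervals of length 1/\<alpha> with centres at the multiples of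
  \<beta> cover the line, which keeps \<open>h_hat\<close> away from 0. Polarization alone yields a
  weak identity, whereas \<open>frame_op\<close> is an unconditional sum in norm; a Bessel bound
  from the same form closes the gap. Convolution is a definite description over distributional
  identities, so evaluating it requires that test functions separate. For the dual window,
  \<alpha>\<beta> \<ge> 1/2 leaves at most one overlapping neighbour almost everywhere on the
  central interval, so the quotient by \<open>h_hat\<close> is
  \<open>exp (- 2 * pi * w * \<eta>)\<close> times a step function.\<close>

lemma l2_rel_iff: "l2_rel f f \<longleftrightarrow> sq_integrable f"
  by (auto simp: l2_rel_def)

lemma sq_integrable_rep [simp, intro]: "sq_integrable (rep_l2 f)"
  using Quotient3_rep_reflp[OF Quotient3_l2] by (simp add: l2_rel_def)

lemma borel_measurable_rep [measurable]: "rep_l2 f \<in> borel_measurable borel"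
  by (rule sq_integrable_measurable) simp

lemma abs_rep_l2 [simp]: "abs_l2 (rep_l2 f) = f"
  by (rule Quotient3_abs_rep[OF Quotient3_l2])

lemma rep_abs_l2:
  assumes "sq_integrable u"
  shows "AE t in lborel. rep_l2 (abs_l2 u) t = u t"
  using rep_abs_rsp_left[OF Quotient3_l2, of u u] assms by (simp add: l2_rel_def)

lemma abs_l2_eqI:
  "sq_integrable u \<Longrightarrow> sq_integrable v \<Longrightarrow> AE t in lborel. u t = v t \<Longrightarrow> abs_l2 u = abs_l2 v"
  using Quotient3_rel_abs[OF Quotient3_l2] by (auto simp: l2_rel_def)

lemma eq_abs_l2I:
  assumes "sq_integrable u" "AE t in lborel. rep_l2 f t = u t"
  shows "f = abs_l2 u"
  using abs_l2_eqI[of "rep_l2 f" u] assms by simp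

lemma abs_l2_add:
  "sq_integrable u \<Longrightarrow> sq_integrable v \<Longrightarrow> abs_l2 u + abs_l2 v = abs_l2 (\<lambda>t. u t + v t)"
  by (simp add: plus_l2.abs_eq l2_rel_iff)

lemma abs_l2_diff:
  "sq_integrable u \<Longrightarrow> sq_integrable v \<Longrightarrow> abs_l2 u - abs_l2 v = abs_l2 (\<lambda>t. u t - v t)"
  by (simp add: minus_l2.abs_eq l2_rel_iff)

lemma abs_l2_scaleC:
  "sq_integrable u \<Longrightarrow> scaleC_l2 c (abs_l2 u) = abs_l2 (\<lambda>t. c * u t)"
  by (simp add: scaleC_l2.abs_eq l2_rel_iff)

lemma rep_l2_add: "AE t in lborel. rep_l2 (f + g) t = rep_l2 f t + rep_l2 g t"
  using rep_abs_l2[of "\<lambda>t. rep_l2 f t + rep_l2 g t"] abs_l2_add[of "rep_l2 f" "rep_l2 g"]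
  by (simp add: sq_integrable_add)

lemma rep_l2_diff: "AE t in lborel. rep_l2 (f - g) t = rep_l2 f t - rep_l2 g t"
  using rep_abs_l2[of "\<lambda>t. rep_l2 f t - rep_l2 g t"] abs_l2_diff[of "rep_l2 f" "rep_l2 g"]
  by (simp add: sq_integrable_diff)

lemma rep_l2_scaleC: "AE t in lborel. rep_l2 (scaleC_l2 c f) t = c * rep_l2 f t"
  using rep_abs_l2[of "\<lambda>t. c * rep_l2 f t"] abs_l2_scaleC[of "rep_l2 f" c]
  by (simp add: sq_integrable_scale)

lemma measurable_cnj [measurable]: "cnj \<in> borel_measurable borel"
  by (intro borel_measurable_continuous_onI continuous_intros)

lemma sq_integrable_cnj: "sq_integrable f \<Longrightarrow> sq_integrable (\<lambda>t. cnj (f t))"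
  by (auto simp: sq_integrable_def)

lemma sq_integrable_mult_integrable:
  assumes "sq_integrable f" "sq_integrable g"
  shows "integrable lborel (\<lambda>t. f t * g t)"
proof -
  have [measurable]: "f \<in> borel_measurable borel" "g \<in> borel_measurable borel"
    using assms by (auto intro: sq_integrable_measurable)
  have "integrable lborel (\<lambda>t. (cmod (f t))\<^sup>2 + (cmod (g t))\<^sup>2)"
    using assms by (auto simp: sq_integrable_def)
  then show ?thesis
  proof (rule Bochner_Integration.integrable_bound)
    show "AE x in lborel. cmod (f x * g x) \<le> norm ((cmod (f x))\<^sup>2 + (cmod (g x))\<^sup>2)"
    proof (rule AE_I2)
      fix x
      have "2 * cmod (f x) * cmod (g x) \<le> (cmod (f x))\<^sup>2 + (cmod (g x))\<^sup>2"
        by (rule sum_squares_bound)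
      then show "cmod (f x * g x) \<le> norm ((cmod (f x))\<^sup>2 + (cmod (g x))\<^sup>2)"
        using mult_nonneg_nonneg[OF norm_ge_zero[of "f x"] norm_ge_zero[of "g x"]]
        unfolding norm_mult real_norm_def by linarith
    qed
  qed auto
qed

lemma l2_inner_rep: "l2_inner f g = (LINT t|lborel. rep_l2 f t * cnj (rep_l2 g t))"
  using l2_inner.abs_eq[of "rep_l2 f" "rep_l2 g"] by (simp add: l2_rel_iff)

lemma norm_l2_rep: "norm f = sqrt (LINT t|lborel. (cmod (rep_l2 f t))\<^sup>2)"
  using norm_l2.abs_eq[of "rep_l2 f"] by (simp add: l2_rel_iff)

lemma l2_inner_abs:
  "sq_integrable u \<Longrightarrow> sq_integrable v \<Longrightarrow>
    l2_inner (abs_l2 u) (abs_l2 v) = (LINT t|lborel. u t * cnj (v t))"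
  by (simp add: l2_inner.abs_eq l2_rel_iff)

lemma l2_inner_abs_right:
  "sq_integrable v \<Longrightarrow> l2_inner f (abs_l2 v) = (LINT t|lborel. rep_l2 f t * cnj (v t))"
  using l2_inner_abs[of "rep_l2 f" v] by simp

lemma l2_inner_add_left: "l2_inner (f + g) k = l2_inner f k + l2_inner g k"
  using l2_inner_abs[OF sq_integrable_add[OF sq_integrable_rep sq_integrable_rep] sq_integrable_rep, of f g k]
    abs_l2_add[of "rep_l2 f" "rep_l2 g"]
  by (simp add: l2_inner_rep distrib_right sq_integrable_mult_integrable sq_integrable_cnj)

lemma l2_inner_scaleC_left: "l2_inner (scaleC_l2 c f) k = c * l2_inner f k"
  using l2_inner_abs[OF sq_integrable_scale[OF sq_integrable_rep] sq_integrable_rep, of c f k]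
    abs_l2_scaleC[of "rep_l2 f" c]
  by (simp add: l2_inner_rep mult.assoc)

lemma integral_cnj: "(LINT t|M. cnj (f t)) = cnj (LINT t|M. f t)"
proof (cases "integrable M f")
  case True
  then show ?thesis by simp
next
  case False
  then have "\<not> integrable M (\<lambda>t. cnj (f t))"
    using integrable_cnj by auto
  then show ?thesis using False by (simp add: not_integrable_integral_eq)
qed

lemma l2_inner_commute: "l2_inner g f = cnj (l2_inner f g)"
  unfolding l2_inner_rep integral_cnj[symmetric] by (simp add: mult.commute)

lemma l2_inner_add_right: "l2_inner k (f + g) = l2_inner k f + l2_inner k g"
  by (subst (1 2 3) l2_inner_commute) (simp add: l2_inner_add_left)

lemma l2_inner_scaleC_right: "l2_inner k (scaleC_l2 c f) = cnj c * l2_inner k f"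
  by (subst (1 2) l2_inner_commute) (simp add: l2_inner_scaleC_left)

lemma scaleC_minus1: "scaleC_l2 (-1) f = - f"
  by transfer (simp add: l2_rel_def sq_integrable_uminus)

lemma l2_inner_zero [simp]: "l2_inner 0 k = 0" "l2_inner k 0 = 0"
  using l2_inner_add_left[of 0 0 k] l2_inner_add_right[of k 0 0] by auto

lemma l2_inner_minus_left: "l2_inner (- f) k = - l2_inner f k"
  unfolding scaleC_minus1[symmetric] l2_inner_scaleC_left by simp

lemma l2_inner_diff_left: "l2_inner (f - g) k = l2_inner f k - l2_inner g k"
  unfolding diff_conv_add_uminus l2_inner_add_left l2_inner_minus_left ..

lemma l2_inner_minus_right: "l2_inner k (- f) = - l2_inner k f"
  unfolding scaleC_minus1[symmetric] l2_inner_scaleC_right by simp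

lemma l2_inner_diff_right: "l2_inner k (f - g) = l2_inner k f - l2_inner k g"
  unfolding diff_conv_add_uminus l2_inner_add_right l2_inner_minus_right ..

lemma l2_inner_sum_left: "l2_inner (\<Sum>i\<in>A. f i) k = (\<Sum>i\<in>A. l2_inner (f i) k)"
  by (induction A rule: infinite_finite_induct) (simp_all add: l2_inner_add_left)

lemma power2_norm_l2_rep: "(norm f)\<^sup>2 = (LINT t|lborel. (cmod (rep_l2 f t))\<^sup>2)"
  by (simp add: norm_l2_rep)

lemma power2_norm_abs_l2:
  "sq_integrable u \<Longrightarrow> (norm (abs_l2 u))\<^sup>2 = (LINT t|lborel. (cmod (u t))\<^sup>2)"
  by (simp add: norm_l2.abs_eq l2_rel_iff)

lemma nn_integral_power2_norm_l2:
  "(\<integral>\<^sup>+t. ennreal ((cmod (rep_l2 f t))\<^sup>2) \<partial>lborel) = ennreal ((norm f)\<^sup>2)"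
  unfolding power2_norm_l2_rep using sq_integrable_rep[of f]
  by (intro nn_integral_eq_integral) (auto simp: sq_integrable_def)

lemma l2_inner_self: "l2_inner f f = of_real ((norm f)\<^sup>2)"
  unfolding l2_inner_rep power2_norm_l2_rep complex_norm_square[symmetric] integral_complex_of_real ..

lemma norm_scaleC: "norm (scaleC_l2 c f) = cmod c * norm f"
proof (rule power2_eq_imp_eq)
  have "complex_of_real ((norm (scaleC_l2 c f))\<^sup>2) = of_real ((cmod c * norm f)\<^sup>2)"
    unfolding l2_inner_self[symmetric] l2_inner_scaleC_left l2_inner_scaleC_right
    by (simp add: l2_inner_self power_mult_distrib)
       (metis complex_norm_square mult.commute of_real_power)
  then show "(norm (scaleC_l2 c f))\<^sup>2 = (cmod c * norm f)\<^sup>2"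
    by (simp only: of_real_eq_iff)
qed auto

lemma l2_Cauchy_Schwarz: "cmod (l2_inner f g) \<le> norm f * norm g"
proof (cases "f = 0 \<or> g = 0")
  case True
  then show ?thesis by auto
next
  case False
  define a b where "a = norm f" and "b = norm g"
  have pos: "a > 0" "b > 0" using False by (auto simp: a_def b_def)
  have int: "integrable lborel (\<lambda>t. (cmod (rep_l2 f t))\<^sup>2)" "integrable lborel (\<lambda>t. (cmod (rep_l2 g t))\<^sup>2)"
    using sq_integrable_rep unfolding sq_integrable_def by auto
  \<comment> \<open>Weighted AM-GM; the weights are chosen so that integrating the right-hand side
    gives exactly \<open>a * b\<close>.\<close>
  have le: "cmod (u * cnj v) \<le> b / (2 * a) * (cmod u)\<^sup>2 + a / (2 * b) * (cmod v)\<^sup>2" for u v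
  proof -
    have "b / (2 * a) * (cmod u)\<^sup>2 + a / (2 * b) * (cmod v)\<^sup>2 - cmod (u * cnj v)
        = (b * cmod u - a * cmod v)\<^sup>2 / (2 * a * b)"
      using pos by (simp add: field_simps power2_eq_square norm_mult)
    also have "\<dots> \<ge> 0" using pos by simp
    finally show ?thesis by simp
  qed
  have "cmod (l2_inner f g) \<le> (LINT t|lborel. cmod (rep_l2 f t * cnj (rep_l2 g t)))"
    unfolding l2_inner_rep by (rule integral_norm_bound)
  also have "\<dots> \<le> (LINT t|lborel. b / (2 * a) * (cmod (rep_l2 f t))\<^sup>2 + a / (2 * b) * (cmod (rep_l2 g t))\<^sup>2)"
    by (rule integral_mono)
       (use int le in \<open>auto intro!: integrable_norm sq_integrable_mult_integrable sq_integrable_cnj\<close>)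
  also have "\<dots> = b / (2 * a) * a\<^sup>2 + a / (2 * b) * b\<^sup>2"
    using int by (simp add: a_def b_def power2_norm_l2_rep)
  also have "\<dots> = a * b"
    using pos by (simp add: field_simps power2_eq_square)
  finally show ?thesis by (simp add: a_def b_def)
qed

lemma l2_eq_zeroI: "(\<And>k. l2_inner f k = 0) \<Longrightarrow> f = 0"
  using l2_inner_self[of f] by simp

lemma l2_eqI_inner:
  assumes "\<And>k. l2_inner f k = l2_inner g k"
  shows "f = g"
  using l2_eq_zeroI[of "f - g"] assms by (simp add: l2_inner_diff_left)

lemma tendsto_l2_inner_left:
  assumes "(X \<longlongrightarrow> f) F"
  shows "((\<lambda>i. l2_inner (X i) k) \<longlongrightarrow> l2_inner f k) F"
proof -
  have "((\<lambda>i. norm (X i - f) * norm k) \<longlongrightarrow> 0) F"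
    using assms by (auto intro!: tendsto_mult_left_zero tendsto_norm_zero simp: LIM_zero_iff)
  then have "((\<lambda>i. l2_inner (X i) k - l2_inner f k) \<longlongrightarrow> 0) F"
    by (rule Lim_null_comparison[rotated])
       (auto simp: l2_inner_diff_left[symmetric] intro!: always_eventually l2_Cauchy_Schwarz)
  then show ?thesis by (simp add: LIM_zero_iff)
qed

lemma l2_polarization:
  "4 * l2_inner f g =
     of_real ((norm (f + g))\<^sup>2) - of_real ((norm (f - g))\<^sup>2)
     + \<i> * of_real ((norm (f + scaleC_l2 \<i> g))\<^sup>2) - \<i> * of_real ((norm (f - scaleC_l2 \<i> g))\<^sup>2)"
  unfolding l2_inner_self[symmetric]
  by (simp add: l2_inner_add_left l2_inner_add_right l2_inner_diff_left l2_inner_diff_right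
      l2_inner_scaleC_left l2_inner_scaleC_right algebra_simps)

section \<open>Completeness of \<open>l2\<close>\<close>

lemma borel_measurable_lim_seq:
  fixes X :: "nat \<Rightarrow> 'a \<Rightarrow> complex"
  assumes "\<And>n. X n \<in> borel_measurable M"
  shows "(\<lambda>t. lim (\<lambda>n. X n t)) \<in> borel_measurable M"
  using assms by measurable

text \<open>A norm bound on the tail passes to a pointwise limit. The conclusion is a nonnegative
  integral because \<open>u\<close> is not yet known to be square integrable; finiteness of the
  bound yields this for \<open>u - f'\<close>. Here \<open>f'\<close> is any representative of
  \<open>f\<close>.\<close>

lemma l2_Fatou:
  fixes X :: "nat \<Rightarrow> l2"
  assumes u: "u \<in> borel_measurable borel"
    and lim: "AE t in lborel. (\<lambda>n. rep_l2 (X n) t) \<longlonglongrightarrow> u t"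
    and bound: "eventually (\<lambda>n. norm (X n - f) \<le> e) sequentially"
    and f: "sq_integrable f'" "f = abs_l2 f'" 
  shows "(\<integral>\<^sup>+t. ennreal ((cmod (u t - f' t))\<^sup>2) \<partial>lborel) \<le> ennreal (e\<^sup>2)"
proof -
  note [measurable] = u sq_integrable_measurable[OF f(1)]
  have "(\<integral>\<^sup>+t. ennreal ((cmod (u t - f' t))\<^sup>2) \<partial>lborel)
      = (\<integral>\<^sup>+t. liminf (\<lambda>n. ennreal ((cmod (rep_l2 (X n) t - f' t))\<^sup>2)) \<partial>lborel)"
  proof (rule nn_integral_cong_AE, use lim in eventually_elim)
    case (elim t)
    have "(\<lambda>n. ennreal ((cmod (rep_l2 (X n) t - f' t))\<^sup>2)) \<longlonglongrightarrow> ennreal ((cmod (u t - f' t))\<^sup>2)"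
      by (intro tendsto_intros elim)
    then show ?case using lim_imp_Liminf[OF sequentially_bot] by metis
  qed
  also have "\<dots> \<le> liminf (\<lambda>n. \<integral>\<^sup>+t. ennreal ((cmod (rep_l2 (X n) t - f' t))\<^sup>2) \<partial>lborel)"
    by (rule nn_integral_liminf) measurable
  also have "\<dots> = liminf (\<lambda>n. ennreal ((norm (X n - f))\<^sup>2))"
  proof -
    have "(\<integral>\<^sup>+t. ennreal ((cmod (rep_l2 (X n) t - f' t))\<^sup>2) \<partial>lborel) = ennreal ((norm (X n - f))\<^sup>2)" for n
    proof -
      have "AE t in lborel. rep_l2 (X n - f) t = rep_l2 (X n) t - f' t"
        using rep_l2_diff[of "X n" f] rep_abs_l2[OF f(1)] unfolding f(2) by eventually_elim simp
      then have "(\<integral>\<^sup>+t. ennreal ((cmod (rep_l2 (X n) t - f' t))\<^sup>2) \<partial>lborel)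
          = (\<integral>\<^sup>+t. ennreal ((cmod (rep_l2 (X n - f) t))\<^sup>2) \<partial>lborel)"
        by (intro nn_integral_cong_AE) auto
      then show ?thesis by (simp add: nn_integral_power2_norm_l2)
    qed
    then show ?thesis by simp
  qed
  also have "\<dots> \<le> ennreal (e\<^sup>2)"
  proof (rule Liminf_le)
    show "\<forall>\<^sub>F n in sequentially. ennreal ((norm (X n - f))\<^sup>2) \<le> ennreal (e\<^sup>2)"
      using bound by eventually_elim (auto intro!: ennreal_leI power_mono)
  qed simp
  finally show ?thesis .
qed

lemma sq_integrableI_nn_integral:
  assumes "u \<in> borel_measurable borel" "(\<integral>\<^sup>+t. ennreal ((cmod (u t))\<^sup>2) \<partial>lborel) < \<infinity>"
  shows "sq_integrable u"
  using assms unfolding sq_integrable_def by (auto intro!: integrableI_nonneg)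

lemma norm_abs_l2_le:
  assumes u: "u \<in> borel_measurable borel" and le: "(\<integral>\<^sup>+t. ennreal ((cmod (u t))\<^sup>2) \<partial>lborel) \<le> ennreal (e\<^sup>2)" and e: "0 \<le> e"
  shows "sq_integrable u" "norm (abs_l2 u) \<le> e"
proof -
  show sq: "sq_integrable u"
    using le by (intro sq_integrableI_nn_integral u) (auto intro: order.strict_trans1)
  have "ennreal ((norm (abs_l2 u))\<^sup>2) \<le> ennreal (e\<^sup>2)"
    using le sq nn_integral_eq_integral[of lborel "\<lambda>t. (cmod (u t))\<^sup>2"]
    by (simp add: power2_norm_abs_l2 sq_integrable_def)
  then show "norm (abs_l2 u) \<le> e" using e by (simp add: ennreal_le_iff power2_le_iff_abs_le)
qed

text \<open>Riesz--Fischer: along a fast subsequence with differences \<open>d n\<close> one has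
  \<open>\<bar>d n\<bar> \<le> (1/2) ^ n + 2 ^ n * \<bar>d n\<bar>\<^sup>2\<close>, and the right-hand sides are summable almost everywhere.\<close>

lemma l2_fast_Cauchy_convergent:
  fixes X :: "nat \<Rightarrow> l2"
  assumes fast: "\<And>n. norm (X (Suc n) - X n) \<le> (1/2) ^ n"
  shows "\<exists>u\<in>borel_measurable borel. AE t in lborel. (\<lambda>n. rep_l2 (X n) t) \<longlonglongrightarrow> u t"
proof -
  define d where "d n = rep_l2 (X (Suc n) - X n)" for n
  have [measurable]: "d n \<in> borel_measurable borel" for n
    by (simp add: d_def)
  have "(\<integral>\<^sup>+t. (\<Sum>n. ennreal (2 ^ n * (cmod (d n t))\<^sup>2)) \<partial>lborel)
      = (\<Sum>n. \<integral>\<^sup>+t. ennreal (2 ^ n * (cmod (d n t))\<^sup>2) \<partial>lborel)"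
    by (rule nn_integral_suminf) auto
  also have "\<dots> \<le> (\<Sum>n. ennreal ((1/2) ^ n))"
  proof (rule suminf_le)
    fix n
    have "(\<integral>\<^sup>+t. ennreal (2 ^ n * (cmod (d n t))\<^sup>2) \<partial>lborel)
        = ennreal (2 ^ n * (norm (X (Suc n) - X n))\<^sup>2)"
      by (simp add: ennreal_mult nn_integral_cmult nn_integral_power2_norm_l2 d_def)
    also have "\<dots> \<le> ennreal (2 ^ n * ((1/2) ^ n)\<^sup>2)"
      by (intro ennreal_leI mult_left_mono power_mono fast) auto
    also have "2 ^ n * ((1/2) ^ n)\<^sup>2 = (1/2 :: real) ^ n"
      by (simp add: power2_eq_square power_mult_distrib[symmetric] mult.assoc[symmetric])
    finally show "(\<integral>\<^sup>+t. ennreal (2 ^ n * (cmod (d n t))\<^sup>2) \<partial>lborel) \<le> ennreal ((1/2) ^ n)" .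
  qed auto
  also have "\<dots> = ennreal (\<Sum>n. (1/2) ^ n)"
    by (rule suminf_ennreal2) (auto intro: summable_geometric)
  finally have fin: "(\<integral>\<^sup>+t. (\<Sum>n. ennreal (2 ^ n * (cmod (d n t))\<^sup>2)) \<partial>lborel) \<noteq> \<infinity>"
    by (auto simp: top_unique)
  have "AE t in lborel. (\<Sum>n. ennreal (2 ^ n * (cmod (d n t))\<^sup>2)) \<noteq> \<infinity>"
    by (rule nn_integral_noteq_infinite[OF _ fin]) auto
  moreover have "AE t in lborel. \<forall>n. d n t = rep_l2 (X (Suc n)) t - rep_l2 (X n) t"
    unfolding AE_all_countable d_def by (intro allI rep_l2_diff)
  ultimately have "AE t in lborel. convergent (\<lambda>n. rep_l2 (X n) t)"
  proof eventually_elim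
    case (elim t)
    have "summable (\<lambda>n. 2 ^ n * (cmod (d n t))\<^sup>2)"
      using elim(1) by (intro summable_suminf_not_top) auto
    then have "summable (\<lambda>n. (1/2) ^ n + 2 ^ n * (cmod (d n t))\<^sup>2)"
      by (intro summable_add summable_geometric) auto
    moreover have "cmod (d n t) \<le> (1/2) ^ n + 2 ^ n * (cmod (d n t))\<^sup>2" for n
    proof -
      have "0 \<le> (1/2) ^ n * (1 - 2 ^ n * cmod (d n t))\<^sup>2 + cmod (d n t)"
        by simp
      also have "\<dots> = (1/2) ^ n + 2 ^ n * (cmod (d n t))\<^sup>2 - cmod (d n t)"
        by (simp add: power2_eq_square field_simps)
      finally show ?thesis by simp
    qed
    ultimately have "summable (\<lambda>n. d n t)"
      by (rule summable_comparison_test'[where N = 0])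
    then have "summable (\<lambda>n. rep_l2 (X (Suc n)) t - rep_l2 (X n) t)"
      using elim(2) by simp
    then show ?case
      unfolding summable_iff_convergent sum_lessThan_telescope[of "\<lambda>n. rep_l2 (X n) t"]
      by (simp add: convergent_diff_const_right_iff)
  qed
  then have "AE t in lborel. (\<lambda>n. rep_l2 (X n) t) \<longlonglongrightarrow> lim (\<lambda>n. rep_l2 (X n) t)"
    by eventually_elim (simp add: convergent_LIMSEQ_iff)
  then show ?thesis
    by (intro bexI[of _ "\<lambda>t. lim (\<lambda>n. rep_l2 (X n) t)"]) (auto intro!: borel_measurable_lim_seq)
qed

lemma Cauchy_fast_subseq:
  fixes X :: "nat \<Rightarrow> 'a::real_normed_vector"
  assumes "Cauchy X"
  obtains r :: "nat \<Rightarrow> nat" where "strict_mono r" "\<And>n. norm (X (r (Suc n)) - X (r n)) \<le> (1/2) ^ n"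
proof -
  have "\<exists>N. \<forall>i\<ge>N. \<forall>j\<ge>N. norm (X i - X j) < (1/2) ^ n" for n
    using assms unfolding Cauchy_iff by (meson zero_less_power half_gt_zero zero_less_one)
  then obtain N where N: "\<And>n i j. i \<ge> N n \<Longrightarrow> j \<ge> N n \<Longrightarrow> norm (X i - X j) < (1/2) ^ n"
    by metis
  \<comment> \<open>The summand \<open>n\<close> makes \<open>r\<close> strictly increasing and the
    accumulated sum dominates \<open>N n\<close>, so the indices need no recursive choice.\<close>
  define r where "r n = n + (\<Sum>k\<le>n. N k)" for n
  have "strict_mono r" by (intro strict_monoI_Suc) (simp add: r_def)
  moreover have "r n \<ge> N n" for n
    using member_le_sum[of n "{..n}" N] by (simp add: r_def trans_le_add2)
  moreover have "r (Suc n) \<ge> r n" for n by (simp add: r_def)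
  ultimately show ?thesis
    by (intro that[of r]) (auto intro!: less_imp_le[OF N] intro: order.trans)
qed

text \<open>The almost everywhere limit \<open>u\<close> of a fast subsequence is compared by Fatou
  with every late member of the full sequence. One such comparison makes \<open>u\<close> square
  integrable; all of them together give convergence of the full sequence and not just of the
  subsequence.\<close>

instance l2 :: complete_space
proof
  fix X :: "nat \<Rightarrow> l2" assume X: "Cauchy X"
  obtain r where r: "strict_mono r" "\<And>n. norm (X (r (Suc n)) - X (r n)) \<le> (1/2) ^ n"
    using Cauchy_fast_subseq[OF X] by blast
  obtain u where u [measurable]: "u \<in> borel_measurable borel"
    and lim: "AE t in lborel. (\<lambda>n. rep_l2 (X (r n)) t) \<longlonglongrightarrow> u t"
    using l2_fast_Cauchy_convergent[of "\<lambda>n. X (r n)"] r(2) by auto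
  have *: "\<exists>N. \<forall>n\<ge>N. sq_integrable (\<lambda>t. u t - rep_l2 (X n) t) \<and> norm (abs_l2 (\<lambda>t. u t - rep_l2 (X n) t)) \<le> e"
    if e: "e > 0" for e
  proof -
    obtain N where N: "\<And>i j. i \<ge> N \<Longrightarrow> j \<ge> N \<Longrightarrow> norm (X i - X j) < e"
      using X e unfolding Cauchy_iff by blast
    show ?thesis
    proof (intro exI[of _ N] allI impI)
      fix n assume n: "n \<ge> N"
      have "\<forall>\<^sub>F k in sequentially. norm (X (r k) - X n) \<le> e"
        using eventually_ge_at_top[of N]
      proof eventually_elim
        case (elim k)
        then show ?case using N[of "r k" n] n seq_suble[OF r(1), of k] by auto
      qed
      then have "(\<integral>\<^sup>+t. ennreal ((cmod (u t - rep_l2 (X n) t))\<^sup>2) \<partial>lborel) \<le> ennreal (e\<^sup>2)"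
        by (intro l2_Fatou[OF u lim]) auto
      then show "sq_integrable (\<lambda>t. u t - rep_l2 (X n) t) \<and> norm (abs_l2 (\<lambda>t. u t - rep_l2 (X n) t)) \<le> e"
        using norm_abs_l2_le[of "\<lambda>t. u t - rep_l2 (X n) t" e] e by auto
    qed
  qed
  obtain N where "sq_integrable (\<lambda>t. u t - rep_l2 (X N) t)"
    using *[of 1] by auto
  from sq_integrable_add[OF this sq_integrable_rep[of "X N"]] have sq: "sq_integrable u"
    by simp
  have "X \<longlonglongrightarrow> abs_l2 u"
  proof (rule metric_LIMSEQ_I)
    fix e :: real assume e: "e > 0"
    obtain N where N: "\<And>n. n \<ge> N \<Longrightarrow> norm (abs_l2 (\<lambda>t. u t - rep_l2 (X n) t)) \<le> e / 2"
      using *[of "e / 2"] e by auto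
    have "dist (X n) (abs_l2 u) < e" if "n \<ge> N" for n
      using N[OF that] abs_l2_diff[OF sq sq_integrable_rep[of "X n"]] e
      by (simp add: dist_norm norm_minus_commute)
    then show "\<exists>N. \<forall>n\<ge>N. dist (X n) (abs_l2 u) < e" by blast
  qed
  then show "convergent X" by (auto simp: convergent_def)
qed

section \<open>Parseval for Fourier series\<close>

definition ec :: "real \<Rightarrow> complex" where
  "ec x = cis (2 * pi * x)"

lemma ec_add: "ec (x + y) = ec x * ec y"
  by (simp add: ec_def cis_mult distrib_left)

lemma ec_0 [simp]: "ec 0 = 1"
  by (simp add: ec_def)

lemma norm_ec [simp]: "cmod (ec x) = 1"
  by (simp add: ec_def)

lemma cnj_ec: "cnj (ec x) = ec (- x)"
  by (simp add: ec_def cis_cnj)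

lemma ec_exp: "ec x = exp (2 * of_real pi * \<i> * of_real x)"
  by (simp add: ec_def cis_conv_exp mult_ac)

lemma ec_of_int [simp]: "ec (of_int n) = 1"
proof -
  have "cos (2 * pi * of_int n) = 1" "sin (2 * pi * of_int n) = 0"
    by (simp_all add: cos_int_2pin sin_int_2pin)
  then show ?thesis by (simp add: ec_def complex_eq_iff)
qed

lemma continuous_on_ec [continuous_intros]:
  "continuous_on A f \<Longrightarrow> continuous_on A (\<lambda>x. ec (f x))"
  unfolding ec_def cis_conv_exp by (intro continuous_intros)

lemma borel_measurable_ec [measurable]: "ec \<in> borel_measurable borel"
  by (intro borel_measurable_continuous_onI continuous_intros)

section \<open>Uniqueness of Fourier coefficients on the circle\<close>

lemma integrable_mult_bounded:
  fixes u v :: "real \<Rightarrow> complex"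
  assumes u: "integrable lborel u" and v: "v \<in> borel_measurable borel"
    and B: "\<And>t. cmod (v t) \<le> B"
  shows "integrable lborel (\<lambda>t. u t * v t)"
proof (rule Bochner_Integration.integrable_bound)
  show "integrable lborel (\<lambda>t. B * cmod (u t))"
    using u by auto
  have "0 \<le> B" using B[of 0] norm_ge_zero[of "v 0"] by linarith
  then show "AE t in lborel. cmod (u t * v t) \<le> norm (B * cmod (u t))"
    using B by (intro AE_I2) (auto simp: norm_mult mult.commute[of B] intro!: mult_left_mono)
qed (use u v in auto)

lemma integrable_mult_ec:
  "integrable lborel u \<Longrightarrow> integrable lborel (\<lambda>t. u t * ec (c * t))"
  by (rule integrable_mult_bounded[where B = 1]) auto

text \<open>Vanishing of all Fourier coefficients. The integral runs over the whole line;
  confinement to one period is imposed only in \<open>trig_null_imp_AE_zero\<close>, so that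
  stability under multiplication by functions of \<open>ec t\<close> can be shown without
  it.\<close>

definition trig_null :: "(real \<Rightarrow> complex) \<Rightarrow> bool" where
  "trig_null u \<longleftrightarrow> integrable lborel u \<and> (\<forall>n::int. (LINT t|lborel. u t * ec (of_int n * t)) = 0)"

lemma trig_null_ec:
  assumes "trig_null u"
  shows "trig_null (\<lambda>t. u t * ec (of_int k * t))"
proof -
  have "(LINT t|lborel. u t * ec (of_int k * t) * ec (of_int n * t)) = 0" for n
  proof -
    have "(\<lambda>t. u t * ec (of_int k * t) * ec (of_int n * t)) = (\<lambda>t. u t * ec (of_int (k + n) * t))"
      by (simp add: fun_eq_iff distrib_right ec_add)
    then show ?thesis using assms unfolding trig_null_def by metis
  qed
  then show ?thesis using assms integrable_mult_ec by (auto simp: trig_null_def)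
qed

lemma trig_null_scale: "trig_null u \<Longrightarrow> trig_null (\<lambda>t. u t * c)"
  unfolding trig_null_def by (simp add: mult.assoc mult.left_commute[of _ c] mult.commute[of _ c])

lemma trig_null_add: "trig_null u \<Longrightarrow> trig_null v \<Longrightarrow> trig_null (\<lambda>t. u t + v t)"
  unfolding trig_null_def by (simp add: distrib_right integrable_mult_ec)

text \<open>Polynomial functions of the point \<open>ec t\<close> in the plane are generated by its
  real and imaginary parts, hence by \<open>ec t\<close> and \<open>ec (- t)\<close>, and
  multiplication by a character only shifts the Fourier coefficients. The function \<open>u\<close>
  is generalized because a product is absorbed one factor at a time.\<close>

lemma trig_null_polynomial:
  assumes "real_polynomial_function p" "trig_null u"
  shows "trig_null (\<lambda>t. u t * of_real (p (ec t)))"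
  using assms
proof (induction arbitrary: u rule: real_polynomial_function.induct)
  case (linear f)
  have "(\<lambda>t. u t * of_real (f (ec t))) =
    (\<lambda>t. u t * ec (of_int 1 * t) * (of_real (f 1) / 2 + of_real (f \<i>) / (2 * \<i>))
       + u t * ec (of_int (-1) * t) * (of_real (f 1) / 2 - of_real (f \<i>) / (2 * \<i>)))"
  proof
    fix t
    have *: "ec t = Re (ec t) *\<^sub>R 1 + Im (ec t) *\<^sub>R \<i>"
      by (simp add: complex_eq_iff)
    have "f (ec t) = Re (ec t) * f 1 + Im (ec t) * f \<i>"
      using linear by (subst *) (simp add: bounded_linear.linear linear_add linear_scale)
    moreover have "complex_of_real (Re (ec t)) = (ec t + ec (-t)) / 2"
        "complex_of_real (Im (ec t)) = (ec t - ec (-t)) / (2 * \<i>)"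
      by (simp_all add: cnj_ec[symmetric] complex_eq_iff)
    ultimately have eq: "complex_of_real (f (ec t)) =
        (ec t + ec (-t)) / 2 * of_real (f 1) + (ec t - ec (-t)) / (2 * \<i>) * of_real (f \<i>)"
      by (simp only: of_real_add of_real_mult)
    then show "u t * of_real (f (ec t)) =
      u t * ec (of_int 1 * t) * (of_real (f 1) / 2 + of_real (f \<i>) / (2 * \<i>))
       + u t * ec (of_int (-1) * t) * (of_real (f 1) / 2 - of_real (f \<i>) / (2 * \<i>))"
      by (simp only: eq) (simp add: field_simps)
  qed
  then show ?case
    by (simp only:) (intro trig_null_add trig_null_scale trig_null_ec linear.prems)
next
  case (const c)
  then show ?case by (rule trig_null_scale)
next
  case (add f g)
  then show ?case by (simp add: distrib_left trig_null_add)
next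
  case (mult f g)
  then show ?case using mult.IH(2)[OF mult.IH(1)] by (simp add: mult.assoc)
qed

text \<open>Stone-Weierstrass on the unit circle: \<open>g\<close> may be replaced by a polynomial,
  for which the integral is zero, at the cost of the uniform error times the integral of
  \<open>cmod (u t)\<close>.\<close>

lemma integral_trig_null_continuous:
  fixes g :: "complex \<Rightarrow> real"
  assumes u: "trig_null u" and g: "continuous_on UNIV g"
  shows "(LINT t|lborel. u t * of_real (g (ec t))) = 0"
proof -
  have int: "integrable lborel u" using u by (simp add: trig_null_def)
  have intc: "integrable lborel (\<lambda>t. u t * of_real (q (ec t)))" if q: "continuous_on UNIV q"
    for q :: "complex \<Rightarrow> real"
  proof -
    have "compact (q ` sphere 0 1)"
      by (intro compact_continuous_image continuous_on_subset[OF q]) auto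
    then have "bounded (q ` sphere 0 1)" by (rule compact_imp_bounded)
    then obtain B where "\<forall>z\<in>sphere 0 1. \<bar>q z\<bar> \<le> B"
      unfolding bounded_iff by auto
    then have B: "\<bar>q z\<bar> \<le> B" if "z \<in> sphere 0 1" for z
      using that by blast
    have [measurable]: "q \<in> borel_measurable borel"
      by (intro borel_measurable_continuous_onI q)
    show ?thesis
      by (rule integrable_mult_bounded[OF int, where B = B]) (auto simp: B)
  qed
  have "cmod (LINT t|lborel. u t * of_real (g (ec t))) \<le> e" if e: "e > 0" for e
  proof -
    \<comment> \<open>The added 1 keeps the denominator positive when the integral of
      \<open>cmod (u t)\<close> is zero.\<close>
    define e' where "e' = e / (1 + (LINT t|lborel. cmod (u t)))"
    have nn: "0 \<le> (LINT t|lborel. cmod (u t))" by simp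
    then have e': "e' > 0" using e unfolding e'_def by (intro divide_pos_pos) linarith+
    obtain p where p: "real_polynomial_function p" "\<And>z. z \<in> sphere 0 1 \<Longrightarrow> \<bar>g z - p z\<bar> < e'"
      using Stone_Weierstrass_real_polynomial_function[of "sphere 0 1" g e'] e' g
      by (metis compact_sphere continuous_on_subset subset_UNIV)
    have pc: "continuous_on UNIV p"
      using p(1) by (intro continuous_on_polymonial_function) (simp add: real_polynomial_function_eq)
    have "(LINT t|lborel. u t * of_real (p (ec t))) = 0"
      using trig_null_polynomial[OF p(1) u] unfolding trig_null_def by (auto dest: spec[of _ 0])
    then have "(LINT t|lborel. u t * of_real (g (ec t)))
        = (LINT t|lborel. u t * of_real (g (ec t)) - u t * of_real (p (ec t)))"
      using intc[OF g] intc[OF pc] by simp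
    also have "cmod \<dots> \<le> (LINT t|lborel. cmod (u t * of_real (g (ec t)) - u t * of_real (p (ec t))))"
      by (rule integral_norm_bound)
    also have "\<dots> \<le> (LINT t|lborel. cmod (u t) * e')"
    proof (rule integral_mono)
      fix t
      have "cmod (u t * of_real (g (ec t)) - u t * of_real (p (ec t))) = cmod (u t) * \<bar>g (ec t) - p (ec t)\<bar>"
        unfolding right_diff_distrib[symmetric] of_real_diff[symmetric] norm_mult norm_of_real ..
      also have "\<dots> \<le> cmod (u t) * e'"
        by (rule mult_left_mono[OF less_imp_le[OF p(2)]]) auto
      finally show "cmod (u t * of_real (g (ec t)) - u t * of_real (p (ec t))) \<le> cmod (u t) * e'" .
    qed (use int intc[OF g] intc[OF pc] in auto)
    also have "\<dots> = (LINT t|lborel. cmod (u t)) * e'" by simp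
    also have "\<dots> \<le> e"
    proof -
      have pos: "0 < 1 + (LINT t|lborel. cmod (u t))" using nn by linarith
      show ?thesis
        unfolding e'_def times_divide_eq_right pos_divide_le_eq[OF pos] using e by (simp add: algebra_simps)
    qed
    finally show ?thesis .
  qed
  then have "cmod (LINT t|lborel. u t * of_real (g (ec t))) \<le> 0"
    by (rule field_le_epsilon[where y = 0, simplified])
  then show ?thesis by simp
qed

text \<open>The indicator of \<open>C\<close> is the pointwise limit of the continuous tents
  \<open>max 0 (1 - real n * infdist z C)\<close>, which lie between 0 and 1. The empty set is split
  off because \<open>infdist\<close> to it is 0 by convention, so that its tents would be constantly
  1.\<close>

lemma integral_trig_null_closed:
  assumes u: "trig_null u" and C: "closed C"
  shows "(LINT t|lborel. u t * indicator C (ec t)) = 0"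
proof (cases "C = {}")
  case False
  have int: "integrable lborel u" using u by (simp add: trig_null_def)
  define g where "g n z = max 0 (1 - real n * infdist z C)" for n z
  have gc: "continuous_on UNIV (g n)" for n
    unfolding g_def by (intro continuous_intros)
  have [measurable]: "g n \<in> borel_measurable borel" for n
    by (intro borel_measurable_continuous_onI gc)
  have [measurable]: "C \<in> sets borel" using C by auto
  have "(\<lambda>n. LINT t|lborel. u t * of_real (g n (ec t))) \<longlonglongrightarrow> (LINT t|lborel. u t * indicator C (ec t))"
  proof (rule integral_dominated_convergence[where w = "\<lambda>t. cmod (u t)"])
    show "AE t in lborel. (\<lambda>n. u t * of_real (g n (ec t))) \<longlonglongrightarrow> u t * indicator C (ec t)"
    proof (rule AE_I2)
      fix t
      have "(\<lambda>n. g n z) \<longlonglongrightarrow> indicator C z" for z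
      proof (cases "z \<in> C")
        case True
        then show ?thesis by (simp add: g_def)
      next
        case nz: False
        have pos: "infdist z C > 0" using infdist_pos_not_in_closed C nz False by blast
        obtain N where N: "real N * infdist z C > 1"
          using reals_Archimedean3[OF pos] by blast
        have "\<forall>\<^sub>F n in sequentially. g n z = 0"
          using eventually_ge_at_top[of N]
        proof eventually_elim
          case (elim n)
          then have "real N * infdist z C \<le> real n * infdist z C"
            using pos by (intro mult_right_mono) auto
          then show ?case using N by (simp add: g_def)
        qed
        then show ?thesis using nz by (simp add: tendsto_eventually)
      qed
      from tendsto_of_real[OF this[of "ec t"]]
      have "(\<lambda>n. complex_of_real (g n (ec t))) \<longlonglongrightarrow> indicator C (ec t)"
        by (simp add: of_real_indicator)
      then show "(\<lambda>n. u t * of_real (g n (ec t))) \<longlonglongrightarrow> u t * indicator C (ec t)"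
        by (rule tendsto_mult_left)
    qed
    show "AE t in lborel. cmod (u t * of_real (g n (ec t))) \<le> cmod (u t)" for n
      by (intro AE_I2) (auto simp: norm_mult g_def infdist_nonneg intro!: mult_left_le)
  qed (use int in auto)
  moreover have "(LINT t|lborel. u t * of_real (g n (ec t))) = 0" for n
    by (rule integral_trig_null_continuous[OF u gc])
  ultimately show ?thesis by (simp add: LIMSEQ_const_iff)
qed simp

lemma ec_inj:
  assumes "ec s = ec t" "0 \<le> s" "s < 1" "0 \<le> t" "t < 1"
  shows "s = t"
proof -
  have "cis (2 * pi * s) = cis (2 * pi * t)" using assms by (simp add: ec_def)
  then have "sin (2 * pi * s) = sin (2 * pi * t) \<and> cos (2 * pi * s) = cos (2 * pi * t)"
    by (simp add: complex_eq_iff)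
  then obtain n :: int where "2 * pi * s = 2 * pi * t + 2 * pi * of_int n"
    unfolding sin_cos_eq_iff by (auto simp: mult_ac)
  then have "2 * pi * s = 2 * pi * (t + of_int n)" by (simp add: distrib_left)
  then have "s = t + of_int n" using pi_neq_zero by simp
  then show ?thesis using assms by auto
qed

lemma Int_stable_range_atMost:
  "Int_stable (range (atMost :: real \<Rightarrow> _))" "range (atMost :: real \<Rightarrow> _) \<subseteq> Pow UNIV"
  by (auto simp: Int_stable_def)

text \<open>The uniqueness theorem. On the support, half-lines correspond to closed arcs under
  \<open>ec\<close>, so \<open>u\<close> integrates to zero over every half-line. These generate the
  Borel sets and are stable under intersection, hence the integral over every Borel set
  vanishes.\<close>

lemma trig_null_imp_AE_zero:
  assumes u: "trig_null u" and supp: "\<And>t. t \<notin> {0..<1} \<Longrightarrow> u t = 0"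
  shows "AE t in lborel. u t = 0"
proof (rule sigma_finite_measure.density_zero[OF sigma_finite_lborel])
  show int: "integrable lborel u" using u by (simp add: trig_null_def)
  have total: "(LINT t|lborel. u t) = 0"
    using u unfolding trig_null_def by (auto dest: spec[of _ 0])
  have intA: "integrable lborel (\<lambda>t. indicator A t *\<^sub>R u t)" if "A \<in> sets borel" for A
    using that int by (intro integrable_mult_indicator) auto
  fix A :: "real set" assume "A \<in> sets lborel"
  then have "A \<in> sigma_sets UNIV (range atMost)"
    unfolding sets_lborel borel_eq_atMost by simp
  with Int_stable_range_atMost have "A \<in> sets borel \<and> set_lebesgue_integral lborel A u = 0"
    unfolding set_lebesgue_integral_def
  proof (induction rule: sigma_sets_induct_disjoint)
    case (basic A)
    then obtain a where A: "A = {..a}" by auto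
    have "(LINT t|lborel. indicator {..a} t *\<^sub>R u t) = 0"
    proof -
      consider "a < 0" | "a \<ge> 1" | "0 \<le> a" "a < 1" by linarith
      then show ?thesis
      proof cases
        case 1
        then have "(\<lambda>t. indicator {..a} t *\<^sub>R u t) = (\<lambda>_. 0)"
          using supp by (auto simp: fun_eq_iff indicator_def)
        then show ?thesis by simp
      next
        case 2
        then have "(\<lambda>t. indicator {..a} t *\<^sub>R u t) = u"
          using supp by (auto simp: fun_eq_iff indicator_def)
        then show ?thesis using total by simp
      next
        case 3
        \<comment> \<open>Injectivity of \<open>ec\<close> on a period identifies
          \<open>t \<le> a\<close> with membership in this arc, which is closed as the continuous
          image of a compact interval.\<close>
        have "compact (ec ` {0..a})"
          by (intro compact_continuous_image continuous_intros) auto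
        then have "closed (ec ` {0..a})" by (rule compact_imp_closed)
        moreover have "(\<lambda>t. indicator {..a} t *\<^sub>R u t) = (\<lambda>t. u t * indicator (ec ` {0..a}) (ec t))"
        proof
          fix t
          show "indicator {..a} t *\<^sub>R u t = u t * indicator (ec ` {0..a}) (ec t)"
          proof (cases "t \<in> {0..<1}")
            case True
            then have "ec t \<in> ec ` {0..a} \<longleftrightarrow> t \<le> a"
              using ec_inj[of t] 3 by fastforce
            then show ?thesis by (simp add: indicator_def)
          qed (simp add: supp)
        qed
        ultimately show ?thesis using integral_trig_null_closed[OF u] by simp
      qed
    qed
    then show ?case by (simp add: A)
  next
    case empty
    then show ?case by simp
  next
    case (compl A)
    then have A: "A \<in> sets borel" by simp
    have "(\<lambda>t. indicator (UNIV - A) t *\<^sub>R u t) = (\<lambda>t. u t - indicator A t *\<^sub>R u t)"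
      by (auto simp: fun_eq_iff indicator_def)
    then show ?case using compl int intA[OF A] total by auto
  next
    case (union A)
    then have A: "\<And>i. A i \<in> sets borel" by simp
    have "(LINT t:(\<Union>i. A i)|lborel. u t) = (\<Sum>i. LINT t:A i|lborel. u t)"
      using union(1) A int
      by (intro lebesgue_integral_countable_add) (auto simp: disjoint_family_on_def set_integrable_def intro!: intA)
    then show ?case using union A by (auto simp: set_lebesgue_integral_def)
  qed
  then show "set_lebesgue_integral lborel A u = 0" by simp
qed

section \<open>Parseval's identity\<close>

lemma l2_inner_sum_right: "l2_inner k (\<Sum>i\<in>A. f i) = (\<Sum>i\<in>A. l2_inner k (f i))"
  by (induction A rule: infinite_finite_induct) (simp_all add: l2_inner_add_right)

text \<open>Turns unconditional sums over the integers into limits of symmetric partial sums, to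
  which sequential completeness and sequential limits apply.\<close>

lemma filterlim_int_intervals:
  "filterlim (\<lambda>N. {- int N..int N}) (finite_subsets_at_top UNIV) sequentially"
  unfolding filterlim_finite_subsets_at_top
proof (intro allI impI)
  fix X :: "int set" assume X: "finite X \<and> X \<subseteq> UNIV"
  define N where "N = (\<Sum>x\<in>X. nat \<bar>x\<bar>)"
  have "nat \<bar>x\<bar> \<le> N" if "x \<in> X" for x
    unfolding N_def using X that by (intro member_le_sum) auto
  then have "X \<subseteq> {- int n..int n}" if "n \<ge> N" for n
    using that by fastforce
  then show "\<forall>\<^sub>F N in sequentially. finite {- int N..int N} \<and> X \<subseteq> {- int N..int N} \<and> {- int N..int N} \<subseteq> UNIV"
    by (intro eventually_mono[OF eventually_ge_at_top[of N]]) auto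
qed

text \<open>Completeness of the system is demanded only relative to \<open>u\<close>: a vector
  orthogonal to every \<open>e n\<close> must be orthogonal to \<open>u\<close>. This suits
  exponentials cut to an interval, which do not span all of \<open>l2\<close>. If \<open>L\<close>
  is the limit of the partial sums, then \<open>u - L\<close> is orthogonal to every
  \<open>e n\<close>, hence to \<open>u\<close> by that hypothesis and to \<open>L\<close> by
  continuity, hence to itself.\<close>

lemma l2_orthonormal_Parseval:
  fixes e :: "int \<Rightarrow> l2"
  assumes orth: "\<And>m n. l2_inner (e m) (e n) = (if m = n then 1 else 0)"
    and complete: "\<And>k. (\<And>n. l2_inner k (e n) = 0) \<Longrightarrow> l2_inner k u = 0"
  shows "((\<lambda>n. (cmod (l2_inner u (e n)))\<^sup>2) has_sum (norm u)\<^sup>2) UNIV"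
proof -
  define c where "c n = l2_inner u (e n)" for n
  define S where "S A = (\<Sum>n\<in>A. scaleC_l2 (c n) (e n))" for A
  have Se: "l2_inner (S A) (e m) = (if m \<in> A then c m else 0)" if "finite A" for A m
    using that by (simp add: S_def l2_inner_sum_left l2_inner_scaleC_left orth if_distrib sum.delta cong: if_cong)
  have cc: "cnj z * z = of_real ((cmod z)\<^sup>2)" for z
    by (simp only: complex_norm_square mult.commute)
  have SS: "(norm (S A))\<^sup>2 = (\<Sum>n\<in>A. (cmod (c n))\<^sup>2)" if A: "finite A" for A
  proof -
    have "complex_of_real ((norm (S A))\<^sup>2) = l2_inner (S A) (S A)"
      by (simp only: l2_inner_self)
    also have "\<dots> = (\<Sum>n\<in>A. cnj (c n) * l2_inner (S A) (e n))"
      by (subst (2) S_def) (simp add: l2_inner_sum_right l2_inner_scaleC_right)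
    also have "\<dots> = (\<Sum>n\<in>A. of_real ((cmod (c n))\<^sup>2))"
      by (intro sum.cong refl) (simp only: Se[OF A] if_True cc)
    finally show ?thesis by (simp only: of_real_sum[symmetric] of_real_eq_iff)
  qed
  have uS: "l2_inner u (S A) = of_real (\<Sum>n\<in>A. (cmod (c n))\<^sup>2)" for A
    unfolding S_def l2_inner_sum_right l2_inner_scaleC_right c_def[symmetric] cc of_real_sum ..
  have bessel: "(\<Sum>n\<in>A. (cmod (c n))\<^sup>2) \<le> (norm u)\<^sup>2" if A: "finite A" for A
  proof -
    have "complex_of_real ((norm (u - S A))\<^sup>2) = of_real ((norm u)\<^sup>2 - (\<Sum>n\<in>A. (cmod (c n))\<^sup>2))"
      unfolding l2_inner_self[symmetric]
      by (simp add: l2_inner_diff_left l2_inner_diff_right uS l2_inner_commute[of "S A" u])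
         (simp add: l2_inner_self SS[OF A] flip: of_real_power of_real_sum)
    then have "(norm (u - S A))\<^sup>2 = (norm u)\<^sup>2 - (\<Sum>n\<in>A. (cmod (c n))\<^sup>2)"
      by (simp only: of_real_eq_iff)
    then show ?thesis by (metis diff_ge_0_iff_ge zero_le_power2)
  qed
  have "(\<lambda>n. (cmod (c n))\<^sup>2) summable_on UNIV"
    by (rule nonneg_bounded_partial_sums_imp_summable_on[where C = "(norm u)\<^sup>2"])
       (auto intro!: eventually_finite_subsets_at_top_weakI bessel)
  then obtain s where s: "((\<lambda>n. (cmod (c n))\<^sup>2) has_sum s) UNIV"
    by (auto simp: summable_on_def)
  define I where "I N = {- int N..int N}" for N
  have fI: "finite (I N)" for N by (simp add: I_def)
  define a where "a N = (\<Sum>n\<in>I N. (cmod (c n))\<^sup>2)" for N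
  have a_lim: "a \<longlonglongrightarrow> s"
    using filterlim_compose[OF s[unfolded has_sum_def] filterlim_int_intervals]
    by (simp add: a_def[abs_def] I_def)
  have S_diff: "(norm (S (I M) - S (I N)))\<^sup>2 = a M - a N" if "N \<le> M" for M N
  proof -
    have sub: "I N \<subseteq> I M" using that by (auto simp: I_def)
    have "S (I M) - S (I N) = S (I M - I N)"
      unfolding S_def by (rule sum_diff[OF fI sub, symmetric])
    then show ?thesis
      unfolding a_def by (simp add: SS fI sum_diff[OF fI sub])
  qed
  have "Cauchy (\<lambda>N. S (I N))"
  proof (rule metric_CauchyI)
    fix \<delta> :: real assume \<delta>: "\<delta> > 0"
    have "Cauchy a" using a_lim by (auto simp: Cauchy_convergent_iff convergent_def)
    then obtain N0 where N0: "\<And>M N. M \<ge> N0 \<Longrightarrow> N \<ge> N0 \<Longrightarrow> \<bar>a M - a N\<bar> < \<delta>\<^sup>2"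
      using \<delta> unfolding Cauchy_iff by (metis zero_less_power real_norm_def)
    have *: "dist (S (I M)) (S (I N)) < \<delta>" if "N0 \<le> N" "N \<le> M" for M N
    proof (rule power2_less_imp_less)
      show "(dist (S (I M)) (S (I N)))\<^sup>2 < \<delta>\<^sup>2"
        using S_diff[OF that(2)] N0[of M N] that by (simp add: dist_norm)
    qed (use \<delta> in auto)
    have "dist (S (I M)) (S (I N)) < \<delta>" if "N0 \<le> N" "N0 \<le> M" for M N
      using *[of N M] *[of M N] that by (cases "N \<le> M") (auto simp: dist_commute)
    then show "\<exists>N0. \<forall>m\<ge>N0. \<forall>n\<ge>N0. dist (S (I m)) (S (I n)) < \<delta>" by blast
  qed
  then obtain L where L: "(\<lambda>N. S (I N)) \<longlonglongrightarrow> L"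
    by (auto simp: Cauchy_convergent_iff convergent_def)
  have Le: "l2_inner L (e m) = c m" for m
  proof -
    have "\<forall>\<^sub>F N in sequentially. l2_inner (S (I N)) (e m) = c m"
      using eventually_ge_at_top[of "nat \<bar>m\<bar>"]
      by eventually_elim (subst Se[OF fI], auto simp: I_def)
    then have "(\<lambda>N. l2_inner (S (I N)) (e m)) \<longlonglongrightarrow> c m"
      by (rule tendsto_eventually)
    then show ?thesis
      using tendsto_l2_inner_left[OF L] LIMSEQ_unique by blast
  qed
  have v: "l2_inner (u - L) (e m) = 0" for m
    by (simp add: l2_inner_diff_left Le c_def)
  have v': "l2_inner (e m) (u - L) = 0" for m
    using v[of m] by (subst l2_inner_commute) simp
  have "l2_inner (S (I N)) (u - L) = 0" for N
    unfolding S_def by (simp add: l2_inner_sum_left l2_inner_scaleC_left v')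
  then have "l2_inner L (u - L) = 0"
    using tendsto_l2_inner_left[OF L, of "u - L"] by (simp add: LIMSEQ_const_iff)
  moreover have "l2_inner u (u - L) = 0"
    using complete[of "u - L", OF v] l2_inner_commute[of u "u - L"] by simp
  ultimately have "u - L = 0"
    using l2_inner_self[of "u - L"] by (simp add: l2_inner_diff_left)
  then have "(\<lambda>N. (norm (S (I N)))\<^sup>2) \<longlonglongrightarrow> (norm u)\<^sup>2"
    using L by (intro tendsto_intros) simp
  then have "a \<longlonglongrightarrow> (norm u)\<^sup>2"
    by (simp add: SS[OF fI] a_def[abs_def])
  then show ?thesis
    using s LIMSEQ_unique[OF a_lim] by (simp add: c_def)
qed

lemma integral_exp_Icc:
  fixes c :: complex
  assumes "c \<noteq> 0" "a \<le> b"
  shows "(LINT t|lborel. indicator {a..b} t * exp (c * of_real t)) = (exp (c * of_real b) - exp (c * of_real a)) / c"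
proof -
  have "(LINT t|lborel. indicator {a..b} t *\<^sub>R exp (c * of_real t)) = exp (c * of_real b) / c - exp (c * of_real a) / c"
  proof (rule integral_FTC_Icc)
    fix x
    have "((\<lambda>z. exp (c * z) / c) has_field_derivative exp (c * of_real x)) (at (of_real x))"
      using assms(1) by (auto intro!: derivative_eq_intros)
    from has_vector_derivative_real_field[OF this]
    show "((\<lambda>x. exp (c * of_real x) / c) has_vector_derivative exp (c * of_real x)) (at x within {a..b})"
      by (rule has_vector_derivative_at_within)
  qed (use assms in \<open>auto intro!: continuous_intros\<close>)
  then show ?thesis by (simp add: diff_divide_distrib scaleR_conv_of_real of_real_indicator)
qed

lemma AE_indicator_Ico_Icc: "AE t in lborel. (indicator {a..<b} t :: 'a::zero_neq_one) = indicator {a..b::real} t"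
  using AE_lborel_singleton[of b] by eventually_elim (auto simp: indicator_def)

lemma integral_ec_period:
  "(LINT t|lborel. indicator {0..<1} t * ec (of_int k * t)) = (if k = 0 then 1 else 0)"
proof (cases "k = 0")
  case True
  have "(LINT t|lborel. complex_of_real (indicator {0..<1::real} t)) = of_real (LINT t|lborel. indicator {0..<1::real} t)"
    by (rule integral_complex_of_real)
  then have "(LINT t|lborel. indicator {0..<1::real} t :: complex) = 1"
    by (simp add: of_real_indicator)
  then show ?thesis using True by simp
next
  case False
  let ?c = "2 * of_real pi * \<i> * of_int k :: complex"
  have ec: "ec (of_int k * t) = exp (?c * of_real t)" for t
    by (simp add: ec_exp mult_ac)
  have "(LINT t|lborel. indicator {0..<1} t * ec (of_int k * t))
      = (LINT t|lborel. indicator {0..1} t * ec (of_int k * t))"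
  proof (rule integral_cong_AE)
    show "AE t in lborel. indicator {0..<1} t * ec (of_int k * t) = indicator {0..1} t * ec (of_int k * t)"
      using AE_indicator_Ico_Icc[of 0 1, where ?'a = complex] by eventually_elim simp
  qed measurable
  also have "\<dots> = (exp (?c * of_real 1) - exp (?c * of_real 0)) / ?c"
    unfolding ec using False by (intro integral_exp_Icc) auto
  also have "\<dots> = 0"
    using ec_of_int[of k] ec[of 1] by simp
  finally show ?thesis using False by simp
qed

lemma cnj_indicator: "cnj (indicator A t) = indicator A t"
  by (simp add: indicator_def)

lemma sq_integrable_bounded_support:
  assumes "v \<in> borel_measurable borel" "\<And>t. cmod (v t) \<le> B" "\<And>t. t \<notin> {a..b} \<Longrightarrow> v t = 0"
  shows "sq_integrable v"
proof (rule sq_integrableI_nn_integral)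
  have "(\<integral>\<^sup>+ t. ennreal ((cmod (v t))\<^sup>2) \<partial>lborel) \<le> (\<integral>\<^sup>+ t. ennreal (B\<^sup>2) * indicator {a..b} t \<partial>lborel)"
  proof (rule nn_integral_mono)
    fix t
    show "ennreal ((cmod (v t))\<^sup>2) \<le> ennreal (B\<^sup>2) * indicator {a..b} t"
      using assms(2)[of t] assms(3)[of t] by (cases "t \<in> {a..b}") (auto intro!: ennreal_leI power_mono)
  qed
  also have "\<dots> = ennreal (B\<^sup>2) * emeasure lborel {a..b}"
    by (rule nn_integral_cmult_indicator) simp
  also have "\<dots> < \<infinity>"
    by (cases "a \<le> b") (simp_all add: ennreal_mult[symmetric])
  finally show "(\<integral>\<^sup>+ t. ennreal ((cmod (v t))\<^sup>2) \<partial>lborel) < \<infinity>" .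
qed fact

lemma Parseval_unit_interval:
  assumes u: "sq_integrable u" and supp: "\<And>t. t \<notin> {0..<1} \<Longrightarrow> u t = 0"
  shows "((\<lambda>n::int. (cmod (LINT t|lborel. u t * ec (of_int n * t)))\<^sup>2) has_sum (LINT t|lborel. (cmod (u t))\<^sup>2)) UNIV"
proof -
  \<comment> \<open>The frequency carries a minus sign because \<open>l2_inner\<close> conjugates
    its second argument.\<close>
  define f where "f n t = indicator {0..<1} t * ec (- of_int n * t)" for n :: int and t
  have f: "sq_integrable (f n)" for n
    by (rule sq_integrable_bounded_support[where a = 0 and b = 1 and B = 1])
       (auto simp: f_def[abs_def] norm_mult indicator_def)
  define e where "e n = abs_l2 (f n)" for n
  have inner_e: "l2_inner k (e n) = (LINT t|lborel. (rep_l2 k t * indicator {0..<1} t) * ec (of_int n * t))" for k n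
    unfolding e_def l2_inner_abs_right[OF f] f_def by (simp add: cnj_ec cnj_indicator mult.assoc)
  have "((\<lambda>n. (cmod (l2_inner (abs_l2 u) (e n)))\<^sup>2) has_sum (norm (abs_l2 u))\<^sup>2) UNIV"
  proof (rule l2_orthonormal_Parseval)
    fix m n
    have "l2_inner (e m) (e n) = (LINT t|lborel. f m t * cnj (f n t))"
      unfolding e_def by (rule l2_inner_abs[OF f f])
    also have "\<dots> = (LINT t|lborel. indicator {0..<1} t * ec (of_int (n - m) * t))"
      by (rule Bochner_Integration.integral_cong)
         (auto simp: f_def cnj_ec indicator_def ec_add[symmetric] algebra_simps)
    finally show "l2_inner (e m) (e n) = (if m = n then 1 else 0)"
      by (subst (asm) integral_ec_period) simp
  next
    fix k assume k: "\<And>n. l2_inner k (e n) = 0"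
    have "sq_integrable (\<lambda>t. indicator {0..<1} t :: complex)"
      by (rule sq_integrable_bounded_support[where a = 0 and b = 1 and B = 1]) (auto simp: indicator_def)
    then have "integrable lborel (\<lambda>t. rep_l2 k t * indicator {0..<1} t)"
      by (intro sq_integrable_mult_integrable) auto
    then have "trig_null (\<lambda>t. rep_l2 k t * indicator {0..<1} t)"
      using k unfolding inner_e trig_null_def by simp
    then have "AE t in lborel. rep_l2 k t * indicator {0..<1} t = 0"
      by (rule trig_null_imp_AE_zero) simp
    then have "AE t in lborel. rep_l2 k t * cnj (u t) = 0"
      by eventually_elim (use supp in \<open>auto simp: indicator_def split: if_splits\<close>)
    then show "l2_inner k (abs_l2 u) = 0"
      unfolding l2_inner_abs_right[OF u] by (rule integral_eq_zero_AE)
  qed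
  moreover have "l2_inner (abs_l2 u) (e n) = (LINT t|lborel. u t * ec (of_int n * t))" for n
    unfolding e_def l2_inner_abs[OF u f] f_def
    by (rule Bochner_Integration.integral_cong) (use supp in \<open>auto simp: cnj_ec indicator_def\<close>)
  ultimately show ?thesis by (simp add: power2_norm_abs_l2[OF u])
qed

lemma sq_integrable_affine:
  "sq_integrable u \<Longrightarrow> c \<noteq> 0 \<Longrightarrow> sq_integrable (\<lambda>t. u (a + c * t))"
  unfolding sq_integrable_def using lborel_integrable_real_affine[of "\<lambda>t. (cmod (u t))\<^sup>2" c a] by auto

text \<open>The substitution \<open>a + L * t\<close> contributes \<open>L\<^sup>2\<close> to the
  squared coefficients but only \<open>L\<close> to the squared norm; the offset \<open>a\<close>
  changes each coefficient by a unimodular factor.\<close>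

lemma Parseval_interval:
  assumes u: "sq_integrable u" and supp: "\<And>t. t \<notin> {a..<a+L} \<Longrightarrow> u t = 0" and L: "L > 0"
  shows "((\<lambda>n::int. (cmod (LINT t|lborel. u t * ec (of_int n * t / L)))\<^sup>2) has_sum L * (LINT t|lborel. (cmod (u t))\<^sup>2)) UNIV"
proof -
  define v where "v t = u (a + L * t)" for t
  have v: "sq_integrable v"
    unfolding v_def[abs_def] using u L by (intro sq_integrable_affine) auto
  have vsupp: "v t = 0" if "t \<notin> {0..<1}" for t
  proof -
    have "a + L * t \<notin> {a..<a+L}"
      using that L by (auto simp: zero_le_mult_iff mult_less_cancel_left1)
    then show ?thesis unfolding v_def by (rule supp)
  qed
  have "((\<lambda>n::int. L\<^sup>2 * (cmod (LINT t|lborel. v t * ec (of_int n * t)))\<^sup>2) has_sum L\<^sup>2 * (LINT t|lborel. (cmod (v t))\<^sup>2)) UNIV"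
    by (intro has_sum_cmult_right Parseval_unit_interval v vsupp)
  moreover have "L\<^sup>2 * (LINT t|lborel. (cmod (v t))\<^sup>2) = L * (LINT t|lborel. (cmod (u t))\<^sup>2)"
    using lborel_integral_real_affine[of L "\<lambda>t. (cmod (u t))\<^sup>2" a] L by (simp add: v_def power2_eq_square)
  moreover have "(cmod (LINT t|lborel. u t * ec (of_int n * t / L)))\<^sup>2 = L\<^sup>2 * (cmod (LINT t|lborel. v t * ec (of_int n * t)))\<^sup>2" for n
  proof -
    have "(LINT t|lborel. u t * ec (of_int n * t / L))
        = L *\<^sub>R (LINT t|lborel. v t * ec (of_int n * (a + L * t) / L))"
      using lborel_integral_real_affine[of L "\<lambda>t. u t * ec (of_int n * t / L)" a] L by (simp add: v_def)
    also have "(\<lambda>t. v t * ec (of_int n * (a + L * t) / L)) = (\<lambda>t. ec (of_int n * a / L) * (v t * ec (of_int n * t)))"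
      using L by (simp add: fun_eq_iff distrib_left add_divide_distrib ec_add mult_ac)
    finally show ?thesis using L by (simp add: norm_mult power_mult_distrib)
  qed
  ultimately show ?thesis by simp
qed

section \<open>The Plancherel transform\<close>

text \<open>Sums of nonnegative terms become integrals over a counting measure, so that Tonelli
  exchanges them with Lebesgue integrals without separate summability proofs.\<close>

lemma has_sum_int_iff_nn_integral:
  fixes f :: "int \<Rightarrow> real"
  assumes f: "\<And>n. 0 \<le> f n" and s: "0 \<le> s"
  shows "(f has_sum s) UNIV \<longleftrightarrow> (\<integral>\<^sup>+n. ennreal (f n) \<partial>count_space UNIV) = ennreal s"
proof -
  have "(f has_sum s) UNIV \<longleftrightarrow> ((\<lambda>k. f (int_decode k)) has_sum s) UNIV"
    using has_sum_reindex_bij_betw[OF bij_int_decode, of f s] by simp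
  also have "\<dots> \<longleftrightarrow> (\<lambda>k. f (int_decode k)) sums s"
    using has_sum_imp_sums sums_nonneg_imp_has_sum f by blast
  also have "\<dots> \<longleftrightarrow> (\<lambda>k. ennreal (f (int_decode k))) sums ennreal s"
    using f s by simp
  also have "\<dots> \<longleftrightarrow> (\<Sum>k. ennreal (f (int_decode k))) = ennreal s"
    by (simp add: sums_iff)
  also have "\<dots> \<longleftrightarrow> (\<integral>\<^sup>+n. ennreal (f n) \<partial>count_space UNIV) = ennreal s"
    using nn_integral_bij_count_space[OF bij_int_decode, of "\<lambda>n. ennreal (f n)"]
    by (simp add: nn_integral_count_space_nat)
  finally show ?thesis .
qed

section \<open>Plancherel for compactly supported functions\<close>

lemma fourier_ec: "fourier \<phi> \<xi> = (LINT t|lborel. \<phi> t * ec (- (\<xi> * t)))"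
  unfolding fourier_def ec_exp by (simp add: mult_ac)

lemma inv_fourier_ec: "inv_fourier \<phi> x = (LINT \<xi>|lborel. \<phi> \<xi> * ec (x * \<xi>))"
  unfolding inv_fourier_def ec_exp by (simp add: mult_ac)

lemma inv_fourier_cnj: "inv_fourier \<phi> x = cnj (fourier (\<lambda>t. cnj (\<phi> t)) x)"
  unfolding inv_fourier_ec fourier_ec integral_cnj[symmetric] by (simp add: cnj_ec)

lemma borel_measurable_fourier [measurable]:
  assumes [measurable]: "f \<in> borel_measurable borel"
  shows "fourier f \<in> borel_measurable borel"
  unfolding fourier_ec[abs_def] by measurable

lemma fourier_cong_AE:
  assumes [measurable]: "f \<in> borel_measurable borel" "g \<in> borel_measurable borel"
    and "AE t in lborel. f t = g t"
  shows "fourier f = fourier g"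
proof
  fix \<xi>
  show "fourier f \<xi> = fourier g \<xi>"
    unfolding fourier_ec by (rule integral_cong_AE) (use assms(3) in auto)
qed

lemma integrable_mult_ec_uminus:
  "integrable lborel u \<Longrightarrow> integrable lborel (\<lambda>t. u t * ec (- (c * t)))"
  using integrable_mult_ec[of u "- c"] by simp

lemma fourier_add:
  "integrable lborel f \<Longrightarrow> integrable lborel g \<Longrightarrow> fourier (\<lambda>t. f t + g t) \<xi> = fourier f \<xi> + fourier g \<xi>"
  unfolding fourier_ec by (simp add: distrib_right integrable_mult_ec_uminus)

lemma fourier_diff:
  "integrable lborel f \<Longrightarrow> integrable lborel g \<Longrightarrow> fourier (\<lambda>t. f t - g t) \<xi> = fourier f \<xi> - fourier g \<xi>"
  unfolding fourier_ec by (simp add: left_diff_distrib integrable_mult_ec_uminus)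

lemma fourier_scale: "fourier (\<lambda>t. c * f t) \<xi> = c * fourier f \<xi>"
  unfolding fourier_ec by (simp add: mult.assoc)

text \<open>The translates of \<open>{0..<1/L}\<close> by multiples of \<open>1/L\<close> tile the
  line: exactly one \<open>n\<close>, namely \<open>- \<lfloor>\<xi> * L\<rfloor>\<close>, moves
  \<open>\<xi>\<close> into this interval.\<close>

lemma nn_integral_periodize:
  fixes G :: "real \<Rightarrow> ennreal"
  assumes [measurable]: "G \<in> borel_measurable borel" and L: "L > 0"
  shows "(\<integral>\<^sup>+\<xi>. G \<xi> \<partial>lborel) = (\<integral>\<^sup>+s. indicator {0..<1/L} s * (\<integral>\<^sup>+n. G (s - of_int n / L) \<partial>count_space UNIV) \<partial>lborel)"
proof -
  let ?I = "\<lambda>n::int. \<lambda>\<xi>. indicator {0..<1/L} (\<xi> + of_int n / L) :: ennreal"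
  have "(\<integral>\<^sup>+n. ?I n \<xi> \<partial>count_space UNIV) = 1" for \<xi>
  proof -
    have "?I n \<xi> = indicator {- \<lfloor>\<xi> * L\<rfloor>} n" for n
    proof -
      have "\<xi> + of_int n / L = (\<xi> * L + of_int n) / L"
        using L by (simp add: field_simps)
      then have "\<xi> + of_int n / L \<in> {0..<1/L} \<longleftrightarrow> 0 \<le> \<xi> * L + of_int n \<and> \<xi> * L + of_int n < 1"
        using L by (simp add: zero_le_divide_iff divide_less_cancel)
      also have "\<dots> \<longleftrightarrow> n = - \<lfloor>\<xi> * L\<rfloor>"
        by linarith
      finally show ?thesis by (auto simp: indicator_def)
    qed
    then show ?thesis by simp
  qed
  then have "(\<integral>\<^sup>+\<xi>. G \<xi> \<partial>lborel) = (\<integral>\<^sup>+\<xi>. \<integral>\<^sup>+n. G \<xi> * ?I n \<xi> \<partial>count_space UNIV \<partial>lborel)"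
    by (simp add: nn_integral_cmult)
  also have "\<dots> = (\<integral>\<^sup>+n. \<integral>\<^sup>+\<xi>. G \<xi> * ?I n \<xi> \<partial>lborel \<partial>count_space UNIV)"
    by (rule nn_integral_count_space_nn_integral) auto
  also have "\<dots> = (\<integral>\<^sup>+n. \<integral>\<^sup>+s. indicator {0..<1/L} s * G (s - of_int n / L) \<partial>lborel \<partial>count_space UNIV)"
  proof (rule nn_integral_cong)
    fix n :: int
    show "(\<integral>\<^sup>+\<xi>. G \<xi> * ?I n \<xi> \<partial>lborel) = (\<integral>\<^sup>+s. indicator {0..<1/L} s * G (s - of_int n / L) \<partial>lborel)"
      by (subst nn_integral_real_affine[where c = 1 and t = "- of_int n / L"])
         (auto simp: mult.commute[of "indicator _ _"] add.commute)
  qed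
  also have "\<dots> = (\<integral>\<^sup>+s. \<integral>\<^sup>+n. indicator {0..<1/L} s * G (s - of_int n / L) \<partial>count_space UNIV \<partial>lborel)"
    by (rule nn_integral_count_space_nn_integral[symmetric]) auto
  also have "\<dots> = (\<integral>\<^sup>+s. indicator {0..<1/L} s * (\<integral>\<^sup>+n. G (s - of_int n / L) \<partial>count_space UNIV) \<partial>lborel)"
    by (simp add: nn_integral_cmult)
  finally show ?thesis .
qed

text \<open>The dense class on which the transform is an honest integral. The support interval is
  half-open so that it is one period in \<open>Parseval_interval\<close>, of length
  \<open>2 * R\<close>.\<close>

definition csq :: "(real \<Rightarrow> complex) \<Rightarrow> bool" where
  "csq f \<longleftrightarrow> sq_integrable f \<and> (\<exists>R>0. \<forall>t. t \<notin> {-R..<R} \<longrightarrow> f t = 0)"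

lemma csq_sq_integrable: "csq f \<Longrightarrow> sq_integrable f"
  by (simp add: csq_def)

lemma csq_borel [measurable_dest]: "csq f \<Longrightarrow> f \<in> borel_measurable borel"
  by (simp add: csq_def sq_integrable_measurable)

lemma csq_integrable:
  assumes "csq f"
  shows "integrable lborel f"
proof -
  obtain R where R: "\<And>t. t \<notin> {-R..<R} \<Longrightarrow> f t = 0" and f: "sq_integrable f"
    using assms unfolding csq_def by blast
  have "sq_integrable (\<lambda>t. indicator {-R..<R} t)"
    by (rule sq_integrable_bounded_support[where a = "-R" and b = R and B = 1]) (auto simp: indicator_def)
  then have "integrable lborel (\<lambda>t. f t * indicator {-R..<R} t)"
    by (rule sq_integrable_mult_integrable[OF f])
  also have "(\<lambda>t. f t * indicator {-R..<R} t) = f"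
    using R by (auto simp: fun_eq_iff indicator_def)
  finally show ?thesis .
qed

lemma csq_cnj: "csq f \<Longrightarrow> csq (\<lambda>t. cnj (f t))"
  by (auto simp: csq_def sq_integrable_cnj)

lemma csq_diff:
  assumes "csq f" "csq g"
  shows "csq (\<lambda>t. f t - g t)"
proof -
  obtain R R' where "R > 0" "R' > 0" "\<And>t. t \<notin> {-R..<R} \<Longrightarrow> f t = 0" "\<And>t. t \<notin> {-R'..<R'} \<Longrightarrow> g t = 0"
    using assms unfolding csq_def by blast
  then have "f t - g t = 0" if "t \<notin> {- (max R R')..<max R R'}" for t
  proof -
    have "t \<notin> {-R..<R}" "t \<notin> {-R'..<R'}" using that by auto
    then show ?thesis using \<open>\<And>t. t \<notin> {-R..<R} \<Longrightarrow> f t = 0\<close> \<open>\<And>t. t \<notin> {-R'..<R'} \<Longrightarrow> g t = 0\<close> by simp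
  qed
  then show ?thesis
    using assms \<open>R > 0\<close> unfolding csq_def by (auto intro!: sq_integrable_diff exI[of _ "max R R'"])
qed

text \<open>Parseval on a period containing the support, applied to all modulations \<open>f t * ec (- s * t)\<close>
  and integrated over \<open>s\<close>.\<close>

lemma nn_integral_fourier_csq:
  assumes f: "csq f"
  shows "(\<integral>\<^sup>+\<xi>. ennreal ((cmod (fourier f \<xi>))\<^sup>2) \<partial>lborel) = ennreal (LINT t|lborel. (cmod (f t))\<^sup>2)"
proof -
  obtain R where R: "R > 0" "\<And>t. t \<notin> {-R..<R} \<Longrightarrow> f t = 0" and sq: "sq_integrable f"
    using f unfolding csq_def by blast
  define L where "L = 2 * R"
  have L: "L > 0" using R by (simp add: L_def)
  note [measurable] = sq_integrable_measurable[OF sq]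
  define J where "J = (LINT t|lborel. (cmod (f t))\<^sup>2)"
  have J: "J \<ge> 0" by (simp add: J_def)
  have inner: "(\<integral>\<^sup>+n. ennreal ((cmod (fourier f (s - of_int n / L)))\<^sup>2) \<partial>count_space (UNIV :: int set)) = ennreal (L * J)" for s
  proof -
    have "sq_integrable (\<lambda>t. ec (- (s * t)) * f t)"
      by (rule sq_integrable_bounded_mult[OF sq]) (auto simp: bounded_iff)
    then have "((\<lambda>n::int. (cmod (LINT t|lborel. (ec (- (s * t)) * f t) * ec (of_int n * t / L)))\<^sup>2)
        has_sum L * (LINT t|lborel. (cmod (ec (- (s * t)) * f t))\<^sup>2)) UNIV"
      by (rule Parseval_interval[where a = "-R"]) (use R L in \<open>auto simp: L_def\<close>)
    moreover have "(LINT t|lborel. (ec (- (s * t)) * f t) * ec (of_int n * t / L)) = fourier f (s - of_int n / L)" for n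
      unfolding fourier_ec
      by (intro Bochner_Integration.integral_cong refl)
         (simp add: ec_add[symmetric] mult.commute mult.left_commute algebra_simps)
    ultimately have "((\<lambda>n::int. (cmod (fourier f (s - of_int n / L)))\<^sup>2) has_sum L * J) UNIV"
      by (simp add: norm_mult J_def)
    then show ?thesis
      using L J by (subst (asm) has_sum_int_iff_nn_integral) auto
  qed
  have "(\<integral>\<^sup>+\<xi>. ennreal ((cmod (fourier f \<xi>))\<^sup>2) \<partial>lborel) = (\<integral>\<^sup>+s. indicator {0..<1/L} s * ennreal (L * J) \<partial>lborel)"
    by (subst nn_integral_periodize[OF _ L]) (simp_all add: inner)
  also have "\<dots> = ennreal (L * J) * emeasure lborel {0..<1/L}"
    by (subst mult.commute) (rule nn_integral_cmult_indicator, simp)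
  \<comment> \<open>The length \<open>1/L\<close> of the fundamental cell cancels the
    \<open>L\<close> from Parseval, so the chosen period leaves no trace.\<close>
  also have "\<dots> = ennreal J"
    using L J by (simp add: ennreal_mult[symmetric])
  finally show ?thesis by (simp add: J_def)
qed

lemma
  assumes f: "csq f"
  shows sq_integrable_fourier_csq: "sq_integrable (fourier f)"
    and norm_fourier_csq: "norm (abs_l2 (fourier f)) = norm (abs_l2 f)"
proof -
  note [measurable] = csq_borel[OF f]
  show sq: "sq_integrable (fourier f)"
    by (rule sq_integrableI_nn_integral) (simp_all add: nn_integral_fourier_csq[OF f])
  have "ennreal ((norm (abs_l2 (fourier f)))\<^sup>2) = ennreal ((norm (abs_l2 f))\<^sup>2)"
    unfolding power2_norm_abs_l2[OF sq] power2_norm_abs_l2[OF csq_sq_integrable[OF f]]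
    using nn_integral_fourier_csq[OF f] nn_integral_eq_integral[of lborel "\<lambda>t. (cmod (fourier f t))\<^sup>2"] sq
    by (simp add: sq_integrable_def)
  then show "norm (abs_l2 (fourier f)) = norm (abs_l2 f)"
    by (simp add: power2_eq_iff_nonneg)
qed

section \<open>The transform on all of \<open>l2\<close>\<close>

definition trunc :: "nat \<Rightarrow> (real \<Rightarrow> complex) \<Rightarrow> real \<Rightarrow> complex" where
  "trunc n f = (\<lambda>t. indicator {- real (Suc n)..<real (Suc n)} t * f t)"

text \<open>The radius \<open>Suc n\<close> is positive already for \<open>n = 0\<close>, as
  \<open>csq\<close> demands.\<close>

lemma csq_trunc: "sq_integrable f \<Longrightarrow> csq (trunc n f)"
  unfolding csq_def trunc_def
  by (auto simp: bounded_iff indicator_def intro!: sq_integrable_bounded_mult exI[of _ 1] exI[of _ "real (Suc n)"])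

lemma trunc_eventually_eq: "\<forall>\<^sub>F n in sequentially. trunc n f t = f t"
  using eventually_ge_at_top[of "nat \<lceil>\<bar>t\<bar>\<rceil>"]
proof eventually_elim
  case (elim n)
  then have "\<bar>t\<bar> \<le> real n" by linarith
  then have "t \<in> {- real (Suc n)..<real (Suc n)}" by auto
  then show ?case by (simp add: trunc_def)
qed

lemma norm_trunc_le: "cmod (trunc n f t) \<le> cmod (f t)"
  by (simp add: trunc_def norm_mult indicator_def)

lemma tendsto_trunc:
  assumes f: "sq_integrable f"
  shows "(\<lambda>n. abs_l2 (trunc n f)) \<longlonglongrightarrow> abs_l2 f"
proof -
  note [measurable] = sq_integrable_measurable[OF f]
  have tr: "sq_integrable (trunc n f)" for n
    by (rule csq_sq_integrable[OF csq_trunc[OF f]])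
  note [measurable] = sq_integrable_measurable[OF tr]
  have eq: "(norm (abs_l2 (trunc n f) - abs_l2 f))\<^sup>2 = (LINT t|lborel. (cmod (trunc n f t - f t))\<^sup>2)" for n
    by (simp add: abs_l2_diff tr f power2_norm_abs_l2 sq_integrable_diff)
  have "(\<lambda>n. LINT t|lborel. (cmod (trunc n f t - f t))\<^sup>2) \<longlonglongrightarrow> integral\<^sup>L lborel (\<lambda>t::real. 0::real)"
  proof (rule integral_dominated_convergence[where w = "\<lambda>t. (cmod (f t))\<^sup>2"])
    show "AE t in lborel. (\<lambda>n. (cmod (trunc n f t - f t))\<^sup>2) \<longlonglongrightarrow> 0"
    proof (rule AE_I2)
      fix t
      show "(\<lambda>n. (cmod (trunc n f t - f t))\<^sup>2) \<longlonglongrightarrow> 0"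
        by (rule tendsto_eventually, rule eventually_mono[OF trunc_eventually_eq[of f t]]) simp
    qed
    show "AE t in lborel. norm ((cmod (trunc n f t - f t))\<^sup>2) \<le> (cmod (f t))\<^sup>2" for n
      by (rule AE_I2) (auto simp: trunc_def indicator_def)
  qed (use f in \<open>auto simp: sq_integrable_def\<close>)
  then have "(\<lambda>n. (norm (abs_l2 (trunc n f) - abs_l2 f))\<^sup>2) \<longlonglongrightarrow> 0"
    by (simp add: eq)
  from tendsto_real_sqrt[OF this] show ?thesis
    by (simp add: tendsto_norm_zero_iff LIM_zero_iff)
qed

text \<open>The Plancherel extension. Truncations serve as the approximating sequence because they
  converge in \<open>l2\<close> and are integrable; the limit exists by isometry and completeness,
  see \<open>tendsto_FT\<close>.\<close>

definition FT :: "l2 \<Rightarrow> l2" where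
  "FT f = lim (\<lambda>n. abs_l2 (fourier (trunc n (rep_l2 f))))"

lemma norm_fourier_diff_csq:
  assumes "csq f" "csq g"
  shows "norm (abs_l2 (fourier f) - abs_l2 (fourier g)) = norm (abs_l2 f - abs_l2 g)"
proof -
  have "fourier (\<lambda>t. f t - g t) = (\<lambda>t. fourier f t - fourier g t)"
    using assms by (simp add: fun_eq_iff fourier_diff csq_integrable)
  then show ?thesis
    using norm_fourier_csq[OF csq_diff[OF assms]] assms
    by (simp add: abs_l2_diff sq_integrable_fourier_csq csq_sq_integrable)
qed

lemma tendsto_FT: "(\<lambda>n. abs_l2 (fourier (trunc n (rep_l2 f)))) \<longlonglongrightarrow> FT f"
proof -
  let ?g = "\<lambda>n. trunc n (rep_l2 f)"
  have "Cauchy (\<lambda>n. abs_l2 (?g n))"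
    using tendsto_trunc[OF sq_integrable_rep] by (auto simp: Cauchy_convergent_iff convergent_def)
  then have "Cauchy (\<lambda>n. abs_l2 (fourier (?g n)))"
    unfolding Cauchy_iff by (simp add: norm_fourier_diff_csq csq_trunc)
  then show ?thesis
    unfolding FT_def by (simp add: Cauchy_convergent_iff convergent_LIMSEQ_iff)
qed

lemma norm_FT [simp]: "norm (FT f) = norm f"
proof -
  have "(\<lambda>n. norm (abs_l2 (trunc n (rep_l2 f)))) \<longlonglongrightarrow> norm f"
    using tendsto_norm[OF tendsto_trunc[OF sq_integrable_rep[of f]]] by simp
  moreover have "(\<lambda>n. norm (abs_l2 (trunc n (rep_l2 f)))) \<longlonglongrightarrow> norm (FT f)"
    using tendsto_norm[OF tendsto_FT[of f]] by (simp add: norm_fourier_csq csq_trunc)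
  ultimately show ?thesis using LIMSEQ_unique by blast
qed

lemma FT_add: "FT (f + g) = FT f + FT g"
proof -
  have "(\<lambda>n. abs_l2 (fourier (trunc n (rep_l2 f))) + abs_l2 (fourier (trunc n (rep_l2 g)))) \<longlonglongrightarrow> FT f + FT g"
    by (intro tendsto_add tendsto_FT)
  moreover have "abs_l2 (fourier (trunc n (rep_l2 f))) + abs_l2 (fourier (trunc n (rep_l2 g)))
      = abs_l2 (fourier (trunc n (rep_l2 (f + g))))" for n
  proof -
    have c: "csq (trunc n (rep_l2 h))" for h by (rule csq_trunc) simp
    have "fourier (trunc n (rep_l2 (f + g))) = fourier (\<lambda>t. trunc n (rep_l2 f) t + trunc n (rep_l2 g) t)"
    proof (rule fourier_cong_AE)
      show "AE t in lborel. trunc n (rep_l2 (f + g)) t = trunc n (rep_l2 f) t + trunc n (rep_l2 g) t"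
        using rep_l2_add[of f g] by eventually_elim (simp add: trunc_def distrib_left)
    qed (use csq_borel[OF c] in auto)
    also have "\<dots> = (\<lambda>\<xi>. fourier (trunc n (rep_l2 f)) \<xi> + fourier (trunc n (rep_l2 g)) \<xi>)"
      by (simp add: fun_eq_iff fourier_add csq_integrable c)
    finally show ?thesis by (simp add: abs_l2_add sq_integrable_fourier_csq c)
  qed
  ultimately show ?thesis using tendsto_FT[of "f + g"] LIMSEQ_unique by auto
qed

lemma tendsto_scaleC:
  assumes "(X \<longlongrightarrow> f) F"
  shows "((\<lambda>i. scaleC_l2 c (X i)) \<longlongrightarrow> scaleC_l2 c f) F"
proof -
  have eq: "scaleC_l2 c (X i) - scaleC_l2 c f = scaleC_l2 c (X i - f)" for i
    by transfer (simp add: l2_rel_def sq_integrable_scale sq_integrable_diff right_diff_distrib)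
  have "((\<lambda>i. cmod c * norm (X i - f)) \<longlongrightarrow> 0) F"
    using assms by (auto intro!: tendsto_mult_right_zero tendsto_norm_zero simp: LIM_zero_iff)
  then have "((\<lambda>i. norm (scaleC_l2 c (X i) - scaleC_l2 c f)) \<longlongrightarrow> 0) F"
    by (simp add: eq norm_scaleC)
  then show ?thesis by (simp add: tendsto_norm_zero_iff LIM_zero_iff)
qed

lemma FT_scaleC: "FT (scaleC_l2 c f) = scaleC_l2 c (FT f)"
proof -
  have "(\<lambda>n. scaleC_l2 c (abs_l2 (fourier (trunc n (rep_l2 f))))) \<longlonglongrightarrow> scaleC_l2 c (FT f)"
    by (intro tendsto_scaleC tendsto_FT)
  moreover have "scaleC_l2 c (abs_l2 (fourier (trunc n (rep_l2 f)))) = abs_l2 (fourier (trunc n (rep_l2 (scaleC_l2 c f))))" for n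
  proof -
    have c: "csq (trunc n (rep_l2 h))" for h by (rule csq_trunc) simp
    have "fourier (trunc n (rep_l2 (scaleC_l2 c f))) = fourier (\<lambda>t. c * trunc n (rep_l2 f) t)"
    proof (rule fourier_cong_AE)
      show "AE t in lborel. trunc n (rep_l2 (scaleC_l2 c f)) t = c * trunc n (rep_l2 f) t"
        using rep_l2_scaleC[of c f] by eventually_elim (simp add: trunc_def mult_ac)
    qed (use csq_borel[OF c] in auto)
    also have "\<dots> = (\<lambda>\<xi>. c * fourier (trunc n (rep_l2 f)) \<xi>)"
      by (simp add: fun_eq_iff fourier_scale)
    finally show ?thesis by (simp add: abs_l2_scaleC sq_integrable_fourier_csq c)
  qed
  ultimately show ?thesis using tendsto_FT[of "scaleC_l2 c f"] LIMSEQ_unique by auto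
qed

lemma FT_diff: "FT (f - g) = FT f - FT g"
  using FT_add[of "f - g" g] by simp

lemma tendsto_FT_comp:
  assumes "(X \<longlongrightarrow> f) F"
  shows "((\<lambda>i. FT (X i)) \<longlongrightarrow> FT f) F"
proof -
  have "((\<lambda>i. norm (FT (X i) - FT f)) \<longlongrightarrow> 0) F"
    using assms by (simp add: FT_diff[symmetric] tendsto_norm_zero_iff LIM_zero_iff)
  then show ?thesis by (simp add: tendsto_norm_zero_iff LIM_zero_iff)
qed

text \<open>The truncations converge pointwise after transformation, and Fatou's lemma identifies that
  limit with the one in \<open>l2\<close>.\<close>

lemma
  assumes f: "sq_integrable f" and int: "integrable lborel f"
  shows sq_integrable_fourier: "sq_integrable (fourier f)"
    and FT_abs_eq: "FT (abs_l2 f) = abs_l2 (fourier f)"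
proof -
  note [measurable] = sq_integrable_measurable[OF f]
  have c: "csq (trunc n f)" "csq (trunc n (rep_l2 (abs_l2 f)))" for n by (simp_all add: csq_trunc f)
  note [measurable] = csq_borel[OF c(1)] csq_borel[OF c(2)]
  define X where "X n = abs_l2 (fourier (trunc n f))" for n
  have "fourier (trunc n (rep_l2 (abs_l2 f))) = fourier (trunc n f)" for n
  proof (rule fourier_cong_AE)
    show "AE t in lborel. trunc n (rep_l2 (abs_l2 f)) t = trunc n f t"
      using rep_abs_l2[OF f] by eventually_elim (simp add: trunc_def)
  qed auto
  then have X: "X \<longlonglongrightarrow> FT (abs_l2 f)"
    using tendsto_FT[of "abs_l2 f"] by (simp add: X_def[abs_def])
  have pt: "(\<lambda>n. fourier (trunc n f) \<xi>) \<longlonglongrightarrow> fourier f \<xi>" for \<xi>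
    unfolding fourier_ec
  proof (rule integral_dominated_convergence[where w = "\<lambda>t. cmod (f t)"])
    show "AE t in lborel. (\<lambda>n. trunc n f t * ec (- (\<xi> * t))) \<longlonglongrightarrow> f t * ec (- (\<xi> * t))"
    proof (rule AE_I2)
      fix t
      show "(\<lambda>n. trunc n f t * ec (- (\<xi> * t))) \<longlonglongrightarrow> f t * ec (- (\<xi> * t))"
        by (rule tendsto_eventually, rule eventually_mono[OF trunc_eventually_eq[of f t]]) simp
    qed
    show "AE t in lborel. cmod (trunc n f t * ec (- (\<xi> * t))) \<le> cmod (f t)" for n
      by (rule AE_I2) (simp add: norm_mult norm_trunc_le)
  qed (use int in auto)
  have "AE \<xi> in lborel. \<forall>n. rep_l2 (X n) \<xi> = fourier (trunc n f) \<xi>"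
    unfolding AE_all_countable X_def by (intro allI rep_abs_l2 sq_integrable_fourier_csq c)
  then have lim: "AE \<xi> in lborel. (\<lambda>n. rep_l2 (X n) \<xi>) \<longlonglongrightarrow> fourier f \<xi>"
    by eventually_elim (simp add: pt)
  have "(\<integral>\<^sup>+\<xi>. ennreal ((cmod (fourier f \<xi> - rep_l2 (FT (abs_l2 f)) \<xi>))\<^sup>2) \<partial>lborel) \<le> 0"
  proof (rule ennreal_le_epsilon)
    fix e :: real assume e: "e > 0"
    have "\<forall>\<^sub>F n in sequentially. norm (X n - FT (abs_l2 f)) \<le> sqrt e"
      using tendstoD[OF X, of "sqrt e"] e by (auto simp: dist_norm elim: eventually_mono)
    from l2_Fatou[OF _ lim this sq_integrable_rep[of "FT (abs_l2 f)"]]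
    show "(\<integral>\<^sup>+\<xi>. ennreal ((cmod (fourier f \<xi> - rep_l2 (FT (abs_l2 f)) \<xi>))\<^sup>2) \<partial>lborel) \<le> 0 + ennreal e"
      using e by simp
  qed
  then have AE: "AE \<xi> in lborel. rep_l2 (FT (abs_l2 f)) \<xi> = fourier f \<xi>"
    by (simp add: nn_integral_0_iff_AE) (auto elim: eventually_mono)
  have "(\<integral>\<^sup>+\<xi>. ennreal ((cmod (fourier f \<xi>))\<^sup>2) \<partial>lborel) = (\<integral>\<^sup>+\<xi>. ennreal ((cmod (rep_l2 (FT (abs_l2 f)) \<xi>))\<^sup>2) \<partial>lborel)"
    by (rule nn_integral_cong_AE) (use AE in \<open>eventually_elim, simp\<close>)
  then show sq: "sq_integrable (fourier f)"
    by (intro sq_integrableI_nn_integral) (simp_all add: nn_integral_power2_norm_l2)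
  show "FT (abs_l2 f) = abs_l2 (fourier f)"
    by (rule eq_abs_l2I[OF sq AE])
qed

text \<open>Fubini for the kernel \<open>ec (- (\<xi> * t))\<close>, which is symmetric in its two
  variables. The transform is thus its own transpose, the source of the adjoint computed in
  \<open>l2_inner_FT_left\<close>.\<close>

lemma integral_fourier_symmetric:
  assumes f: "integrable lborel f" and g: "integrable lborel g"
  shows "(LINT \<xi>|lborel. fourier f \<xi> * g \<xi>) = (LINT t|lborel. f t * fourier g t)"
proof -
  have [measurable]: "f \<in> borel_measurable borel" "g \<in> borel_measurable borel"
    using f g by auto
  have "integrable (lborel \<Otimes>\<^sub>M lborel) (\<lambda>(\<xi>, t). f t * ec (- (\<xi> * t)) * g \<xi>)"
  proof (rule lborel_pair.Fubini_integrable)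
    show "integrable lborel (\<lambda>\<xi>. LINT t|lborel. cmod (case (\<xi>, t) of (\<xi>, t) \<Rightarrow> f t * ec (- (\<xi> * t)) * g \<xi>))"
      using g by (simp add: norm_mult)
    show "AE \<xi> in lborel. integrable lborel (\<lambda>t. case (\<xi>, t) of (\<xi>, t) \<Rightarrow> f t * ec (- (\<xi> * t)) * g \<xi>)"
      using f by (auto intro!: AE_I2 integrable_mult_ec_uminus)
  qed measurable
  from lborel_pair.Fubini_integral[OF this]
  have "(LINT t|lborel. LINT \<xi>|lborel. f t * ec (- (\<xi> * t)) * g \<xi>) = (LINT \<xi>|lborel. LINT t|lborel. f t * ec (- (\<xi> * t)) * g \<xi>)" .
  moreover have "(LINT \<xi>|lborel. f t * ec (- (\<xi> * t)) * g \<xi>) = f t * fourier g t" for t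
    unfolding fourier_ec integral_mult_right_zero[symmetric]
    by (intro Bochner_Integration.integral_cong refl) (simp add: mult_ac)
  moreover have "(LINT t|lborel. f t * ec (- (\<xi> * t)) * g \<xi>) = fourier f \<xi> * g \<xi>" for \<xi>
    unfolding fourier_ec by simp
  ultimately show ?thesis by (simp only:)
qed

section \<open>The inverse transform\<close>

lift_definition cnj_l2 :: "l2 \<Rightarrow> l2" is "\<lambda>f t. cnj (f t)"
  by (rule l2_rel_cong1[where F = cnj]) (auto intro: sq_integrable_cnj)

lemma cnj_abs_l2: "sq_integrable u \<Longrightarrow> cnj_l2 (abs_l2 u) = abs_l2 (\<lambda>t. cnj (u t))"
  by (simp add: cnj_l2.abs_eq l2_rel_iff)

lemma norm_cnj_l2 [simp]: "norm (cnj_l2 f) = norm f"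
  by transfer simp

lemma cnj_l2_diff: "cnj_l2 (f - g) = cnj_l2 f - cnj_l2 g"
  by transfer (simp add: l2_rel_def sq_integrable_cnj sq_integrable_diff)

lemma tendsto_cnj_l2:
  assumes "(X \<longlongrightarrow> f) F"
  shows "((\<lambda>i. cnj_l2 (X i)) \<longlongrightarrow> cnj_l2 f) F"
proof -
  have "((\<lambda>i. norm (cnj_l2 (X i) - cnj_l2 f)) \<longlongrightarrow> 0) F"
    using assms by (simp add: cnj_l2_diff[symmetric] tendsto_norm_zero_iff LIM_zero_iff)
  then show ?thesis by (simp add: tendsto_norm_zero_iff LIM_zero_iff)
qed

text \<open>Conjugation on both sides reverses the sign in the exponent, so facts about
  \<open>IFT\<close> follow from those about \<open>FT\<close>; that the two are inverse to each
  other is the content of \<open>IFT_FT\<close> and \<open>FT_IFT\<close>.\<close>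

definition IFT :: "l2 \<Rightarrow> l2" where
  "IFT f = cnj_l2 (FT (cnj_l2 f))"

lemma norm_IFT [simp]: "norm (IFT f) = norm f"
  by (simp add: IFT_def)

lemma tendsto_l2_inner_right:
  "(X \<longlongrightarrow> f) F \<Longrightarrow> ((\<lambda>i. l2_inner k (X i)) \<longlongrightarrow> l2_inner k f) F"
  by (subst (1 2) l2_inner_commute) (intro tendsto_cnj tendsto_l2_inner_left)

text \<open>The multiplication formula gives this for truncations; the two arguments are then sent
  to their limits one after the other, each time by continuity of the inner product.\<close>

lemma l2_inner_FT_left: "l2_inner (FT f) g = l2_inner f (IFT g)"
proof -
  let ?f = "\<lambda>n. trunc n (rep_l2 f)" and ?g = "\<lambda>n. trunc n (rep_l2 g)"
  have c: "csq (trunc n (rep_l2 h))" for n h by (rule csq_trunc) simp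
  have eq: "l2_inner (FT (abs_l2 (?f n))) (abs_l2 (?g m)) = l2_inner (abs_l2 (?f n)) (IFT (abs_l2 (?g m)))" for n m
  proof -
    note cc = c[of n f] csq_cnj[OF c[of m g]]
    have "l2_inner (FT (abs_l2 (?f n))) (abs_l2 (?g m)) = (LINT \<xi>|lborel. fourier (?f n) \<xi> * cnj (?g m \<xi>))"
      by (simp add: FT_abs_eq csq_integrable csq_sq_integrable sq_integrable_fourier_csq c l2_inner_abs)
    also have "\<dots> = (LINT t|lborel. ?f n t * fourier (\<lambda>t. cnj (?g m t)) t)"
      by (rule integral_fourier_symmetric) (use csq_integrable[OF cc(1)] csq_integrable[OF cc(2)] in simp_all)
    also have "\<dots> = l2_inner (abs_l2 (?f n)) (IFT (abs_l2 (?g m)))"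
      unfolding IFT_def
      by (simp add: FT_abs_eq csq_integrable csq_sq_integrable sq_integrable_fourier_csq c csq_cnj l2_inner_abs cnj_abs_l2
          sq_integrable_cnj)
    finally show ?thesis .
  qed
  have F: "(\<lambda>n. abs_l2 (?f n)) \<longlonglongrightarrow> f" and G: "(\<lambda>n. abs_l2 (?g n)) \<longlonglongrightarrow> g"
    using tendsto_trunc[OF sq_integrable_rep[of f]] tendsto_trunc[OF sq_integrable_rep[of g]] by auto
  have "l2_inner (FT f) (abs_l2 (?g m)) = l2_inner f (IFT (abs_l2 (?g m)))" for m
    using tendsto_l2_inner_left[OF tendsto_FT_comp[OF F], of "abs_l2 (?g m)"]
      tendsto_l2_inner_left[OF F, of "IFT (abs_l2 (?g m))"]
    unfolding eq by (rule LIMSEQ_unique)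
  then show ?thesis
    using tendsto_l2_inner_right[OF G, of "FT f"]
      tendsto_l2_inner_right[OF tendsto_cnj_l2[OF tendsto_FT_comp[OF tendsto_cnj_l2[OF G]]], of f]
    unfolding IFT_def by (auto intro: LIMSEQ_unique)
qed

lemma l2_inner_FT_FT: "l2_inner (FT f) (FT g) = l2_inner f g"
proof -
  have "4 * l2_inner (FT f) (FT g) = 4 * l2_inner f g"
    unfolding l2_polarization
    by (simp add: FT_add[symmetric] FT_diff[symmetric] FT_scaleC[symmetric])
  then show ?thesis by simp
qed

lemma l2_inner_cnj_cnj: "l2_inner (cnj_l2 f) (cnj_l2 g) = cnj (l2_inner f g)"
proof -
  have "l2_inner (cnj_l2 f) (cnj_l2 g) = l2_inner (abs_l2 (\<lambda>t. cnj (rep_l2 f t))) (abs_l2 (\<lambda>t. cnj (rep_l2 g t)))"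
    by (simp add: cnj_abs_l2[symmetric])
  also have "\<dots> = (LINT t|lborel. cnj (rep_l2 f t * cnj (rep_l2 g t)))"
    by (simp add: l2_inner_abs sq_integrable_cnj)
  finally show ?thesis by (simp only: integral_cnj l2_inner_rep)
qed

lemma l2_inner_IFT_IFT: "l2_inner (IFT f) (IFT g) = l2_inner f g"
  by (simp add: IFT_def l2_inner_cnj_cnj l2_inner_FT_FT)

text \<open>Inversion is formal: \<open>IFT\<close> is the adjoint of \<open>FT\<close>, and
  \<open>FT\<close> preserves inner products, so \<open>IFT (FT f)\<close> and \<open>f\<close> have
  the same inner product with every vector.\<close>

lemma IFT_FT [simp]: "IFT (FT f) = f"
proof (rule l2_eqI_inner)
  fix k
  have "l2_inner k (IFT (FT f)) = l2_inner k f"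
    by (simp add: l2_inner_FT_left[symmetric] l2_inner_FT_FT)
  then show "l2_inner (IFT (FT f)) k = l2_inner f k"
    by (subst (1 2) l2_inner_commute) simp
qed

lemma FT_IFT [simp]: "FT (IFT f) = f"
  by (rule l2_eqI_inner) (simp add: l2_inner_FT_left l2_inner_IFT_IFT)

lemma
  assumes f: "sq_integrable f" and int: "integrable lborel f"
  shows sq_integrable_inv_fourier: "sq_integrable (inv_fourier f)"
    and IFT_abs_eq: "IFT (abs_l2 f) = abs_l2 (inv_fourier f)"
proof -
  have g: "sq_integrable (\<lambda>t. cnj (f t))" "integrable lborel (\<lambda>t. cnj (f t))"
    using f int by (auto intro: sq_integrable_cnj)
  have eq: "inv_fourier f = (\<lambda>x. cnj (fourier (\<lambda>t. cnj (f t)) x))"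
    by (simp add: fun_eq_iff inv_fourier_cnj)
  show "sq_integrable (inv_fourier f)"
    unfolding eq by (intro sq_integrable_cnj sq_integrable_fourier g)
  show "IFT (abs_l2 f) = abs_l2 (inv_fourier f)"
    unfolding IFT_def eq cnj_abs_l2[OF f] FT_abs_eq[OF g] cnj_abs_l2[OF sq_integrable_fourier[OF g]] ..
qed

section \<open>Schwartz functions and convolutions\<close>

lemma abs_l2_eq_imp_AE:
  assumes "abs_l2 u = abs_l2 v" "sq_integrable u" "sq_integrable v"
  shows "AE t in lborel. u t = v t"
  using rep_abs_l2[OF assms(2)] rep_abs_l2[OF assms(3)] unfolding assms(1)
  by eventually_elim simp

lemma nn_integral_inverse_quadratic: "(\<integral>\<^sup>+x. ennreal (1 / (1 + x\<^sup>2)) \<partial>lborel) < \<infinity>"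
proof -
  have half: "(\<integral>\<^sup>+x. ennreal (1 / (1 + x\<^sup>2)) * indicator {0..} x \<partial>lborel) = ennreal (pi / 2 - arctan 0)"
  proof (rule nn_integral_FTC_atLeast)
    show "(arctan has_real_derivative 1 / (1 + x\<^sup>2)) (at x)" for x
      using DERIV_arctan[of x] by (simp add: inverse_eq_divide)
  qed (auto intro: tendsto_arctan_at_top)
  have "(\<integral>\<^sup>+x. ennreal (1 / (1 + x\<^sup>2)) * indicator {..0} x \<partial>lborel)
      = (\<integral>\<^sup>+x. ennreal (1 / (1 + x\<^sup>2)) * indicator {0..} x \<partial>lborel)"
    by (subst nn_integral_real_affine[where c = "-1" and t = 0]) (auto simp: indicator_def)
  note half' = this[unfolded half]
  have "(\<integral>\<^sup>+x. ennreal (1 / (1 + x\<^sup>2)) \<partial>lborel)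
      \<le> (\<integral>\<^sup>+x. ennreal (1 / (1 + x\<^sup>2)) * indicator {0..} x + ennreal (1 / (1 + x\<^sup>2)) * indicator {..0} x \<partial>lborel)"
    by (intro nn_integral_mono) (auto simp: indicator_def)
  also have "\<dots> = ennreal (pi / 2 - arctan 0) + ennreal (pi / 2 - arctan 0)"
    by (subst nn_integral_add) (simp_all only: half half', measurable)
  also have "\<dots> < \<infinity>" by simp
  finally show ?thesis .
qed

lemma integrable_inverse_quadratic: "integrable lborel (\<lambda>x::real. 1 / (1 + x\<^sup>2))"
  using nn_integral_inverse_quadratic by (intro integrableI_nonneg) auto

lemma schwartz_differentiable: "\<phi> \<in> schwartz \<Longrightarrow> \<phi> differentiable at x"
  unfolding schwartz_def by (auto dest: spec[of _ 0])

lemma schwartz_bounded: "\<phi> \<in> schwartz \<Longrightarrow> bounded (range (\<lambda>x. of_real (x ^ k) * \<phi> x))"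
  unfolding schwartz_def by (auto dest: spec[of _ 0])

lemma schwartz_vderiv:
  assumes "\<phi> \<in> schwartz"
  shows "vderiv \<phi> \<in> schwartz"
proof -
  have "(vderiv ^^ n) (vderiv \<phi>) = (vderiv ^^ Suc n) \<phi>" for n
    by (simp only: funpow_Suc_right o_apply)
  then show ?thesis
    using assms unfolding schwartz_def mem_Collect_eq by metis
qed

lemma schwartz_borel [measurable_dest]:
  assumes "\<phi> \<in> schwartz"
  shows "\<phi> \<in> borel_measurable borel"
  by (intro borel_measurable_continuous_onI continuous_at_imp_continuous_on ballI
      differentiable_imp_continuous_within schwartz_differentiable[OF assms])

lemma schwartz_decay:
  assumes "\<phi> \<in> schwartz"
  obtains C where "\<And>x. cmod (\<phi> x) \<le> C * (1 / (1 + x\<^sup>2))"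
proof -
  obtain A where A: "\<And>x. cmod (\<phi> x) \<le> A"
    using schwartz_bounded[OF assms, of 0] unfolding bounded_iff by auto
  obtain B where B: "\<And>x. cmod (of_real (x ^ 2) * \<phi> x) \<le> B"
    using schwartz_bounded[OF assms, of 2] unfolding bounded_iff by blast
  have "cmod (\<phi> x) \<le> (A + B) * (1 / (1 + x\<^sup>2))" for x
  proof -
    have pos: "0 < 1 + x\<^sup>2" by (simp add: add_pos_nonneg)
    have "x\<^sup>2 * cmod (\<phi> x) \<le> B"
      using B[of x] by (simp add: norm_mult norm_power)
    then have "cmod (\<phi> x) * (1 + x\<^sup>2) \<le> A + B"
      using A[of x] by (simp add: algebra_simps)
    then show ?thesis using pos by (simp add: pos_le_divide_eq)
  qed
  then show ?thesis by (rule that)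
qed

lemma schwartz_integrable:
  assumes "\<phi> \<in> schwartz"
  shows "integrable lborel \<phi>"
proof -
  note [measurable] = schwartz_borel[OF assms]
  obtain C where C: "\<And>x. cmod (\<phi> x) \<le> C * (1 / (1 + x\<^sup>2))"
    using schwartz_decay[OF assms] by blast
  have "integrable lborel (\<lambda>x::real. C * (1 / (1 + x\<^sup>2)))"
    by (intro integrable_mult_right integrable_inverse_quadratic)
  then show ?thesis
    by (rule Bochner_Integration.integrable_bound)
       (use order.trans[OF C abs_ge_self] in \<open>auto simp only: real_norm_def intro!: AE_I2\<close>, measurable)
qed

lemma schwartz_sq_integrable:
  assumes "\<phi> \<in> schwartz"
  shows "sq_integrable \<phi>"
proof -
  note [measurable] = schwartz_borel[OF assms]
  obtain B where B: "\<And>x. cmod (\<phi> x) \<le> B"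
    using schwartz_bounded[OF assms, of 0] unfolding bounded_iff by auto
  have "integrable lborel (\<lambda>x. B * cmod (\<phi> x))"
    using schwartz_integrable[OF assms] by auto
  then have "integrable lborel (\<lambda>x. (cmod (\<phi> x))\<^sup>2)"
  proof (rule Bochner_Integration.integrable_bound)
    have "0 \<le> B" using B[of 0] norm_ge_zero[of "\<phi> 0"] by linarith
    then show "AE x in lborel. norm ((cmod (\<phi> x))\<^sup>2) \<le> norm (B * cmod (\<phi> x))"
      by (intro AE_I2) (simp add: power2_eq_square mult_right_mono B)
  qed auto
  then show ?thesis by (simp add: sq_integrable_def)
qed

text \<open>Integration by parts on \<open>{- real n..real n}\<close>: \<open>g\<close> is the
  derivative of \<open>\<phi> t * ec (- (\<xi> * t))\<close>, and the boundary terms vanish in the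
  limit by quadratic decay.\<close>

lemma schwartz_fourier_vderiv:
  assumes \<phi>: "\<phi> \<in> schwartz"
  shows "fourier (vderiv \<phi>) \<xi> = 2 * of_real pi * \<i> * of_real \<xi> * fourier \<phi> \<xi>"
proof -
  note \<phi>' = schwartz_vderiv[OF \<phi>]
  define c where "c = - 2 * of_real pi * \<i> * of_real \<xi>"
  have ec: "ec (- (\<xi> * t)) = exp (c * of_real t)" for t
    by (simp add: c_def ec_exp mult_ac)
  define g where "g t = vderiv \<phi> t * ec (- (\<xi> * t)) + c * (\<phi> t * ec (- (\<xi> * t)))" for t
  have int: "integrable lborel (\<lambda>t. vderiv \<phi> t * ec (- (\<xi> * t)))" "integrable lborel (\<lambda>t. \<phi> t * ec (- (\<xi> * t)))"
    by (intro integrable_mult_ec_uminus schwartz_integrable \<phi> \<phi>')+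
  then have g_int: "integrable lborel g" unfolding g_def[abs_def] by auto
  note [measurable] = borel_measurable_integrable[OF g_int]
  have cont: "continuous_on A \<psi>" if "\<psi> \<in> schwartz" for A \<psi>
    by (intro continuous_at_imp_continuous_on ballI differentiable_imp_continuous_within schwartz_differentiable[OF that])
  have FTC: "(LINT t|lborel. indicator {- real n..real n} t *\<^sub>R g t)
      = \<phi> (real n) * ec (- (\<xi> * real n)) - \<phi> (- real n) * ec (- (\<xi> * - real n))" for n
  proof (rule integral_FTC_Icc)
    fix t
    have "(\<phi> has_vector_derivative vderiv \<phi> t) (at t)"
      using schwartz_differentiable[OF \<phi>, of t] by (simp add: vderiv_def vector_derivative_works)
    moreover have "((\<lambda>t. ec (- (\<xi> * t))) has_vector_derivative c * ec (- (\<xi> * t))) (at t)"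
    proof -
      have "((\<lambda>z. exp (c * z)) has_field_derivative c * exp (c * of_real t)) (at (of_real t))"
        by (auto intro!: derivative_eq_intros)
      from has_vector_derivative_real_field[OF this] show ?thesis by (simp add: ec)
    qed
    ultimately have "((\<lambda>t. \<phi> t * ec (- (\<xi> * t))) has_vector_derivative g t) (at t)"
      by (rule has_vector_derivative_eq_rhs[OF has_vector_derivative_mult]) (simp add: g_def)
    then show "((\<lambda>t. \<phi> t * ec (- (\<xi> * t))) has_vector_derivative g t) (at t within {- real n..real n})"
      by (rule has_vector_derivative_at_within)
    show "continuous_on {- real n..real n} g"
      unfolding g_def[abs_def] by (intro continuous_intros cont \<phi> \<phi>')
  qed simp
  have "(\<lambda>n. LINT t|lborel. indicator {- real n..real n} t *\<^sub>R g t) \<longlonglongrightarrow> (LINT t|lborel. g t)"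
  proof (rule integral_dominated_convergence[where w = "\<lambda>t. cmod (g t)"])
    show "AE t in lborel. (\<lambda>n. indicator {- real n..real n} t *\<^sub>R g t) \<longlonglongrightarrow> g t"
    proof (rule AE_I2)
      fix t
      have "\<forall>\<^sub>F n in sequentially. indicator {- real n..real n} t *\<^sub>R g t = g t"
        using eventually_ge_at_top[of "nat \<lceil>\<bar>t\<bar>\<rceil>"]
      proof eventually_elim
        case (elim n)
        then have "\<bar>t\<bar> \<le> real n" by linarith
        then have "t \<in> {- real n..real n}" by auto
        then show ?case by simp
      qed
      then show "(\<lambda>n. indicator {- real n..real n} t *\<^sub>R g t) \<longlonglongrightarrow> g t"
        by (rule tendsto_eventually)
    qed
    show "AE t in lborel. cmod (indicator {- real n..real n} t *\<^sub>R g t) \<le> cmod (g t)" for n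
      by (rule AE_I2) (simp add: indicator_def)
  qed (use g_int in auto)
  moreover have "(\<lambda>n. LINT t|lborel. indicator {- real n..real n} t *\<^sub>R g t) \<longlonglongrightarrow> 0"
  proof -
    obtain C where C: "\<And>x. cmod (\<phi> x) \<le> C * (1 / (1 + x\<^sup>2))"
      using schwartz_decay[OF \<phi>] by blast
    have "(\<lambda>n. 2 * C * (1 / (1 + (real n)\<^sup>2))) \<longlonglongrightarrow> 2 * C * 0"
    proof (intro tendsto_mult_left tendsto_divide_0[OF tendsto_const] filterlim_at_top_imp_at_infinity)
      show "filterlim (\<lambda>n. 1 + (real n)\<^sup>2) at_top sequentially"
        by (intro filterlim_tendsto_add_at_top[OF tendsto_const] filterlim_pow_at_top filterlim_real_sequentially) simp
    qed
    moreover have "cmod (LINT t|lborel. indicator {- real n..real n} t *\<^sub>R g t) \<le> 2 * C * (1 / (1 + (real n)\<^sup>2))" for n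
    proof -
      have "cmod (\<phi> (real n) * ec (- (\<xi> * real n)) - \<phi> (- real n) * ec (- (\<xi> * - real n)))
          \<le> cmod (\<phi> (real n)) + cmod (\<phi> (- real n))"
        by (rule order.trans[OF norm_triangle_ineq4]) (simp add: norm_mult)
      also have "\<dots> \<le> 2 * C * (1 / (1 + (real n)\<^sup>2))"
        using C[of "real n"] C[of "- real n"] by simp
      finally show ?thesis
        unfolding FTC .
    qed
    ultimately show ?thesis
      unfolding mult_zero_right by (rule Lim_null_comparison[OF always_eventually[OF allI], rotated])
  qed
  ultimately have "(LINT t|lborel. g t) = 0" using LIMSEQ_unique by blast
  then have "fourier (vderiv \<phi>) \<xi> + c * fourier \<phi> \<xi> = 0"
    unfolding g_def[abs_def] fourier_ec using int by simp
  then show ?thesis by (simp add: c_def add_eq_0_iff2)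
qed

text \<open>With \<open>y = cmod (fourier \<phi> \<xi>)\<close> and
  \<open>a = 1 + \<xi>\<^sup>2\<close>, the square \<open>(1 - a * y)\<^sup>2 / a\<close> gives
  \<open>y \<le> 1 / a + a * y\<^sup>2\<close>, and \<open>\<xi>\<^sup>2 * y\<^sup>2\<close> is
  controlled by the transform of the derivative. The squared moduli of both transforms are
  integrable by Plancherel.\<close>

lemma schwartz_integrable_fourier:
  assumes \<phi>: "\<phi> \<in> schwartz"
  shows "integrable lborel (fourier \<phi>)"
proof -
  note \<phi>' = schwartz_vderiv[OF \<phi>]
  note [measurable] = schwartz_borel[OF \<phi>]
  have sq: "sq_integrable (fourier \<phi>)" "sq_integrable (fourier (vderiv \<phi>))"
    by (intro sq_integrable_fourier schwartz_sq_integrable schwartz_integrable \<phi> \<phi>')+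
  have "integrable lborel (\<lambda>\<xi>. 1 / (1 + \<xi>\<^sup>2) + ((cmod (fourier \<phi> \<xi>))\<^sup>2 + (cmod (fourier (vderiv \<phi>) \<xi>))\<^sup>2))"
    using sq integrable_inverse_quadratic unfolding sq_integrable_def by auto
  then show ?thesis
  proof (rule Bochner_Integration.integrable_bound)
    show "AE \<xi> in lborel. cmod (fourier \<phi> \<xi>) \<le>
        norm (1 / (1 + \<xi>\<^sup>2) + ((cmod (fourier \<phi> \<xi>))\<^sup>2 + (cmod (fourier (vderiv \<phi>) \<xi>))\<^sup>2))"
    proof (rule AE_I2)
      fix \<xi> :: real
      define y where "y = cmod (fourier \<phi> \<xi>)"
      have y: "y \<ge> 0" by (simp add: y_def)
      have pos: "0 < 1 + \<xi>\<^sup>2" by (simp add: add_pos_nonneg)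
      have "1 \<le> (2 * pi)\<^sup>2"
        using pi_gt3 by (intro one_le_power) auto
      then have "1 * (\<xi>\<^sup>2 * y\<^sup>2) \<le> (2 * pi)\<^sup>2 * (\<xi>\<^sup>2 * y\<^sup>2)"
        by (rule mult_right_mono) auto
      then have der: "\<xi>\<^sup>2 * y\<^sup>2 \<le> (cmod (fourier (vderiv \<phi>) \<xi>))\<^sup>2"
        by (simp add: schwartz_fourier_vderiv[OF \<phi>] norm_mult power_mult_distrib y_def mult.assoc)
      have "0 \<le> (1 / (1 + \<xi>\<^sup>2)) * ((1 - (1 + \<xi>\<^sup>2) * y)\<^sup>2) + y"
        using pos y by simp
      also have "(1 / (1 + \<xi>\<^sup>2)) * ((1 - (1 + \<xi>\<^sup>2) * y)\<^sup>2) = 1 / (1 + \<xi>\<^sup>2) - 2 * y + (1 + \<xi>\<^sup>2) * y\<^sup>2"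
      proof -
        have "(1 / a) * ((1 - a * y)\<^sup>2) = 1 / a - 2 * y + a * y\<^sup>2" if "a > 0" for a
          using that by (simp add: power2_eq_square field_simps)
        from this[OF pos] show ?thesis .
      qed
      finally have "y \<le> 1 / (1 + \<xi>\<^sup>2) + (y\<^sup>2 + \<xi>\<^sup>2 * y\<^sup>2)"
        by (simp add: algebra_simps)
      also have "\<dots> \<le> 1 / (1 + \<xi>\<^sup>2) + (y\<^sup>2 + (cmod (fourier (vderiv \<phi>) \<xi>))\<^sup>2)"
        using der by simp
      finally show "cmod (fourier \<phi> \<xi>) \<le>
        norm (1 / (1 + \<xi>\<^sup>2) + ((cmod (fourier \<phi> \<xi>))\<^sup>2 + (cmod (fourier (vderiv \<phi>) \<xi>))\<^sup>2))"
        by (simp add: y_def)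
    qed
  qed auto
qed

text \<open>Inversion in \<open>l2\<close>, made explicit because the transform is integrable.
  Equality almost everywhere is enough for its use under an integral sign.\<close>

lemma schwartz_inv_fourier_fourier:
  assumes \<phi>: "\<phi> \<in> schwartz"
  shows "AE x in lborel. inv_fourier (fourier \<phi>) x = \<phi> x"
proof (rule abs_l2_eq_imp_AE)
  note f = schwartz_sq_integrable[OF \<phi>] schwartz_integrable[OF \<phi>]
  note f' = sq_integrable_fourier[OF f] schwartz_integrable_fourier[OF \<phi>]
  show "abs_l2 (inv_fourier (fourier \<phi>)) = abs_l2 \<phi>"
    unfolding IFT_abs_eq[OF f', symmetric] FT_abs_eq[OF f, symmetric] by simp
  show "sq_integrable (inv_fourier (fourier \<phi>))" "sq_integrable \<phi>"
    by (intro sq_integrable_inv_fourier f' f)+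
qed

text \<open>The distributional transform of an \<open>l2\<close> class is \<open>FT\<close>.
  Pairings of distributions are bilinear, so \<open>\<phi>\<close> enters the inner product
  conjugated.\<close>

lemma integral_mult_fourier_schwartz:
  assumes \<phi>: "\<phi> \<in> schwartz"
  shows "(LINT x|lborel. rep_l2 F x * fourier \<phi> x) = (LINT x|lborel. rep_l2 (FT F) x * \<phi> x)"
proof -
  note f = schwartz_sq_integrable[OF \<phi>] schwartz_integrable[OF \<phi>]
  have c: "sq_integrable (\<lambda>x. cnj (\<phi> x))" "integrable lborel (\<lambda>x. cnj (\<phi> x))"
    using f by (auto intro: sq_integrable_cnj)
  have "l2_inner (FT F) (abs_l2 (\<lambda>x. cnj (\<phi> x))) = l2_inner F (abs_l2 (inv_fourier (\<lambda>x. cnj (\<phi> x))))"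
    unfolding l2_inner_FT_left IFT_abs_eq[OF c] ..
  then show ?thesis
    unfolding l2_inner_abs_right[OF c(1)] l2_inner_abs_right[OF sq_integrable_inv_fourier[OF c]]
    by (simp add: inv_fourier_cnj)
qed

section \<open>Gaussians as separating test functions\<close>

lemma bounded_mult_exp_neg_square:
  "bounded (range (\<lambda>x::real. x ^ k * exp (- x\<^sup>2)))"
proof -
  \<comment> \<open>The constant combines \<open>\<bar>x ^ k\<bar> \<le> 1 + (x\<^sup>2) ^ k\<close>
    with the single term \<open>(x\<^sup>2) ^ k / fact k\<close> of the exponential series.\<close>
  have "\<bar>x ^ k * exp (- x\<^sup>2)\<bar> \<le> 1 + fact k" for x :: real
  proof -
    have ex: "(x\<^sup>2) ^ k / fact k \<le> exp (x\<^sup>2)"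
    proof -
      have "(\<lambda>n. (x\<^sup>2) ^ n /\<^sub>R fact n) sums exp (x\<^sup>2)" by (rule exp_converges)
      then have "(\<Sum>n\<in>{k}. (x\<^sup>2) ^ n /\<^sub>R fact n) \<le> exp (x\<^sup>2)"
        by (intro sum_le_suminf[THEN order.trans, OF sums_summable _ _ eq_refl[OF sums_unique[symmetric]]]) auto
      then show ?thesis by (simp add: divide_inverse mult.commute)
    qed
    have "\<bar>x ^ k\<bar> \<le> 1 + (x\<^sup>2) ^ k"
    proof -
      have "(x\<^sup>2) ^ k = \<bar>x ^ k\<bar>\<^sup>2"
        by (simp add: power_mult[symmetric] mult.commute)
      moreover have "a \<le> 1 + a\<^sup>2" for a :: real
        using zero_le_power2[of "a - 1/2"] by (simp add: power2_eq_square algebra_simps)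
      ultimately show ?thesis by metis
    qed
    also have "\<dots> \<le> exp (x\<^sup>2) + fact k * exp (x\<^sup>2)"
      using ex by (intro add_mono) (auto simp: field_simps)
    finally have "\<bar>x ^ k\<bar> \<le> (1 + fact k) * exp (x\<^sup>2)" by (simp add: algebra_simps)
    then have "\<bar>x ^ k\<bar> * exp (- x\<^sup>2) \<le> (1 + fact k) * exp (x\<^sup>2) * exp (- x\<^sup>2)"
      by (rule mult_right_mono) simp
    then show ?thesis by (simp add: abs_mult exp_minus field_simps)
  qed
  then show ?thesis unfolding bounded_iff by auto
qed

text \<open>A Gaussian times the character of frequency \<open>- b\<close>, see
  \<open>gauss_ec\<close>. The single exponential is the restriction of an entire function, so
  derivatives can be taken in the complex variable.\<close>

definition gauss :: "real \<Rightarrow> real \<Rightarrow> complex" where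
  "gauss b x = exp (- 2 * of_real pi * \<i> * of_real b * of_real x - (of_real x)\<^sup>2)"

lemma gauss_ec: "gauss b x = of_real (exp (- x\<^sup>2)) * ec (- (b * x))"
  unfolding gauss_def ec_exp exp_of_real[symmetric] exp_add[symmetric]
  by (intro arg_cong[where f = exp]) (simp add: algebra_simps)

text \<open>The power \<open>k\<close> is arbitrary in the induction because peeling off a
  coefficient of \<open>p\<close> raises it by one.\<close>

lemma bounded_poly_gauss:
  "bounded (range (\<lambda>x. of_real (x ^ k) * (poly p (of_real x) * gauss b x)))"
proof (induction p arbitrary: k)
  case 0
  then show ?case by (simp add: image_constant_conv)
next
  case (pCons a p)
  obtain B where B: "\<And>x. cmod (of_real (x ^ Suc k) * (poly p (of_real x) * gauss b x)) \<le> B"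
    using pCons.IH[of "Suc k"] unfolding bounded_iff by blast
  obtain A where A: "\<And>x::real. \<bar>x ^ k * exp (- x\<^sup>2)\<bar> \<le> A"
    using bounded_mult_exp_neg_square[of k] unfolding bounded_iff by auto
  have "cmod (of_real (x ^ k) * (poly (pCons a p) (of_real x) * gauss b x)) \<le> cmod a * A + B" for x
  proof -
    have "of_real (x ^ k) * (poly (pCons a p) (of_real x) * gauss b x)
        = a * (of_real (x ^ k) * gauss b x) + of_real (x ^ Suc k) * (poly p (of_real x) * gauss b x)"
      by (simp add: algebra_simps)
    also have "cmod \<dots> \<le> cmod (a * (of_real (x ^ k) * gauss b x)) + cmod (of_real (x ^ Suc k) * (poly p (of_real x) * gauss b x))"
      by (rule norm_triangle_ineq)
    also have "cmod (a * (of_real (x ^ k) * gauss b x)) = cmod a * \<bar>x ^ k * exp (- x\<^sup>2)\<bar>"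
      by (simp add: norm_mult gauss_ec abs_mult norm_power power_abs)
    also have "\<dots> \<le> cmod a * A" by (intro mult_left_mono A) auto
    finally show ?thesis using B[of x] by linarith
  qed
  then show ?case unfolding bounded_iff by blast
qed

lemma has_vector_derivative_poly_gauss:
  "((\<lambda>x. poly p (of_real x) * gauss b x) has_vector_derivative
     poly (pderiv p + p * [:- 2 * of_real pi * \<i> * of_real b, - 2:]) (of_real x) * gauss b x) (at x)"
proof -
  let ?c = "- 2 * of_real pi * \<i> * of_real b :: complex"
  have "((\<lambda>z. poly p z * exp (?c * z - z\<^sup>2)) has_field_derivative
      poly (pderiv p + p * [:?c, - 2:]) (of_real x) * exp (?c * of_real x - (of_real x)\<^sup>2)) (at (of_real x))"
    (is "((\<lambda>z. poly p z * ?e z) has_field_derivative _) _")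
  proof -
    have "(?e has_field_derivative ?e (of_real x) * (?c - 2 * of_real x)) (at (of_real x))"
      by (rule derivative_eq_intros refl)+ simp
    from DERIV_mult[OF poly_DERIV this] show ?thesis
      by (rule DERIV_cong) (simp add: algebra_simps)
  qed
  from has_vector_derivative_real_field[OF this] show ?thesis
    by (simp add: gauss_def)
qed

text \<open>Each derivative is again a polynomial times the same Gaussian, so the bounds for all
  orders reduce to \<open>bounded_poly_gauss\<close>.\<close>

lemma gauss_schwartz: "gauss b \<in> schwartz"
proof -
  have "\<exists>p. (vderiv ^^ n) (gauss b) = (\<lambda>x. poly p (of_real x) * gauss b x)" for n
  proof (induction n)
    case 0
    show ?case by (intro exI[of _ 1]) simp
  next
    case (Suc n)
    then obtain p where p: "(vderiv ^^ n) (gauss b) = (\<lambda>x. poly p (of_real x) * gauss b x)" by blast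
    have "(vderiv ^^ Suc n) (gauss b) = (\<lambda>x. poly (pderiv p + p * [:- 2 * of_real pi * \<i> * of_real b, - 2:]) (of_real x) * gauss b x)"
      using vector_derivative_at[OF has_vector_derivative_poly_gauss, of p b] by (simp add: p vderiv_def)
    then show ?case by blast
  qed
  then obtain P where P: "\<And>n. (vderiv ^^ n) (gauss b) = (\<lambda>x. poly (P n) (of_real x) * gauss b x)"
    by metis
  show ?thesis
    unfolding schwartz_def mem_Collect_eq P
    by (intro allI conjI bounded_poly_gauss differentiableI_vector[OF has_vector_derivative_poly_gauss])
qed

text \<open>Pairing \<open>u\<close> with the modulated Gaussians computes the Fourier transform of \<open>u\<close> times a Gaussian,
  which determines \<open>u\<close> by Plancherel.\<close>

lemma schwartz_separating:
  assumes u: "sq_integrable u \<or> u \<in> borel_measurable borel \<and> bounded (range u)"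
    and zero: "\<And>\<phi>. \<phi> \<in> schwartz \<Longrightarrow> (LINT x|lborel. u x * \<phi> x) = 0"
  shows "AE x in lborel. u x = 0"
proof -
  define \<gamma> where "\<gamma> x = complex_of_real (exp (- x\<^sup>2))" for x :: real
  have \<gamma>_eq: "\<gamma> = gauss 0"
    by (simp add: fun_eq_iff \<gamma>_def gauss_ec)
  have \<gamma>: "sq_integrable \<gamma>" "integrable lborel \<gamma>"
    unfolding \<gamma>_eq by (intro schwartz_sq_integrable schwartz_integrable gauss_schwartz)+
  have \<gamma>b: "bounded (range \<gamma>)"
    unfolding \<gamma>_eq using schwartz_bounded[OF gauss_schwartz, of 0] by simp
  note [measurable] = sq_integrable_measurable[OF \<gamma>(1)]
  \<comment> \<open>Either hypothesis on \<open>u\<close> makes the product with the Gaussian both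
    square integrable and integrable, so that its \<open>FT\<close> is the plain Fourier integral.
    The first case serves differences of square-integrable functions, the second differences of
    bounded multipliers.\<close>
  have v: "sq_integrable (\<lambda>x. u x * \<gamma> x) \<and> integrable lborel (\<lambda>x. u x * \<gamma> x)"
    using u
  proof (elim disjE conjE)
    assume u: "sq_integrable u"
    show ?thesis
      using sq_integrable_bounded_mult[OF u _ \<gamma>b] sq_integrable_mult_integrable[OF u \<gamma>(1)]
      by (simp_all add: mult.commute)
  next
    assume u: "u \<in> borel_measurable borel" "bounded (range u)"
    then obtain B where "\<And>x. cmod (u x) \<le> B" unfolding bounded_iff by blast
    then show ?thesis
      using sq_integrable_bounded_mult[OF \<gamma>(1) u] integrable_mult_bounded[OF \<gamma>(2) u(1), of B]
      by (simp_all add: mult.commute)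
  qed
  then have v: "sq_integrable (\<lambda>x. u x * \<gamma> x)" "integrable lborel (\<lambda>x. u x * \<gamma> x)" by auto
  have "fourier (\<lambda>x. u x * \<gamma> x) b = 0" for b
    using zero[OF gauss_schwartz[of b]] by (simp add: fourier_ec gauss_ec \<gamma>_def mult.assoc)
  then have "fourier (\<lambda>x. u x * \<gamma> x) = (\<lambda>_. 0)" by (simp add: fun_eq_iff)
  then have "FT (abs_l2 (\<lambda>x. u x * \<gamma> x)) = 0"
    using FT_abs_eq[OF v] by (simp add: zero_l2_def)
  then have "abs_l2 (\<lambda>x. u x * \<gamma> x) = abs_l2 (\<lambda>_. 0)"
    using IFT_FT[of "abs_l2 (\<lambda>x. u x * \<gamma> x)"] norm_IFT[of 0] by (simp add: zero_l2_def[symmetric])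
  then have "AE x in lborel. u x * \<gamma> x = 0"
    by (rule abs_l2_eq_imp_AE) (intro v sq_integrable_zero)+
  then show ?thesis by (simp add: \<gamma>_def)
qed

section \<open>Convolutions as Fourier multipliers\<close>

definition mult_l2 :: "(real \<Rightarrow> complex) \<Rightarrow> l2 \<Rightarrow> l2" where
  "mult_l2 b f = abs_l2 (\<lambda>t. b t * rep_l2 f t)"

lemma sq_integrable_mult_rep:
  "b \<in> borel_measurable borel \<Longrightarrow> bounded (range b) \<Longrightarrow> sq_integrable (\<lambda>t. b t * rep_l2 f t)"
  by (rule sq_integrable_bounded_mult) auto

lemma rep_mult_l2:
  "b \<in> borel_measurable borel \<Longrightarrow> bounded (range b) \<Longrightarrow> AE t in lborel. rep_l2 (mult_l2 b f) t = b t * rep_l2 f t"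
  unfolding mult_l2_def by (intro rep_abs_l2 sq_integrable_mult_rep)

text \<open>This makes the definite description in \<open>l2_convolution\<close> meaningful. The
  witnesses \<open>M\<close> and \<open>K\<close> in \<open>is_l2_convolution\<close> are
  existential, but equality against all test functions determines them almost everywhere:
  \<open>M\<close> is \<open>M0\<close>, \<open>K\<close> is \<open>FT F\<close>, and then
  \<open>FT G\<close> is their product.\<close>

lemma is_l2_convolution_iff:
  assumes M0: "M0 \<in> borel_measurable borel" "bounded (range M0)"
  shows "is_l2_convolution F (inv_fourier_distr (distr_of M0)) G \<longleftrightarrow> G = IFT (mult_l2 M0 (FT F))"
proof -
  note [measurable] = M0(1)
  have T: "fourier_distr (inv_fourier_distr (distr_of M0)) \<phi> = (LINT x|lborel. M0 x * \<phi> x)" if \<phi>: "\<phi> \<in> schwartz" for \<phi>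
    unfolding fourier_distr_def inv_fourier_distr_def distr_of_def
  proof (rule integral_cong_AE)
    note f = schwartz_sq_integrable[OF \<phi>] schwartz_integrable[OF \<phi>]
    note [measurable] = schwartz_borel[OF \<phi>]
      sq_integrable_measurable[OF sq_integrable_inv_fourier[OF sq_integrable_fourier[OF f] schwartz_integrable_fourier[OF \<phi>]]]
    show "(\<lambda>x. M0 x * inv_fourier (fourier \<phi>) x) \<in> borel_measurable lborel" "(\<lambda>x. M0 x * \<phi> x) \<in> borel_measurable lborel"
      by measurable
    show "AE x in lborel. M0 x * inv_fourier (fourier \<phi>) x = M0 x * \<phi> x"
      using schwartz_inv_fourier_fourier[OF \<phi>] by eventually_elim simp
  qed
  have FTr: "fourier_distr (distr_of (rep_l2 H)) \<phi> = (LINT x|lborel. rep_l2 (FT H) x * \<phi> x)" if "\<phi> \<in> schwartz" for H \<phi>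
    unfolding fourier_distr_def distr_of_def by (rule integral_mult_fourier_schwartz[OF that])
  have bint: "integrable lborel (\<lambda>x. M x * \<phi> x)" if M: "M \<in> borel_measurable borel" "bounded (range M)" "\<phi> \<in> schwartz" for M \<phi>
  proof -
    obtain B where "\<And>x. cmod (M x) \<le> B" using M(2) unfolding bounded_iff by blast
    from integrable_mult_bounded[OF schwartz_integrable[OF M(3)] M(1) this] show ?thesis
      by (simp add: mult.commute)
  qed
  have sint: "integrable lborel (\<lambda>x. u x * \<phi> x)" if "sq_integrable u" "\<phi> \<in> schwartz" for u \<phi>
    by (intro sq_integrable_mult_integrable that schwartz_sq_integrable)
  have AE_eq: "AE x in lborel. u x = v x"
    if "sq_integrable u" "sq_integrable v" "\<And>\<phi>. \<phi> \<in> schwartz \<Longrightarrow> (LINT x|lborel. u x * \<phi> x) = (LINT x|lborel. v x * \<phi> x)" for u v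
  proof -
    have "AE x in lborel. u x - v x = 0"
      by (rule schwartz_separating)
         (use that in \<open>auto simp: left_diff_distrib sint intro!: sq_integrable_diff\<close>)
    then show ?thesis by eventually_elim simp
  qed
  show ?thesis
  proof
    assume "is_l2_convolution F (inv_fourier_distr (distr_of M0)) G"
    then obtain M K where M: "M \<in> borel_measurable borel" "bounded (range M)"
      and TM: "distr_eq (fourier_distr (inv_fourier_distr (distr_of M0))) (distr_of M)"
      and K: "distr_eq (fourier_distr (distr_of (rep_l2 F))) (distr_of (rep_l2 K))"
      and G: "distr_eq (fourier_distr (distr_of (rep_l2 G))) (distr_of (\<lambda>\<xi>. M \<xi> * rep_l2 K \<xi>))"
      unfolding is_l2_convolution_def by auto
    have "AE x in lborel. M0 x - M x = 0"
    proof (rule schwartz_separating)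
      show "sq_integrable (\<lambda>x. M0 x - M x) \<or> (\<lambda>x. M0 x - M x) \<in> borel_measurable borel \<and> bounded (range (\<lambda>x. M0 x - M x))"
        using M M0 by (auto intro: bounded_minus_comp)
      show "(LINT x|lborel. (M0 x - M x) * \<phi> x) = 0" if "\<phi> \<in> schwartz" for \<phi>
        using TM that T[OF that] by (simp add: left_diff_distrib bint M0 M distr_eq_def distr_of_def)
    qed
    moreover have "AE x in lborel. rep_l2 (FT F) x = rep_l2 K x"
      by (rule AE_eq) (use K FTr in \<open>auto simp: distr_eq_def distr_of_def\<close>)
    moreover have "AE x in lborel. rep_l2 (FT G) x = M x * rep_l2 K x"
      by (rule AE_eq) (use G FTr M in \<open>auto simp: distr_eq_def distr_of_def intro!: sq_integrable_mult_rep\<close>)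
    ultimately have "AE x in lborel. rep_l2 (FT G) x = M0 x * rep_l2 (FT F) x"
      by eventually_elim simp
    then have "FT G = mult_l2 M0 (FT F)"
      unfolding mult_l2_def by (intro eq_abs_l2I sq_integrable_mult_rep M0)
    then show "G = IFT (mult_l2 M0 (FT F))" by (metis IFT_FT)
  next
    assume G: "G = IFT (mult_l2 M0 (FT F))"
    show "is_l2_convolution F (inv_fourier_distr (distr_of M0)) G"
      unfolding is_l2_convolution_def
    proof (intro exI conjI)
      show "distr_eq (fourier_distr (distr_of (rep_l2 G))) (distr_of (\<lambda>\<xi>. M0 \<xi> * rep_l2 (FT F) \<xi>))"
        unfolding distr_eq_def
      proof
        fix \<phi> assume \<phi>: "\<phi> \<in> schwartz"
        note [measurable] = schwartz_borel[OF \<phi>]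
        have "(LINT x|lborel. rep_l2 (mult_l2 M0 (FT F)) x * \<phi> x) = (LINT x|lborel. M0 x * rep_l2 (FT F) x * \<phi> x)"
        proof (rule integral_cong_AE)
          show "AE x in lborel. rep_l2 (mult_l2 M0 (FT F)) x * \<phi> x = M0 x * rep_l2 (FT F) x * \<phi> x"
            using rep_mult_l2[OF M0, of "FT F"] by eventually_elim simp
        qed measurable
        then show "fourier_distr (distr_of (rep_l2 G)) \<phi> = distr_of (\<lambda>\<xi>. M0 \<xi> * rep_l2 (FT F) \<xi>) \<phi>"
          unfolding FTr[OF \<phi>] G FT_IFT by (simp only: distr_of_def)
      qed
    qed (use M0 T FTr in \<open>auto simp: distr_eq_def distr_of_def\<close>)
  qed
qed

lemma l2_convolution_eq:
  assumes "M0 \<in> borel_measurable borel" "bounded (range M0)"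
  shows "F \<star> inv_fourier_distr (distr_of M0) = IFT (mult_l2 M0 (FT F))"
  unfolding l2_convolution_def is_l2_convolution_iff[OF assms] by simp

section \<open>Frame operators and auxiliary integrals\<close>

text \<open>From a quadratic form to an unconditional sum in norm. Polarization turns
  \<open>quad\<close> into \<open>bil\<close>, which is convergence after pairing with each fixed
  \<open>k\<close>; norm convergence needs a bound on finite sums that is uniform over
  \<open>k\<close> of norm one, and \<open>B\<close> supplies it.\<close>

lemma l2_frame_has_sum:
  fixes g :: "'i \<Rightarrow> l2" and T :: "l2 \<Rightarrow> l2"
  assumes T_add: "\<And>f k. T (f + k) = T f + T k"
    and T_scale: "\<And>c f. T (scaleC_l2 c f) = scaleC_l2 c (T f)"
    and B: "B > 0" "\<And>f. norm (T f) \<le> B * norm f"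
    and quad: "\<And>f. ((\<lambda>i. complex_of_real ((cmod (l2_inner f (g i)))\<^sup>2)) has_sum l2_inner (T f) f) UNIV"
  shows "((\<lambda>i. scaleC_l2 (l2_inner f (g i)) (g i)) has_sum T f) UNIV"
proof -
  have T_diff: "T (f - k) = T f - T k" for f k
    using T_add[of "f - k" k] by simp
  define q where "q f = Re (l2_inner (T f) f)" for f
  have quadr: "((\<lambda>i. (cmod (l2_inner f (g i)))\<^sup>2) has_sum q f) UNIV" for f
    using has_sum_Re[OF quad[of f]] by (simp add: q_def)
  have q_le: "q f \<le> B * (norm f)\<^sup>2" for f
  proof -
    have "q f \<le> norm (T f) * norm f"
      unfolding q_def by (rule order.trans[OF complex_Re_le_cmod l2_Cauchy_Schwarz])
    also have "\<dots> \<le> B * norm f * norm f"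
      by (intro mult_right_mono B) simp
    finally show ?thesis by (simp add: power2_eq_square)
  qed
  have Bessel: "(\<Sum>i\<in>F. (cmod (l2_inner f (g i)))\<^sup>2) \<le> q f" if "finite F" for F f
    by (rule finite_sum_le_has_sum[OF quadr that]) auto
  have bil: "((\<lambda>i. l2_inner f (g i) * cnj (l2_inner k (g i))) has_sum l2_inner (T f) k) UNIV" for f k
  proof -
    have has_sum_diff: "((\<lambda>i. u i - v i) has_sum a - b) UNIV"
      if "(u has_sum a) UNIV" "(v has_sum b) UNIV" for u v :: "'i \<Rightarrow> complex" and a b
      using has_sum_add[OF that(1) has_sum_uminusI[OF that(2)]] by simp
    let ?s = "\<lambda>f i. complex_of_real ((cmod (l2_inner f (g i)))\<^sup>2)"
    have "((\<lambda>i. ?s (f + k) i - ?s (f - k) i + \<i> * ?s (f + scaleC_l2 \<i> k) i - \<i> * ?s (f - scaleC_l2 \<i> k) i)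
      has_sum l2_inner (T (f + k)) (f + k) - l2_inner (T (f - k)) (f - k)
        + \<i> * l2_inner (T (f + scaleC_l2 \<i> k)) (f + scaleC_l2 \<i> k)
        - \<i> * l2_inner (T (f - scaleC_l2 \<i> k)) (f - scaleC_l2 \<i> k)) UNIV"
      by (intro has_sum_add has_sum_diff has_sum_cmult_right quad)
    also have "l2_inner (T (f + k)) (f + k) - l2_inner (T (f - k)) (f - k)
        + \<i> * l2_inner (T (f + scaleC_l2 \<i> k)) (f + scaleC_l2 \<i> k)
        - \<i> * l2_inner (T (f - scaleC_l2 \<i> k)) (f - scaleC_l2 \<i> k) = 4 * l2_inner (T f) k"
      by (simp add: T_add T_diff T_scale l2_inner_add_left l2_inner_add_right l2_inner_diff_left l2_inner_diff_right
          l2_inner_scaleC_left l2_inner_scaleC_right algebra_simps)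
    also have "(\<lambda>i. ?s (f + k) i - ?s (f - k) i + \<i> * ?s (f + scaleC_l2 \<i> k) i - \<i> * ?s (f - scaleC_l2 \<i> k) i)
        = (\<lambda>i. 4 * (l2_inner f (g i) * cnj (l2_inner k (g i))))"
      unfolding l2_inner_add_left l2_inner_diff_left l2_inner_scaleC_left complex_norm_square
      by (simp add: fun_eq_iff algebra_simps)
    finally have "((\<lambda>i. 4 * (l2_inner f (g i) * cnj (l2_inner k (g i)))) has_sum 4 * l2_inner (T f) k) UNIV" .
    from has_sum_cmult_right[OF this, of "1/4"] show ?thesis by simp
  qed
  define x where "x i = l2_inner f (g i)" for i
  define s where "s F = (\<Sum>i\<in>F. scaleC_l2 (x i) (g i))" for F
  \<comment> \<open>Duality: the squared norm of \<open>s F\<close> is expanded in the coefficients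
    \<open>y\<close> of \<open>s F\<close> itself. With the weights \<open>B\<close> and
    \<open>1 / B\<close>, the Bessel bound for \<open>y\<close> contributes at most half of this
    squared norm, which is absorbed on the left.\<close>
  have synth: "(norm (s F))\<^sup>2 \<le> B * (\<Sum>i\<in>F. (cmod (x i))\<^sup>2)" if F: "finite F" for F
  proof -
    define y where "y i = l2_inner (s F) (g i)" for i
    have "l2_inner (g i) (s F) = cnj (y i)" for i
      unfolding y_def by (rule l2_inner_commute)
    then have "complex_of_real ((norm (s F))\<^sup>2) = (\<Sum>i\<in>F. x i * cnj (y i))"
      unfolding l2_inner_self[symmetric]
      by (subst s_def) (simp add: l2_inner_sum_left l2_inner_scaleC_left)
    then have "(norm (s F))\<^sup>2 \<le> cmod (\<Sum>i\<in>F. x i * cnj (y i))"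
      by (metis norm_of_real abs_ge_self)
    also have "\<dots> \<le> (\<Sum>i\<in>F. (B * (cmod (x i))\<^sup>2 + (cmod (y i))\<^sup>2 / B) / 2)"
    proof (rule sum_norm_le)
      fix i
      have "0 \<le> (B * cmod (x i) - cmod (y i))\<^sup>2 / (2 * B)" using B by simp
      also have "\<dots> = (B * (cmod (x i))\<^sup>2 + (cmod (y i))\<^sup>2 / B) / 2 - cmod (x i) * cmod (y i)"
        using B by (simp add: power2_eq_square field_simps)
      finally show "cmod (x i * cnj (y i)) \<le> (B * (cmod (x i))\<^sup>2 + (cmod (y i))\<^sup>2 / B) / 2"
        by (simp add: norm_mult)
    qed
    also have "\<dots> = (B * (\<Sum>i\<in>F. (cmod (x i))\<^sup>2) + (\<Sum>i\<in>F. (cmod (y i))\<^sup>2) / B) / 2"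
      by (simp add: sum_divide_distrib[symmetric] sum.distrib sum_distrib_left)
    also have "\<dots> \<le> (B * (\<Sum>i\<in>F. (cmod (x i))\<^sup>2) + (norm (s F))\<^sup>2) / 2"
    proof -
      have "(\<Sum>i\<in>F. (cmod (y i))\<^sup>2) \<le> B * (norm (s F))\<^sup>2"
        unfolding y_def by (rule order.trans[OF Bessel[OF F] q_le])
      then have "(\<Sum>i\<in>F. (cmod (y i))\<^sup>2) / B \<le> (norm (s F))\<^sup>2"
        using B by (simp add: pos_divide_le_eq mult.commute)
      then show ?thesis by (intro divide_right_mono add_left_mono) simp_all
    qed
    finally show ?thesis by simp
  qed
  \<comment> \<open>Tested against \<open>k = T f - s F\<close>: as \<open>G\<close> grows, the
    inner products of \<open>s G - s F\<close> with \<open>k\<close> tend to the squared norm of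
    \<open>k\<close>, while the synthesis bound on \<open>G - F\<close> keeps them below
    \<open>C * norm k\<close>.\<close>
  have tail: "(norm (T f - s F))\<^sup>2 \<le> B * (q f - (\<Sum>i\<in>F. (cmod (x i))\<^sup>2))" if F: "finite F" for F
  proof -
    define C where "C = sqrt (B * (q f - (\<Sum>i\<in>F. (cmod (x i))\<^sup>2)))"
    define k where "k = T f - s F"
    have ev: "\<forall>\<^sub>F G in finite_subsets_at_top UNIV. finite G \<and> F \<subseteq> G"
      unfolding eventually_finite_subsets_at_top using F by blast
    have gk: "l2_inner (g i) k = cnj (l2_inner k (g i))" for i
      by (rule l2_inner_commute)
    have lim: "((\<lambda>G. cmod (l2_inner (s G) k - l2_inner (s F) k)) \<longlongrightarrow> cmod (l2_inner (T f) k - l2_inner (s F) k)) (finite_subsets_at_top UNIV)"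
      using bil[of f k] unfolding has_sum_def s_def
      by (intro tendsto_intros) (simp add: l2_inner_sum_left l2_inner_scaleC_left x_def gk)
    have "cmod (l2_inner (T f) k - l2_inner (s F) k) \<le> C * norm k"
    proof (rule tendsto_upperbound[OF lim])
      show "\<forall>\<^sub>F G in finite_subsets_at_top UNIV. cmod (l2_inner (s G) k - l2_inner (s F) k) \<le> C * norm k"
        using ev
      proof eventually_elim
        case (elim G)
        have "s G - s F = s (G - F)"
          unfolding s_def using elim by (simp add: sum_diff)
        then have "cmod (l2_inner (s G) k - l2_inner (s F) k) \<le> norm (s (G - F)) * norm k"
          by (metis l2_inner_diff_left l2_Cauchy_Schwarz)
        also have "norm (s (G - F)) \<le> C"
        proof -
          have "(norm (s (G - F)))\<^sup>2 \<le> B * (\<Sum>i\<in>G - F. (cmod (x i))\<^sup>2)"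
            using elim by (intro synth) simp
          also have "\<dots> \<le> B * (q f - (\<Sum>i\<in>F. (cmod (x i))\<^sup>2))"
            using elim B Bessel[of G f] by (simp add: sum_diff x_def)
          finally show ?thesis unfolding C_def by (rule real_le_rsqrt)
        qed
        finally show ?case by (simp add: mult_right_mono)
      qed
    qed simp
    then have "norm k * norm k \<le> C * norm k"
      unfolding l2_inner_diff_left[symmetric] k_def[symmetric] l2_inner_self by (simp add: power2_eq_square norm_mult)
    then have "norm k \<le> C"
      using B Bessel[OF F, of f] by (cases "norm k = 0") (auto simp: C_def x_def)
    moreover have "C\<^sup>2 = B * (q f - (\<Sum>i\<in>F. (cmod (x i))\<^sup>2))"
      using B Bessel[OF F, of f] by (simp add: C_def x_def)
    ultimately show ?thesis
      unfolding k_def by (metis norm_ge_zero power_mono)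
  qed
  have "((\<lambda>F. \<Sum>i\<in>F. (cmod (x i))\<^sup>2) \<longlongrightarrow> q f) (finite_subsets_at_top UNIV)"
    using quadr[of f] by (simp add: has_sum_def x_def)
  from tendsto_mult_left[OF tendsto_diff[OF tendsto_const this], of B "q f"]
  have lim: "((\<lambda>F. B * (q f - (\<Sum>i\<in>F. (cmod (x i))\<^sup>2))) \<longlongrightarrow> 0) (finite_subsets_at_top UNIV)"
    by simp
  have "((\<lambda>F. (norm (T f - s F))\<^sup>2) \<longlongrightarrow> 0) (finite_subsets_at_top UNIV)"
    by (rule Lim_null_comparison[OF eventually_finite_subsets_at_top_weakI lim]) (simp add: tail)
  from tendsto_real_sqrt[OF this] have "((\<lambda>F. norm (s F - T f)) \<longlongrightarrow> 0) (finite_subsets_at_top UNIV)"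
    by (simp add: norm_minus_commute)
  then have "(s \<longlongrightarrow> T f) (finite_subsets_at_top UNIV)"
    by (simp add: tendsto_norm_zero_iff LIM_zero_iff)
  then show ?thesis by (simp add: has_sum_def s_def[abs_def] x_def)
qed

section \<open>Complex sines and exponential integrals\<close>

lemma
  shows norm_sin_ge: "\<bar>exp (Im z) - exp (- Im z)\<bar> / 2 \<le> cmod (sin z)"
    and norm_sin_le: "cmod (sin z) \<le> (exp (Im z) + exp (- Im z)) / 2"
proof -
  have eq: "cmod (sin z) = cmod (exp (- (\<i> * z)) - exp (\<i> * z)) / 2"
    by (simp add: sin_exp_eq norm_divide norm_mult norm_minus_commute)
  have n: "cmod (exp (- (\<i> * z))) = exp (Im z)" "cmod (exp (\<i> * z)) = exp (- Im z)"
    by simp_all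
  show "\<bar>exp (Im z) - exp (- Im z)\<bar> / 2 \<le> cmod (sin z)"
    unfolding eq n[symmetric] by (intro divide_right_mono norm_triangle_ineq3) simp
  show "cmod (sin z) \<le> (exp (Im z) + exp (- Im z)) / 2"
    unfolding eq n[symmetric] by (intro divide_right_mono norm_triangle_ineq4) simp
qed

lemma integral_exp_symmetric:
  fixes z :: complex
  assumes z: "z \<noteq> 0" and r: "r \<ge> 0"
  shows "(LINT \<xi>|lborel. indicator {a - r..a + r} \<xi> * exp (2 * of_real pi * \<i> * z * of_real \<xi>)) =
    exp (2 * of_real pi * \<i> * z * of_real a) * sin (of_real (2 * pi * r) * z) / (of_real pi * z)"
proof -
  let ?c = "2 * of_real pi * \<i> * z"
  have c: "?c \<noteq> 0" using z by simp
  have "exp (?c * of_real (a + r)) - exp (?c * of_real (a - r))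
      = exp (?c * of_real a) * (exp (\<i> * (of_real (2 * pi * r) * z)) - exp (- (\<i> * (of_real (2 * pi * r) * z))))"
    by (simp add: right_diff_distrib exp_add[symmetric] exp_diff[symmetric] algebra_simps)
  also have "\<dots> = exp (?c * of_real a) * (2 * \<i> * sin (of_real (2 * pi * r) * z))"
    by (simp add: sin_exp_eq)
  finally show ?thesis
    using integral_exp_Icc[OF c, of "a - r" "a + r"] r z by (simp add: field_simps)
qed

text \<open>Used with \<open>w\<close> in the imaginary part of \<open>z\<close>, once for the
  transforms of the atoms and once for the closed form of the dual window.\<close>

lemma integral_exp_symmetric_Ico:
  fixes z :: complex
  assumes z: "z \<noteq> 0" and r: "r \<ge> 0"
  shows "(LINT \<xi>|lborel. indicator {a - r..<a + r} \<xi> * exp (2 * of_real pi * \<i> * z * of_real \<xi>)) =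
    exp (2 * of_real pi * \<i> * z * of_real a) * sin (of_real (2 * pi * r) * z) / (of_real pi * z)"
  unfolding integral_exp_symmetric[OF assms, symmetric]
proof (rule integral_cong_AE)
  show "AE \<xi> in lborel. indicator {a - r..<a + r} \<xi> * exp (2 * of_real pi * \<i> * z * of_real \<xi>)
      = indicator {a - r..a + r} \<xi> * exp (2 * of_real pi * \<i> * z * of_real \<xi>)"
    using AE_indicator_Ico_Icc[of "a - r" "a + r", where ?'a = complex] by eventually_elim simp
qed measurable

section \<open>Bounds for \<open>h_hat\<close>\<close>

locale cauchy_gabor =
  fixes \<alpha> \<beta> w :: real
  assumes w: "w > 0" and \<alpha>: "\<alpha> > 0" and \<beta>: "\<beta> > 0" and \<alpha>\<beta>: "\<alpha> * \<beta> \<le> 1"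
begin

definition "h_term m \<xi> = (indicator {- (1 / (2 * \<alpha>)) .. 1 / (2 * \<alpha>)} (\<xi> - \<beta> * of_int m) * exp (4 * pi * w * (\<xi> - \<beta> * of_int m)) :: real)"
  for m :: int and \<xi> :: real

text \<open>The indices of the translates that contain \<open>\<xi>\<close>. The set is finite, so
  the infinite sum in \<open>h_hat\<close> reduces to a finite one.\<close>

definition "h_supp \<xi> = {m :: int. \<xi> - \<beta> * of_int m \<in> {- (1 / (2 * \<alpha>)) .. 1 / (2 * \<alpha>)}}"
  for \<xi> :: real

lemma h_supp_subset: "h_supp \<xi> \<subseteq> {\<lceil>(\<xi> - 1 / (2 * \<alpha>)) / \<beta>\<rceil>..\<lfloor>(\<xi> + 1 / (2 * \<alpha>)) / \<beta>\<rfloor>}"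
proof
  fix m assume "m \<in> h_supp \<xi>"
  then have "(\<xi> - 1 / (2 * \<alpha>)) / \<beta> \<le> of_int m" "of_int m \<le> (\<xi> + 1 / (2 * \<alpha>)) / \<beta>"
    using \<beta> by (auto simp: h_supp_def pos_divide_le_eq pos_le_divide_eq mult.commute)
  then show "m \<in> {\<lceil>(\<xi> - 1 / (2 * \<alpha>)) / \<beta>\<rceil>..\<lfloor>(\<xi> + 1 / (2 * \<alpha>)) / \<beta>\<rfloor>}"
    by (simp add: ceiling_le_iff le_floor_iff)
qed

lemma finite_h_supp: "finite (h_supp \<xi>)"
  using h_supp_subset finite_subset by blast

lemma h_term_nonneg: "0 \<le> h_term m \<xi>"
  by (simp add: h_term_def)

lemma h_term_has_sum: "((\<lambda>m. h_term m \<xi>) has_sum (\<Sum>m\<in>h_supp \<xi>. h_term m \<xi>)) UNIV"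
proof (rule has_sum_finite_neutralI[OF finite_h_supp])
  show "h_term m \<xi> = 0" if "m \<in> UNIV - h_supp \<xi>" for m
    using that by (auto simp: h_term_def h_supp_def indicator_def)
qed auto

lemma h_hat_eq_sum: "h_hat \<alpha> \<beta> w \<xi> = pi * (\<Sum>m\<in>h_supp \<xi>. h_term m \<xi>)"
  unfolding h_hat_def h_term_def[symmetric] using h_term_has_sum infsumI by fastforce

lemma h_hat_has_sum: "((\<lambda>m. pi * h_term m \<xi>) has_sum h_hat \<alpha> \<beta> w \<xi>) UNIV"
  unfolding h_hat_eq_sum by (intro has_sum_cmult_right h_term_has_sum)

lemma borel_measurable_h_term [measurable]: "h_term m \<in> borel_measurable borel"
  unfolding h_term_def[abs_def] by measurable

lemma borel_measurable_h_hat [measurable]: "h_hat \<alpha> \<beta> w \<in> borel_measurable borel"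
proof (rule borel_measurable_LIMSEQ_real)
  fix \<xi> :: real
  show "(\<lambda>N. \<Sum>m\<in>{- int N..int N}. pi * h_term m \<xi>) \<longlonglongrightarrow> h_hat \<alpha> \<beta> w \<xi>"
    by (rule filterlim_compose[OF h_hat_has_sum[unfolded has_sum_def] filterlim_int_intervals])
qed measurable

text \<open>A closed interval of length \<open>1 / (\<alpha> * \<beta>)\<close> contains at most
  \<open>1 / (\<alpha> * \<beta>) + 1\<close> integers, and on each translate the exponent is at
  most its value at the right endpoint.\<close>

lemma h_hat_le: "h_hat \<alpha> \<beta> w \<xi> \<le> pi * ((1 / (\<alpha> * \<beta>) + 1) * exp (2 * pi * w / \<alpha>))"
proof -
  have "(\<Sum>m\<in>h_supp \<xi>. h_term m \<xi>) \<le> of_nat (card (h_supp \<xi>)) * exp (2 * pi * w / \<alpha>)"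
  proof (rule sum_bounded_above)
    fix m assume "m \<in> h_supp \<xi>"
    then have "\<xi> - \<beta> * of_int m \<le> 1 / (2 * \<alpha>)" by (simp add: h_supp_def)
    then have "4 * pi * w * (\<xi> - \<beta> * of_int m) \<le> 4 * pi * w * (1 / (2 * \<alpha>))"
      using w by (intro mult_left_mono) auto
    also have "\<dots> = 2 * pi * w / \<alpha>" by simp
    finally show "h_term m \<xi> \<le> exp (2 * pi * w / \<alpha>)"
      by (simp add: h_term_def indicator_def)
  qed
  also have "\<dots> \<le> (1 / (\<alpha> * \<beta>) + 1) * exp (2 * pi * w / \<alpha>)"
  proof (rule mult_right_mono)
    have "card (h_supp \<xi>) \<le> nat (\<lfloor>(\<xi> + 1 / (2 * \<alpha>)) / \<beta>\<rfloor> + 1 - \<lceil>(\<xi> - 1 / (2 * \<alpha>)) / \<beta>\<rceil>)"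
      using card_mono[OF _ h_supp_subset, of \<xi>] by simp
    moreover have "(\<xi> + 1 / (2 * \<alpha>)) / \<beta> - (\<xi> - 1 / (2 * \<alpha>)) / \<beta> = 1 / (\<alpha> * \<beta>)"
      using \<alpha> \<beta> by (simp add: field_simps)
    moreover have "1 / (\<alpha> * \<beta>) > 0" using \<alpha> \<beta> by simp
    ultimately show "real (card (h_supp \<xi>)) \<le> 1 / (\<alpha> * \<beta>) + 1"
      by linarith
  qed simp
  finally show ?thesis unfolding h_hat_eq_sum by (rule mult_left_mono) simp
qed

text \<open>\<open>\<alpha> * \<beta> \<le> 1\<close> says that half the spacing \<beta> is at most
  the half-length \<open>1 / (2 * \<alpha>)\<close>, so the translate whose centre is nearest to
  \<open>\<xi>\<close> contains it. Its single term, bounded below by the value at the left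
  endpoint, suffices because all terms are nonnegative.\<close>

lemma h_hat_ge: "pi * exp (- (2 * pi * w / \<alpha>)) \<le> h_hat \<alpha> \<beta> w \<xi>"
proof -
  define m where "m = round (\<xi> / \<beta>)"
  have "\<bar>\<xi> / \<beta> - of_int m\<bar> \<le> 1 / 2"
    unfolding m_def using of_int_round_abs_le[of "\<xi> / \<beta>"] by (simp add: abs_minus_commute)
  then have "\<beta> * \<bar>\<xi> / \<beta> - of_int m\<bar> \<le> \<beta> * (1 / 2)"
    using \<beta> by (intro mult_left_mono) auto
  also have "\<beta> * \<bar>\<xi> / \<beta> - of_int m\<bar> = \<bar>\<xi> - \<beta> * of_int m\<bar>"
  proof -
    have "\<xi> - \<beta> * of_int m = \<beta> * (\<xi> / \<beta> - of_int m)" using \<beta> by (simp add: right_diff_distrib)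
    then show ?thesis using \<beta> by (simp add: abs_mult)
  qed
  also have "\<beta> * (1 / 2) \<le> 1 / (2 * \<alpha>)"
    using \<alpha>\<beta> \<alpha> by (simp add: field_simps)
  finally have le: "\<bar>\<xi> - \<beta> * of_int m\<bar> \<le> 1 / (2 * \<alpha>)" .
  then have m: "m \<in> h_supp \<xi>" by (auto simp: h_supp_def abs_le_iff)
  have "4 * pi * w * (- (1 / (2 * \<alpha>))) \<le> 4 * pi * w * (\<xi> - \<beta> * of_int m)"
    using w le by (intro mult_left_mono) (auto simp: abs_le_iff)
  then have "exp (- (2 * pi * w / \<alpha>)) \<le> h_term m \<xi>"
    using m by (simp add: h_term_def h_supp_def)
  also have "\<dots> \<le> (\<Sum>m\<in>h_supp \<xi>. h_term m \<xi>)"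
    by (rule member_le_sum[OF m]) (auto simp: h_term_nonneg finite_h_supp)
  finally show ?thesis unfolding h_hat_eq_sum by (rule mult_left_mono) simp
qed

end

section \<open>The frame operator of the Cauchy kernel\<close>

lemma mult_l2_add:
  assumes "b \<in> borel_measurable borel" "bounded (range b)"
  shows "mult_l2 b (f + g) = mult_l2 b f + mult_l2 b g"
proof -
  have "AE t in lborel. rep_l2 (mult_l2 b f + mult_l2 b g) t = b t * rep_l2 (f + g) t"
    using rep_l2_add[of f g] rep_l2_add[of "mult_l2 b f" "mult_l2 b g"] rep_mult_l2[OF assms, of f] rep_mult_l2[OF assms, of g]
    by eventually_elim (simp add: distrib_left)
  then show ?thesis
    unfolding mult_l2_def[of b "f + g"] by (intro eq_abs_l2I[symmetric] sq_integrable_mult_rep assms)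
qed

lemma mult_l2_scaleC:
  assumes "b \<in> borel_measurable borel" "bounded (range b)"
  shows "mult_l2 b (scaleC_l2 c f) = scaleC_l2 c (mult_l2 b f)"
proof -
  have "AE t in lborel. rep_l2 (scaleC_l2 c (mult_l2 b f)) t = b t * rep_l2 (scaleC_l2 c f) t"
    using rep_l2_scaleC[of c f] rep_l2_scaleC[of c "mult_l2 b f"] rep_mult_l2[OF assms, of f]
    by eventually_elim (simp add: mult_ac)
  then show ?thesis
    unfolding mult_l2_def[of b "scaleC_l2 c f"] by (intro eq_abs_l2I[symmetric] sq_integrable_mult_rep assms)
qed

text \<open>The product of \<open>a\<close> with \<open>rep_l2 (mult_l2 b f)\<close> is square
  integrable because it agrees with \<open>rep_l2 f\<close> almost everywhere; measurability of
  \<open>a\<close> comes from \<open>a = (\<lambda>t. 1 / b t)\<close>.\<close>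

lemma mult_l2_cancel:
  assumes "b \<in> borel_measurable borel" "bounded (range b)" "\<And>t. a t * b t = 1"
  shows "mult_l2 a (mult_l2 b f) = f"
proof -
  have "AE t in lborel. a t * rep_l2 (mult_l2 b f) t = rep_l2 f t"
    using rep_mult_l2[OF assms(1,2), of f]
    by eventually_elim (simp add: mult.assoc[symmetric] assms(3))
  moreover have "sq_integrable (\<lambda>t. a t * rep_l2 (mult_l2 b f) t) \<and>
      abs_l2 (\<lambda>t. a t * rep_l2 (mult_l2 b f) t) = f" if "AE t in lborel. a t * rep_l2 (mult_l2 b f) t = rep_l2 f t"
    and [measurable]: "a \<in> borel_measurable borel"
  proof -
    have "(\<integral>\<^sup>+t. ennreal ((cmod (a t * rep_l2 (mult_l2 b f) t))\<^sup>2) \<partial>lborel) = (\<integral>\<^sup>+t. ennreal ((cmod (rep_l2 f t))\<^sup>2) \<partial>lborel)"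
      by (rule nn_integral_cong_AE) (use that(1) in \<open>eventually_elim, simp\<close>)
    then have "sq_integrable (\<lambda>t. a t * rep_l2 (mult_l2 b f) t)"
      by (intro sq_integrableI_nn_integral) (simp_all add: nn_integral_power2_norm_l2)
    then show ?thesis
      using that(1) abs_l2_eqI[of _ "rep_l2 f"] by auto
  qed
  moreover have "a \<in> borel_measurable borel"
  proof -
    have "a = (\<lambda>t. 1 / b t)"
      using assms(3) by (auto simp: fun_eq_iff nonzero_eq_divide_eq) (metis mult_zero_right nonzero_eq_divide_eq zero_neq_one)
    then show ?thesis using assms(1) by simp
  qed
  ultimately show ?thesis unfolding mult_l2_def[of a] by blast
qed

lemma norm_mult_l2_le:
  assumes "b \<in> borel_measurable borel" "\<And>t. cmod (b t) \<le> B"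
  shows "norm (mult_l2 b f) \<le> B * norm f"
proof -
  have B: "0 \<le> B" using assms(2)[of 0] norm_ge_zero[of "b 0"] by linarith
  note [measurable] = assms(1)
  have "(\<integral>\<^sup>+t. ennreal ((cmod (b t * rep_l2 f t))\<^sup>2) \<partial>lborel) \<le> (\<integral>\<^sup>+t. ennreal (B\<^sup>2) * ennreal ((cmod (rep_l2 f t))\<^sup>2) \<partial>lborel)"
    by (intro nn_integral_mono)
       (auto simp: norm_mult power_mult_distrib ennreal_mult[symmetric] intro!: ennreal_leI mult_right_mono power_mono assms(2))
  also have "\<dots> = ennreal ((B * norm f)\<^sup>2)"
    by (subst nn_integral_cmult)
       (simp_all add: nn_integral_power2_norm_l2 ennreal_mult[symmetric] power_mult_distrib)
  finally show ?thesis
    unfolding mult_l2_def using B by (intro norm_abs_l2_le(2)) auto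
qed

lemma l2_inner_mult_left:
  assumes "b \<in> borel_measurable borel" "bounded (range b)"
  shows "l2_inner (mult_l2 (\<lambda>t. cnj (b t)) f) k = l2_inner f (mult_l2 b k)"
proof -
  have c: "(\<lambda>t. cnj (b t)) \<in> borel_measurable borel" "bounded (range (\<lambda>t. cnj (b t)))"
    using assms by (auto simp: bounded_iff)
  show ?thesis
    unfolding mult_l2_def l2_inner_abs_right[OF sq_integrable_mult_rep[OF assms]]
    using l2_inner_abs[OF sq_integrable_mult_rep[OF c] sq_integrable_rep, of f k]
    by (simp add: mult_ac)
qed

lemma IFT_add: "IFT (f + g) = IFT f + IFT g"
  using IFT_FT[of "IFT f + IFT g"] by (simp add: FT_add)

lemma IFT_scaleC: "IFT (scaleC_l2 c f) = scaleC_l2 c (IFT f)"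
  using IFT_FT[of "scaleC_l2 c (IFT f)"] by (simp add: FT_scaleC)

lemma l2_inner_IFT_left: "l2_inner (IFT f) g = l2_inner f (FT g)"
  by (subst (1 2) l2_inner_commute) (simp add: l2_inner_FT_left)

lemma integrable_Ico_exp: "integrable lborel (\<lambda>x::real. indicator {a..<b} x * exp (c * complex_of_real x))"
proof -
  have "integrable lborel (\<lambda>x. indicator {a..b} x *\<^sub>R exp (c * complex_of_real x))"
    by (rule borel_integrable_compact) (auto intro!: continuous_intros)
  from integrable_mult_indicator[OF _ this, of "{a..<b}"]
  have "integrable lborel (\<lambda>x. indicator {a..<b} x *\<^sub>R indicator {a..b} x *\<^sub>R exp (c * complex_of_real x))"
    by simp
  also have "(\<lambda>x. indicator {a..<b} x *\<^sub>R indicator {a..b} x *\<^sub>R exp (c * complex_of_real x)) =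
      (\<lambda>x. indicator {a..<b} x * exp (c * complex_of_real x))"
    by (auto simp: fun_eq_iff indicator_def)
  finally show ?thesis .
qed

lemma sq_integrable_cong_AE:
  assumes "sq_integrable u" "v \<in> borel_measurable borel" "AE t in lborel. u t = v t"
  shows "sq_integrable v"
proof (rule sq_integrableI_nn_integral)
  have "(\<integral>\<^sup>+t. ennreal ((cmod (v t))\<^sup>2) \<partial>lborel) = (\<integral>\<^sup>+t. ennreal ((cmod (u t))\<^sup>2) \<partial>lborel)"
    by (rule nn_integral_cong_AE) (use assms(3) in \<open>eventually_elim, simp\<close>)
  then show "(\<integral>\<^sup>+t. ennreal ((cmod (v t))\<^sup>2) \<partial>lborel) < \<infinity>"
    using nn_integral_eq_integral[of lborel "\<lambda>t. (cmod (u t))\<^sup>2"] assms(1) by (simp add: sq_integrable_def)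
qed fact

lemma mult_l2_abs:
  assumes "b \<in> borel_measurable borel" "bounded (range b)" "sq_integrable u"
  shows "mult_l2 b (abs_l2 u) = abs_l2 (\<lambda>t. b t * u t)"
  unfolding mult_l2_def
proof (rule abs_l2_eqI)
  show "AE t in lborel. b t * rep_l2 (abs_l2 u) t = b t * u t"
    using rep_abs_l2[OF assms(3)] by eventually_elim simp
qed (use assms in \<open>auto intro: sq_integrable_mult_rep sq_integrable_bounded_mult\<close>)

section \<open>Atoms and quadratic form on the Fourier side\<close>

context cauchy_gabor
begin

definition "sin_p t = sin (complex_of_real (pi / \<alpha>) * (complex_of_real t + \<i> * complex_of_real w))" for t

definition "sin_m t = sin (complex_of_real (pi / \<alpha>) * (complex_of_real t - \<i> * complex_of_real w))" for t

definition "sin_lo = (exp (pi * w / \<alpha>) - exp (- (pi * w / \<alpha>))) / 2"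

definition "sin_hi = (exp (pi * w / \<alpha>) + exp (- (pi * w / \<alpha>))) / 2"

lemma sin_lo_pos: "sin_lo > 0"
  using w \<alpha> by (simp add: sin_lo_def)

lemma sin_pm_bounds:
  "sin_lo \<le> cmod (sin_p t)" "cmod (sin_p t) \<le> sin_hi" "sin_lo \<le> cmod (sin_m t)" "cmod (sin_m t) \<le> sin_hi"
proof -
  have im: "Im (complex_of_real (pi / \<alpha>) * (complex_of_real t + \<i> * complex_of_real w)) = pi * w / \<alpha>"
    "Im (complex_of_real (pi / \<alpha>) * (complex_of_real t - \<i> * complex_of_real w)) = - (pi * w / \<alpha>)"
    by (simp_all del: of_real_divide)
  have "0 \<le> exp (pi * w / \<alpha>) - exp (- (pi * w / \<alpha>))"
    using w \<alpha> by simp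
  then show "sin_lo \<le> cmod (sin_p t)" "cmod (sin_p t) \<le> sin_hi" "sin_lo \<le> cmod (sin_m t)" "cmod (sin_m t) \<le> sin_hi"
    unfolding sin_p_def sin_m_def sin_lo_def sin_hi_def
    using norm_sin_ge[of "complex_of_real (pi / \<alpha>) * (complex_of_real t + \<i> * complex_of_real w)"]
      norm_sin_le[of "complex_of_real (pi / \<alpha>) * (complex_of_real t + \<i> * complex_of_real w)"]
      norm_sin_ge[of "complex_of_real (pi / \<alpha>) * (complex_of_real t - \<i> * complex_of_real w)"]
      norm_sin_le[of "complex_of_real (pi / \<alpha>) * (complex_of_real t - \<i> * complex_of_real w)"]
    unfolding im by auto
qed

lemma sin_pm_nonzero: "sin_p t \<noteq> 0" "sin_m t \<noteq> 0"
  using sin_pm_bounds[of t] sin_lo_pos by auto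

lemma cnj_sin_p: "cnj (sin_p t) = sin_m t"
  by (simp add: sin_p_def sin_m_def cnj_sin)

lemma borel_measurable_sin_pm [measurable]: "sin_p \<in> borel_measurable borel" "sin_m \<in> borel_measurable borel"
  unfolding sin_p_def[abs_def] sin_m_def[abs_def]
  by (intro borel_measurable_continuous_onI continuous_intros)+

lemma bounded_sin_pm:
  "bounded (range (\<lambda>t. c * sin_p t))" "bounded (range (\<lambda>t. c * sin_m t))"
  "bounded (range (\<lambda>t. c / sin_p t))" "bounded (range (\<lambda>t. c / sin_m t))"
proof -
  have "cmod (c * sin_p t) \<le> cmod c * sin_hi" "cmod (c * sin_m t) \<le> cmod c * sin_hi" for t
    using sin_pm_bounds by (auto simp: norm_mult intro!: mult_left_mono)
  moreover have "cmod (c / sin_p t) \<le> cmod c / sin_lo" "cmod (c / sin_m t) \<le> cmod c / sin_lo" for t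
    using sin_pm_bounds sin_lo_pos sin_pm_nonzero by (auto simp: norm_divide intro!: divide_left_mono mult_pos_pos)
  ultimately show "bounded (range (\<lambda>t. c * sin_p t))" "bounded (range (\<lambda>t. c * sin_m t))"
    "bounded (range (\<lambda>t. c / sin_p t))" "bounded (range (\<lambda>t. c / sin_m t))"
    unfolding bounded_iff by blast+
qed

definition "hc \<xi> = complex_of_real (h_hat \<alpha> \<beta> w \<xi>)"

lemma h_hat_nonneg: "0 \<le> h_hat \<alpha> \<beta> w \<xi>"
  unfolding h_hat_eq_sum
  by (intro mult_nonneg_nonneg sum_nonneg h_term_nonneg) simp

lemma borel_measurable_hc [measurable]: "hc \<in> borel_measurable borel"
  unfolding hc_def[abs_def] using borel_measurable_h_hat by measurable

lemma bounded_hc: "bounded (range hc)"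
  unfolding bounded_iff hc_def using h_hat_le h_hat_nonneg by auto

text \<open>The right-hand side of the claimed formula, with the convolution written as its Fourier
  multiplier. It is matched with \<open>frame_op\<close> in \<open>frame_op_eq\<close> through its
  quadratic form.\<close>

definition "frame_form f = mult_l2 (\<lambda>t. of_real (pi / \<alpha>) / sin_m t)
  (IFT (mult_l2 hc (FT (mult_l2 (\<lambda>t. 1 / sin_p t) f))))" for f

text \<open>The sign \<open>(-1) ^ m\<close>, as a cosine so that negative \<open>m\<close> are
  covered.\<close>

definition "sgn_m m = complex_of_real (cos (pi * of_int m))" for m :: int

lemma sgn_m_square: "sgn_m m * sgn_m m = 1"
proof -
  have "(cos (pi * of_int m))\<^sup>2 = 1"
    using sin_cos_squared_add[of "pi * of_int m"] sin_npi_int[of m] by simp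
  then show ?thesis
    unfolding sgn_m_def by (metis of_real_1 of_real_mult power2_eq_square)
qed

lemma norm_sgn_m: "cmod (sgn_m m) = 1"
proof -
  have "cmod (sgn_m m) * cmod (sgn_m m) = 1"
    using arg_cong[OF sgn_m_square[of m], of cmod] by (simp only: norm_mult norm_one)
  then show ?thesis
    using norm_ge_zero[of "sgn_m m"] by (auto simp: square_eq_1_iff simp del: norm_ge_zero)
qed

lemma sin_shift: "sin (z - of_real (pi * of_int m)) = sgn_m m * sin z"
  unfolding sin_diff sgn_m_def cos_of_real sin_of_real by simp

text \<open>The Fourier transform of \<open>sin_m\<close> times the atom with indices
  \<open>m\<close>, \<open>n\<close>: an exponential cut to the interval of length
  \<open>1 / \<alpha>\<close> centred at \<open>\<beta> * n\<close>. Its modulus grows like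
  \<open>exp (2 * pi * w * (\<eta> - \<beta> * n))\<close>, whose square is the exponential in
  \<open>h_hat\<close>.\<close>

definition "cell m n \<eta> = of_real pi * sgn_m m * (indicator {- (1 / (2 * \<alpha>))..<1 / (2 * \<alpha>)} (\<eta> - \<beta> * of_int n) *
   exp (2 * of_real pi * \<i> * (- of_real (\<alpha> * of_int m) - \<i> * of_real w) * of_real (\<eta> - \<beta> * of_int n)))"
  for m n :: int and \<eta> :: real

lemma borel_measurable_cell [measurable]: "cell m n \<in> borel_measurable borel"
  unfolding cell_def[abs_def] by measurable

lemma sq_integrable_cell: "sq_integrable (cell m n)"
proof (rule sq_integrable_bounded_support)
  show "cell m n \<eta> = 0" if "\<eta> \<notin> {\<beta> * of_int n - 1 / (2 * \<alpha>)..\<beta> * of_int n + 1 / (2 * \<alpha>)}" for \<eta>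
    using that by (auto simp: cell_def indicator_def)
  show "cmod (cell m n \<eta>) \<le> pi * exp (2 * pi * w * (1 / (2 * \<alpha>)))" for \<eta>
  proof (cases "\<eta> - \<beta> * of_int n \<in> {- (1 / (2 * \<alpha>))..<1 / (2 * \<alpha>)}")
    case True
    then have "2 * pi * w * (\<eta> - \<beta> * of_int n) \<le> 2 * pi * w * (1 / (2 * \<alpha>))"
      using w by (intro mult_left_mono) auto
    moreover have "cmod (cell m n \<eta>) = pi * exp (2 * pi * w * (\<eta> - \<beta> * of_int n))"
      using True by (simp add: cell_def norm_mult norm_sgn_m)
    ultimately show ?thesis by simp
  next
    case False
    then show ?thesis by (simp add: cell_def)
  qed
qed measurable

lemma csq_cell: "csq (cell m n)"
  unfolding csq_def
proof (intro conjI exI[of _ "\<bar>\<beta> * of_int n\<bar> + 1 / (2 * \<alpha>)"] allI impI)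
  fix \<eta> assume \<eta>: "\<eta> \<notin> {- (\<bar>\<beta> * of_int n\<bar> + 1 / (2 * \<alpha>))..<\<bar>\<beta> * of_int n\<bar> + 1 / (2 * \<alpha>)}"
  have "\<eta> - \<beta> * of_int n \<notin> {- (1 / (2 * \<alpha>))..<1 / (2 * \<alpha>)}"
    using \<eta> abs_le_iff[of "\<beta> * of_int n" "\<bar>\<beta> * of_int n\<bar>"] by auto
  then show "cell m n \<eta> = 0" by (simp add: cell_def)
qed (use \<alpha> sq_integrable_cell in \<open>auto simp: add_nonneg_pos\<close>)

text \<open>Integrating the exponential over the symmetric interval gives
  \<open>sin (pi / \<alpha> * z) / (pi * z)\<close> with
  \<open>z = t - \<alpha> * m - \<i> * w\<close>. Because the translation by
  \<open>\<alpha> * m\<close> shifts the sine by \<open>pi * m\<close>, all atoms share the one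
  factor \<open>sin_m t\<close> up to sign, and \<open>sgn_m m\<close> in \<open>cell\<close>
  removes this sign; centring at \<open>\<beta> * n\<close> yields the modulation.\<close>

lemma inv_fourier_cell: "inv_fourier (cell m n) t = sin_m t * cauchy_atom \<alpha> \<beta> w m n t"
proof -
  let ?z = "of_real t - of_real \<alpha> * of_int m - \<i> * of_real w :: complex"
  let ?r = "1 / (2 * \<alpha>)"
  have z: "?z \<noteq> 0" using w by (simp add: complex_eq_iff)
  have "inv_fourier (cell m n) t = (LINT \<xi>|lborel. cell m n (\<beta> * of_int n + 1 * \<xi>) * ec (t * (\<beta> * of_int n + 1 * \<xi>)))"
    unfolding inv_fourier_ec by (subst lborel_integral_real_affine[where c = 1 and t = "\<beta> * of_int n"]) simp_all
  also have "\<dots> = (LINT \<xi>|lborel. (of_real pi * sgn_m m * ec (t * (\<beta> * of_int n))) *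
      (indicator {0 - ?r..<0 + ?r} \<xi> * exp (2 * of_real pi * \<i> * ?z * of_real \<xi>)))"
  proof (intro Bochner_Integration.integral_cong refl)
    fix \<xi> :: real
    have "exp (2 * of_real pi * \<i> * (- of_real (\<alpha> * of_int m) - \<i> * of_real w) * of_real \<xi>) * ec (t * \<xi>)
        = exp (2 * of_real pi * \<i> * ?z * of_real \<xi>)"
      unfolding ec_exp exp_add[symmetric] by (intro arg_cong[where f = exp]) (simp add: algebra_simps)
    then show "cell m n (\<beta> * of_int n + 1 * \<xi>) * ec (t * (\<beta> * of_int n + 1 * \<xi>)) = (of_real pi * sgn_m m * ec (t * (\<beta> * of_int n))) *
      (indicator {0 - ?r..<0 + ?r} \<xi> * exp (2 * of_real pi * \<i> * ?z * of_real \<xi>))"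
      unfolding cell_def by (simp add: distrib_left ec_add mult_ac)
  qed
  also have "\<dots> = of_real pi * sgn_m m * ec (t * (\<beta> * of_int n)) * (sin (of_real (2 * pi * ?r) * ?z) / (of_real pi * ?z))"
    using integral_exp_symmetric_Ico[OF z, of ?r 0] \<alpha> by simp
  also have "of_real (2 * pi * ?r) * ?z = of_real (pi / \<alpha>) * (of_real t - \<i> * of_real w) - of_real (pi * of_int m)"
    using \<alpha> by (simp add: field_simps)
  also have "sin \<dots> = sgn_m m * sin_m t"
    unfolding sin_shift sin_m_def ..
  also have "of_real pi * sgn_m m * ec (t * (\<beta> * of_int n)) * (sgn_m m * sin_m t / (of_real pi * ?z))
      = (sgn_m m * sgn_m m) * (sin_m t * (ec (t * (\<beta> * of_int n)) / ?z))"
    using z by (simp only: times_divide_eq_right times_divide_eq_left mult_ac)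
      (simp add: divide_simps)
  also have "ec (t * (\<beta> * of_int n)) / ?z = cauchy_atom \<alpha> \<beta> w m n t"
    unfolding cauchy_atom_def ec_exp by (simp add: mult_ac)
  finally show ?thesis by (simp add: sgn_m_square)
qed

text \<open>The atom is a bounded multiplier times the inverse transform of a compactly supported
  function, which replaces an estimate of its tails.\<close>

lemma sq_integrable_cauchy_atom: "sq_integrable (cauchy_atom \<alpha> \<beta> w m n)"
proof -
  have "sq_integrable (inv_fourier (cell m n))"
    by (intro sq_integrable_inv_fourier csq_sq_integrable csq_integrable csq_cell)
  from sq_integrable_bounded_mult[OF this _ bounded_sin_pm(4)[of 1]]
  have "sq_integrable (\<lambda>t. 1 / sin_m t * inv_fourier (cell m n) t)"
    by simp
  also have "(\<lambda>t. 1 / sin_m t * inv_fourier (cell m n) t) = cauchy_atom \<alpha> \<beta> w m n"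
    by (simp add: fun_eq_iff inv_fourier_cell sin_pm_nonzero)
  finally show ?thesis .
qed

text \<open>Since \<open>sin_p\<close> is the conjugate of \<open>sin_m\<close>, dividing
  \<open>f\<close> by \<open>sin_p\<close> can be compensated by multiplying the atom by
  \<open>sin_m\<close>, which makes it band-limited; Plancherel does the rest.\<close>

lemma l2_inner_cauchy_atom:
  "l2_inner f (abs_l2 (cauchy_atom \<alpha> \<beta> w m n)) = l2_inner (FT (mult_l2 (\<lambda>t. 1 / sin_p t) f)) (abs_l2 (cell m n))"
proof -
  note cc = csq_sq_integrable[OF csq_cell[of m n]] csq_integrable[OF csq_cell[of m n]]
  have meas [measurable]: "(\<lambda>t. 1 / sin_p t) \<in> borel_measurable borel" by simp
  have "l2_inner (FT (mult_l2 (\<lambda>t. 1 / sin_p t) f)) (abs_l2 (cell m n))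
      = l2_inner (mult_l2 (\<lambda>t. 1 / sin_p t) f) (abs_l2 (inv_fourier (cell m n)))"
    unfolding l2_inner_FT_left IFT_abs_eq[OF cc] ..
  also have "\<dots> = (LINT t|lborel. (1 / sin_p t * rep_l2 f t) * cnj (inv_fourier (cell m n) t))"
    unfolding mult_l2_def
    by (rule l2_inner_abs[OF sq_integrable_mult_rep[OF meas bounded_sin_pm(3)] sq_integrable_inv_fourier[OF cc]])
  also have "\<dots> = (LINT t|lborel. rep_l2 f t * cnj (cauchy_atom \<alpha> \<beta> w m n t))"
    by (intro Bochner_Integration.integral_cong refl)
       (simp add: inv_fourier_cell cnj_sin_p[symmetric] sin_pm_nonzero)
  finally show ?thesis
    by (simp add: l2_inner_abs_right[OF sq_integrable_cauchy_atom])
qed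

text \<open>The piece of \<open>k\<close> on the common interval of all cells with second index
  \<open>n\<close>, weighted by the modulus of their exponential. Up to unimodular factors and
  \<open>pi\<close>, its Fourier coefficients are the inner products with these cells.\<close>

definition "slice k n \<eta> = indicator {- (1 / (2 * \<alpha>))..<1 / (2 * \<alpha>)} (\<eta> - \<beta> * of_int n) *
   of_real (exp (2 * pi * w * (\<eta> - \<beta> * of_int n))) * k \<eta>" for k :: "real \<Rightarrow> complex" and n :: int

lemma sq_integrable_slice:
  assumes "sq_integrable k"
  shows "sq_integrable (slice k n)"
proof -
  have "cmod (indicator {- (1 / (2 * \<alpha>))..<1 / (2 * \<alpha>)} (\<eta> - \<beta> * of_int n) *
      of_real (exp (2 * pi * w * (\<eta> - \<beta> * of_int n)))) \<le> exp (2 * pi * w * (1 / (2 * \<alpha>)))" for \<eta>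
  proof (cases "\<eta> - \<beta> * of_int n \<in> {- (1 / (2 * \<alpha>))..<1 / (2 * \<alpha>)}")
    case True
    then have "2 * pi * w * (\<eta> - \<beta> * of_int n) \<le> 2 * pi * w * (1 / (2 * \<alpha>))"
      using w by (intro mult_left_mono) auto
    then show ?thesis using True by (simp add: norm_mult)
  qed simp
  then show ?thesis
    unfolding slice_def[abs_def]
    by (intro sq_integrable_bounded_mult assms) (auto simp: bounded_iff)
qed

text \<open>For fixed \<open>n\<close> the cells differ only by constants and by characters of
  period \<open>1 / \<alpha>\<close>, exactly the length of the interval, so this is Parseval there.
  The factor \<open>pi\<^sup>2\<close> is the square of the \<open>pi\<close> in
  \<open>cell\<close>.\<close>

lemma has_sum_slice:
  "((\<lambda>m. (cmod (l2_inner K (abs_l2 (cell m n))))\<^sup>2) has_sum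
     pi\<^sup>2 / \<alpha> * (LINT \<eta>|lborel. (cmod (slice (rep_l2 K) n \<eta>))\<^sup>2)) UNIV"
proof -
  let ?u = "slice (rep_l2 K) n"
  have "((\<lambda>m. (cmod (LINT \<eta>|lborel. ?u \<eta> * ec (of_int m * \<eta> / (1 / \<alpha>))))\<^sup>2) has_sum
      1 / \<alpha> * (LINT \<eta>|lborel. (cmod (?u \<eta>))\<^sup>2)) UNIV"
  proof (rule Parseval_interval[where a = "\<beta> * of_int n - 1 / (2 * \<alpha>)"])
    show "?u \<eta> = 0" if "\<eta> \<notin> {\<beta> * of_int n - 1 / (2 * \<alpha>)..<\<beta> * of_int n - 1 / (2 * \<alpha>) + 1 / \<alpha>}" for \<eta>
    proof -
      have "1 / \<alpha> = 1 / (2 * \<alpha>) + 1 / (2 * \<alpha>)" using \<alpha> by (simp add: field_simps)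
      then have "\<eta> - \<beta> * of_int n \<notin> {- (1 / (2 * \<alpha>))..<1 / (2 * \<alpha>)}" using that by auto
      then show ?thesis by (simp add: slice_def)
    qed
  qed (use \<alpha> in \<open>auto intro: sq_integrable_slice\<close>)
  from has_sum_cmult_right[OF this, of "pi\<^sup>2"]
  have "((\<lambda>m. pi\<^sup>2 * (cmod (LINT \<eta>|lborel. ?u \<eta> * ec (of_int m * \<eta> / (1 / \<alpha>))))\<^sup>2) has_sum
      pi\<^sup>2 / \<alpha> * (LINT \<eta>|lborel. (cmod (?u \<eta>))\<^sup>2)) UNIV"
    by simp
  moreover have "cmod (l2_inner K (abs_l2 (cell m n))) = pi * cmod (LINT \<eta>|lborel. ?u \<eta> * ec (of_int m * \<eta> / (1 / \<alpha>)))" for m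
  proof -
    \<comment> \<open>A constant of modulus \<open>pi\<close>: the sign and the phase caused by
      centring the exponential at \<open>\<beta> * n\<close> are unimodular.\<close>
    let ?c = "of_real pi * sgn_m m * ec (- (\<alpha> * of_int m * (\<beta> * of_int n)))"
    have "l2_inner K (abs_l2 (cell m n)) = (LINT \<eta>|lborel. rep_l2 K \<eta> * cnj (cell m n \<eta>))"
      by (rule l2_inner_abs_right[OF sq_integrable_cell])
    also have "\<dots> = (LINT \<eta>|lborel. ?c * (?u \<eta> * ec (of_int m * \<eta> / (1 / \<alpha>))))"
    proof (intro Bochner_Integration.integral_cong refl)
      fix \<eta> :: real
      have "exp (2 * of_real pi * \<i> * (- of_real (\<alpha> * of_int m) - \<i> * of_real w) * of_real (\<eta> - \<beta> * of_int n))
          = of_real (exp (2 * pi * w * (\<eta> - \<beta> * of_int n))) * ec (- (\<alpha> * of_int m * (\<eta> - \<beta> * of_int n)))"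
        unfolding ec_exp exp_of_real[symmetric] exp_add[symmetric]
        by (intro arg_cong[where f = exp]) (simp add: algebra_simps)
      moreover have "ec (\<alpha> * of_int m * (\<eta> - \<beta> * of_int n)) = ec (- (\<alpha> * of_int m * (\<beta> * of_int n))) * ec (of_int m * \<eta> / (1 / \<alpha>))"
        unfolding ec_add[symmetric] by (intro arg_cong[where f = ec]) (simp add: algebra_simps)
      moreover have "cnj (sgn_m m) = sgn_m m" by (simp add: sgn_m_def)
      ultimately show "rep_l2 K \<eta> * cnj (cell m n \<eta>) = ?c * (?u \<eta> * ec (of_int m * \<eta> / (1 / \<alpha>)))"
        unfolding cell_def slice_def by (simp add: cnj_ec cnj_indicator mult_ac)
    qed
    finally show ?thesis
      by (simp add: norm_mult norm_sgn_m)
  qed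
  ultimately show ?thesis by (simp add: power_mult_distrib)
qed

text \<open>Squaring doubles the growth rate \<open>2 * pi * w\<close> to the
  \<open>4 * pi * w\<close> of \<open>h_hat\<close>; Tonelli then moves the sum over
  \<open>n\<close> inside. Slices use half-open intervals and \<open>h_hat\<close> closed ones,
  which differ in one point for each \<open>n\<close>.\<close>

lemma has_sum_slices:
  "((\<lambda>n. LINT \<eta>|lborel. (cmod (slice (rep_l2 K) n \<eta>))\<^sup>2) has_sum
     (LINT \<eta>|lborel. h_hat \<alpha> \<beta> w \<eta> / pi * (cmod (rep_l2 K \<eta>))\<^sup>2)) UNIV"
proof (subst has_sum_int_iff_nn_integral)
  let ?k = "rep_l2 K"
  note [measurable] = borel_measurable_h_hat borel_measurable_h_term
    sq_integrable_measurable[OF sq_integrable_slice[OF sq_integrable_rep[of K]]]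
  let ?t = "h_term"
  have slice: "(\<integral>\<^sup>+\<eta>. ennreal ((cmod (slice ?k n \<eta>))\<^sup>2) \<partial>lborel) = ennreal (LINT \<eta>|lborel. (cmod (slice ?k n \<eta>))\<^sup>2)" for n
    using sq_integrable_slice[OF sq_integrable_rep[of K], of n]
    by (intro nn_integral_eq_integral) (auto simp: sq_integrable_def)
  have AE: "AE \<eta> in lborel. (cmod (slice ?k n \<eta>))\<^sup>2 = ?t n \<eta> * (cmod (?k \<eta>))\<^sup>2" for n
    using AE_lborel_singleton[of "\<beta> * of_int n + 1 / (2 * \<alpha>)"]
  proof eventually_elim
    case (elim \<eta>)
    have "(exp (2 * pi * w * (\<eta> - \<beta> * of_int n)))\<^sup>2 = exp (4 * pi * w * (\<eta> - \<beta> * of_int n))"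
      by (simp add: exp_double[symmetric] flip: exp_of_nat_mult)
    then show ?case
      using elim unfolding slice_def h_term_def
      by (auto simp: indicator_def norm_mult power_mult_distrib)
  qed
  have "(\<integral>\<^sup>+n. ennreal (LINT \<eta>|lborel. (cmod (slice ?k n \<eta>))\<^sup>2) \<partial>count_space UNIV)
      = (\<integral>\<^sup>+n. \<integral>\<^sup>+\<eta>. ennreal (?t n \<eta> * (cmod (?k \<eta>))\<^sup>2) \<partial>lborel \<partial>count_space UNIV)"
    unfolding slice[symmetric]
  proof (rule nn_integral_cong)
    fix n
    show "(\<integral>\<^sup>+\<eta>. ennreal ((cmod (slice ?k n \<eta>))\<^sup>2) \<partial>lborel) = (\<integral>\<^sup>+\<eta>. ennreal (?t n \<eta> * (cmod (?k \<eta>))\<^sup>2) \<partial>lborel)"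
      by (rule nn_integral_cong_AE) (use AE[of n] in \<open>eventually_elim, simp\<close>)
  qed
  also have "\<dots> = (\<integral>\<^sup>+\<eta>. \<integral>\<^sup>+n. ennreal (?t n \<eta> * (cmod (?k \<eta>))\<^sup>2) \<partial>count_space UNIV \<partial>lborel)"
    by (rule nn_integral_count_space_nn_integral[symmetric]) auto
  also have "\<dots> = (\<integral>\<^sup>+\<eta>. ennreal (h_hat \<alpha> \<beta> w \<eta> / pi * (cmod (?k \<eta>))\<^sup>2) \<partial>lborel)"
  proof (rule nn_integral_cong)
    fix \<eta>
    have "((\<lambda>n. ?t n \<eta> * (cmod (?k \<eta>))\<^sup>2) has_sum (h_hat \<alpha> \<beta> w \<eta> / pi * (cmod (?k \<eta>))\<^sup>2)) UNIV"
      using h_term_has_sum[of \<eta>] unfolding h_hat_eq_sum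
      by (intro has_sum_cmult_left) simp
    then show "(\<integral>\<^sup>+n. ennreal (?t n \<eta> * (cmod (?k \<eta>))\<^sup>2) \<partial>count_space UNIV) = ennreal (h_hat \<alpha> \<beta> w \<eta> / pi * (cmod (?k \<eta>))\<^sup>2)"
      by (subst (asm) has_sum_int_iff_nn_integral) (auto simp: h_term_nonneg h_hat_nonneg)
  qed
  also have "\<dots> = ennreal (LINT \<eta>|lborel. h_hat \<alpha> \<beta> w \<eta> / pi * (cmod (?k \<eta>))\<^sup>2)"
  proof (rule nn_integral_eq_integral)
    have "integrable lborel (\<lambda>\<eta>. ((1 / (\<alpha> * \<beta>) + 1) * exp (2 * pi * w / \<alpha>)) * (cmod (?k \<eta>))\<^sup>2)"
      using sq_integrable_rep[of K] by (auto simp: sq_integrable_def)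
    then show "integrable lborel (\<lambda>\<eta>. h_hat \<alpha> \<beta> w \<eta> / pi * (cmod (?k \<eta>))\<^sup>2)"
    proof (rule Bochner_Integration.integrable_bound)
      show "AE \<eta> in lborel. norm (h_hat \<alpha> \<beta> w \<eta> / pi * (cmod (?k \<eta>))\<^sup>2)
          \<le> norm (((1 / (\<alpha> * \<beta>) + 1) * exp (2 * pi * w / \<alpha>)) * (cmod (?k \<eta>))\<^sup>2)"
      proof (rule AE_I2)
        fix \<eta>
        have le: "h_hat \<alpha> \<beta> w \<eta> / pi \<le> (1 / (\<alpha> * \<beta>) + 1) * exp (2 * pi * w / \<alpha>)"
          using h_hat_le[of \<eta>] by (simp add: pos_divide_le_eq mult.commute)
        have nonneg: "0 \<le> h_hat \<alpha> \<beta> w \<eta> / pi" using h_hat_nonneg by simp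
        show "norm (h_hat \<alpha> \<beta> w \<eta> / pi * (cmod (?k \<eta>))\<^sup>2)
          \<le> norm (((1 / (\<alpha> * \<beta>) + 1) * exp (2 * pi * w / \<alpha>)) * (cmod (?k \<eta>))\<^sup>2)"
          using mult_right_mono[OF le zero_le_power2[of "cmod (?k \<eta>)"]] mult_nonneg_nonneg[OF nonneg zero_le_power2[of "cmod (?k \<eta>)"]]
          unfolding real_norm_def by linarith
      qed
    qed measurable
  qed (auto simp: h_hat_nonneg)
  finally show "(\<integral>\<^sup>+n. ennreal (LINT \<eta>|lborel. (cmod (slice ?k n \<eta>))\<^sup>2) \<partial>count_space UNIV)
      = ennreal (LINT \<eta>|lborel. h_hat \<alpha> \<beta> w \<eta> / pi * (cmod (?k \<eta>))\<^sup>2)" .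
qed (auto intro!: Bochner_Integration.integral_nonneg simp: h_hat_nonneg)

text \<open>The outer factor \<open>1 / sin_m\<close> is the conjugate of the inner
  \<open>1 / sin_p\<close>; taken to the other side of the inner product it produces the same
  function \<open>F\<close> in both slots, and the form becomes an integral of \<open>h_hat\<close>
  against a squared modulus.\<close>

lemma l2_inner_frame_form:
  "l2_inner (frame_form f) f = of_real (pi\<^sup>2 / \<alpha> *
     (LINT \<eta>|lborel. h_hat \<alpha> \<beta> w \<eta> / pi * (cmod (rep_l2 (FT (mult_l2 (\<lambda>t. 1 / sin_p t) f)) \<eta>))\<^sup>2))"
proof -
  define F where "F = mult_l2 (\<lambda>t. 1 / sin_p t) f"
  define u where "u = IFT (mult_l2 hc (FT F))"
  have meas: "(\<lambda>t. c / sin_p t) \<in> borel_measurable borel" for c by simp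
  have "frame_form f = mult_l2 (\<lambda>t. cnj (of_real (pi / \<alpha>) / sin_p t)) u"
    unfolding frame_form_def u_def F_def by (simp add: cnj_sin_p)
  then have "l2_inner (frame_form f) f = l2_inner u (mult_l2 (\<lambda>t. of_real (pi / \<alpha>) / sin_p t) f)"
    using l2_inner_mult_left[OF meas bounded_sin_pm(3), of "of_real (pi / \<alpha>)" u f] by (simp only:)
  also have "mult_l2 (\<lambda>t. of_real (pi / \<alpha>) / sin_p t) f = scaleC_l2 (of_real (pi / \<alpha>)) F"
    unfolding F_def mult_l2_def abs_l2_scaleC[OF sq_integrable_mult_rep[OF meas bounded_sin_pm(3)]] by simp
  also have "l2_inner u \<dots> = of_real (pi / \<alpha>) * l2_inner (mult_l2 hc (FT F)) (FT F)"
    unfolding l2_inner_scaleC_right u_def l2_inner_IFT_left by simp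
  also have "l2_inner (mult_l2 hc (FT F)) (FT F) = (LINT \<eta>|lborel. of_real (h_hat \<alpha> \<beta> w \<eta> * (cmod (rep_l2 (FT F) \<eta>))\<^sup>2))"
    unfolding mult_l2_def using l2_inner_abs[OF sq_integrable_mult_rep[OF borel_measurable_hc bounded_hc] sq_integrable_rep, of "FT F" "FT F"]
    by (simp only: abs_rep_l2 of_real_mult complex_norm_square hc_def mult.assoc)
  also have "\<dots> = of_real (pi * (LINT \<eta>|lborel. h_hat \<alpha> \<beta> w \<eta> / pi * (cmod (rep_l2 (FT F) \<eta>))\<^sup>2))"
    unfolding integral_complex_of_real by simp
  finally show ?thesis unfolding F_def by (simp add: power2_eq_square)
qed

lemma frame_quadratic_form:
  "((\<lambda>i. complex_of_real ((cmod (l2_inner f (abs_l2 (cauchy_atom \<alpha> \<beta> w (fst i) (snd i)))))\<^sup>2))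
     has_sum l2_inner (frame_form f) f) UNIV"
proof -
  define K where "K = FT (mult_l2 (\<lambda>t. 1 / sin_p t) f)"
  let ?c = "\<lambda>m n. (cmod (l2_inner K (abs_l2 (cell m n))))\<^sup>2"
  let ?J = "pi\<^sup>2 / \<alpha> * (LINT \<eta>|lborel. h_hat \<alpha> \<beta> w \<eta> / pi * (cmod (rep_l2 K \<eta>))\<^sup>2)"
  have outer: "((\<lambda>n. pi\<^sup>2 / \<alpha> * (LINT \<eta>|lborel. (cmod (slice (rep_l2 K) n \<eta>))\<^sup>2)) has_sum ?J) UNIV"
    by (intro has_sum_cmult_right has_sum_slices)
  \<comment> \<open>The pair is ordered \<open>(n, m)\<close>: summing over \<open>m\<close> for
    fixed \<open>n\<close> is Parseval on one interval, and summing the results over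
    \<open>n\<close> assembles \<open>h_hat\<close>. The coordinates are swapped back
    afterwards.\<close>
  have "((\<lambda>(n, m). ?c m n) has_sum ?J) (UNIV \<times> UNIV)"
  proof (rule has_sum_SigmaI[OF _ outer])
    show "((\<lambda>m. case (n, m) of (n, m) \<Rightarrow> ?c m n) has_sum pi\<^sup>2 / \<alpha> * (LINT \<eta>|lborel. (cmod (slice (rep_l2 K) n \<eta>))\<^sup>2)) UNIV" for n
      using has_sum_slice[of K n] by simp
    show "(\<lambda>(n, m). ?c m n) summable_on (UNIV \<times> UNIV)"
      by (rule summable_on_SigmaI[OF _ has_sum_imp_summable[OF outer]]) (use has_sum_slice in auto)
  qed
  then have "((\<lambda>i. ?c (fst i) (snd i)) has_sum ?J) UNIV"
    by (subst has_sum_reindex_bij_betw[OF bij_swap, symmetric]) (simp add: case_prod_unfold)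
  from has_sum_of_real[OF this] show ?thesis
    unfolding l2_inner_cauchy_atom l2_inner_frame_form K_def .
qed

lemma frame_form_linear:
  "frame_form (f + g) = frame_form f + frame_form g"
  "frame_form (scaleC_l2 c f) = scaleC_l2 c (frame_form f)"
proof -
  have A: "(\<lambda>t. of_real (pi / \<alpha>) / sin_m t) \<in> borel_measurable borel" and B: "(\<lambda>t. 1 / sin_p t) \<in> borel_measurable borel"
    by simp_all
  show "frame_form (f + g) = frame_form f + frame_form g"
    unfolding frame_form_def mult_l2_add[OF B bounded_sin_pm(3)] FT_add mult_l2_add[OF borel_measurable_hc bounded_hc]
      IFT_add mult_l2_add[OF A bounded_sin_pm(4)] ..
  show "frame_form (scaleC_l2 c f) = scaleC_l2 c (frame_form f)"
    unfolding frame_form_def mult_l2_scaleC[OF B bounded_sin_pm(3)] FT_scaleC mult_l2_scaleC[OF borel_measurable_hc bounded_hc]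
      IFT_scaleC mult_l2_scaleC[OF A bounded_sin_pm(4)] ..
qed

lemma norm_frame_form: "\<exists>B>0. \<forall>f. norm (frame_form f) \<le> B * norm f"
proof -
  obtain A where A: "\<And>t. cmod (of_real (pi / \<alpha>) / sin_m t) \<le> A" using bounded_sin_pm(4) unfolding bounded_iff by blast
  obtain B where B: "\<And>t. cmod (1 / sin_p t) \<le> B" using bounded_sin_pm(3) unfolding bounded_iff by blast
  obtain C where C: "\<And>t. cmod (hc t) \<le> C" using bounded_hc unfolding bounded_iff by blast
  have AC: "A \<ge> 0" "C \<ge> 0" "B \<ge> 0"
    using order.trans[OF norm_ge_zero A] order.trans[OF norm_ge_zero C] order.trans[OF norm_ge_zero B] by auto
  \<comment> \<open>The added 1 makes the constant strictly positive, as
    \<open>l2_frame_has_sum\<close> requires.\<close>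
  have "norm (frame_form f) \<le> (1 + A * (C * B)) * norm f" for f
  proof -
    have "norm (frame_form f) \<le> A * norm (mult_l2 hc (FT (mult_l2 (\<lambda>t. 1 / sin_p t) f)))"
      unfolding frame_form_def by (rule order.trans[OF norm_mult_l2_le[OF _ A]]) simp_all
    also have "\<dots> \<le> A * (C * norm (mult_l2 (\<lambda>t. 1 / sin_p t) f))"
      by (rule mult_left_mono[OF order.trans[OF norm_mult_l2_le[OF _ C]]]) (simp_all add: AC)
    also have "\<dots> \<le> A * (C * (B * norm f))"
      by (intro mult_left_mono norm_mult_l2_le B AC) simp
    also have "\<dots> \<le> (1 + A * (C * B)) * norm f"
      by (simp add: algebra_simps)
    finally show ?thesis .
  qed
  moreover have "1 + A * (C * B) > 0" using AC by (simp add: add_pos_nonneg)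
  ultimately show ?thesis by blast
qed

lemma frame_op_eq: "frame_op \<alpha> \<beta> w f = frame_form f"
proof -
  obtain B where B: "B > 0" "\<And>f. norm (frame_form f) \<le> B * norm f" using norm_frame_form by blast
  have "((\<lambda>i. scaleC_l2 (l2_inner f (abs_l2 (cauchy_atom \<alpha> \<beta> w (fst i) (snd i)))) (abs_l2 (cauchy_atom \<alpha> \<beta> w (fst i) (snd i))))
      has_sum frame_form f) UNIV"
    by (rule l2_frame_has_sum[OF frame_form_linear B frame_quadratic_form])
  then show ?thesis
    unfolding frame_op_def by (intro infsumI) (simp add: case_prod_unfold)
qed

end

section \<open>The inverse and the canonical dual window\<close>

context cauchy_gabor
begin

definition "frame_inv f = mult_l2 sin_p
  (IFT (mult_l2 (\<lambda>\<xi>. 1 / hc \<xi>) (FT (mult_l2 (\<lambda>t. of_real (\<alpha> / pi) * sin_m t) f))))" for f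

lemma h_hat_pos: "0 < h_hat \<alpha> \<beta> w \<xi>"
  by (rule less_le_trans[OF _ h_hat_ge]) simp

lemma hc_nonzero: "hc \<xi> \<noteq> 0"
  using h_hat_pos[of \<xi>] by (simp add: hc_def)

lemma bounded_inverse_hc: "bounded (range (\<lambda>\<xi>. 1 / hc \<xi>))"
proof -
  have pos: "0 < pi * exp (- (2 * pi * w / \<alpha>))" by simp
  have "cmod (1 / hc \<xi>) \<le> 1 / (pi * exp (- (2 * pi * w / \<alpha>)))" for \<xi>
  proof -
    have "cmod (1 / hc \<xi>) = 1 / h_hat \<alpha> \<beta> w \<xi>"
      using h_hat_nonneg by (simp add: hc_def norm_divide)
    also have "\<dots> \<le> 1 / (pi * exp (- (2 * pi * w / \<alpha>)))"
      by (rule divide_left_mono[OF h_hat_ge _ mult_pos_pos[OF h_hat_pos pos]]) simp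
    finally show ?thesis .
  qed
  then show ?thesis unfolding bounded_iff by blast
qed

lemma multiplier_measurable:
  "(\<lambda>t. c / sin_p t) \<in> borel_measurable borel" "(\<lambda>t. c / sin_m t) \<in> borel_measurable borel"
  "(\<lambda>t. c * sin_p t) \<in> borel_measurable borel" "(\<lambda>t. c * sin_m t) \<in> borel_measurable borel"
  "(\<lambda>\<xi>. 1 / hc \<xi>) \<in> borel_measurable borel"
  by simp_all

lemma bounded_sin_p: "bounded (range sin_p)"
  using bounded_sin_pm(1)[of 1] by simp

lemma bounded_sin_m: "bounded (range sin_m)"
  using bounded_sin_pm(2)[of 1] by simp

lemma multiplier_cancel:
  "mult_l2 (\<lambda>t. 1 / sin_p t) (mult_l2 sin_p f) = f"
  "mult_l2 sin_p (mult_l2 (\<lambda>t. 1 / sin_p t) f) = f"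
  "mult_l2 hc (mult_l2 (\<lambda>\<xi>. 1 / hc \<xi>) f) = f"
  "mult_l2 (\<lambda>\<xi>. 1 / hc \<xi>) (mult_l2 hc f) = f"
  "mult_l2 (\<lambda>t. of_real (pi / \<alpha>) / sin_m t) (mult_l2 (\<lambda>t. of_real (\<alpha> / pi) * sin_m t) f) = f"
  "mult_l2 (\<lambda>t. of_real (\<alpha> / pi) * sin_m t) (mult_l2 (\<lambda>t. of_real (pi / \<alpha>) / sin_m t) f) = f"
  using \<alpha>
  by (auto intro!: mult_l2_cancel multiplier_measurable bounded_sin_p bounded_inverse_hc bounded_hc bounded_sin_pm
      simp: sin_pm_nonzero hc_nonzero simp del: of_real_divide)
     (simp_all add: field_simps sin_pm_nonzero)

lemma frame_form_frame_inv: "frame_form (frame_inv f) = f"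
  unfolding frame_form_def frame_inv_def by (simp only: multiplier_cancel FT_IFT IFT_FT)

lemma frame_inv_frame_form: "frame_inv (frame_form f) = f"
  unfolding frame_form_def frame_inv_def by (simp only: multiplier_cancel FT_IFT IFT_FT)

lemma bij_frame_op: "bij (frame_op \<alpha> \<beta> w)"
  and inv_frame_op: "inv (frame_op \<alpha> \<beta> w) = frame_inv"
proof -
  have eq: "frame_op \<alpha> \<beta> w = frame_form" by (simp add: fun_eq_iff frame_op_eq)
  have "frame_inv \<circ> frame_form = id" "frame_form \<circ> frame_inv = id"
    by (simp_all add: fun_eq_iff frame_inv_frame_form frame_form_frame_inv)
  then show "bij (frame_op \<alpha> \<beta> w)" "inv (frame_op \<alpha> \<beta> w) = frame_inv"
    unfolding eq by (auto intro: o_bij inv_unique_comp)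
qed

lemma frame_op_convolution:
  "AE x in lborel. rep_l2 (frame_op \<alpha> \<beta> w f) x =
     of_real pi / (of_real \<alpha> * sin_m x) * rep_l2 (abs_l2 (\<lambda>t. rep_l2 f t / sin_p t) \<star> h_distr \<alpha> \<beta> w) x"
proof -
  have conv: "abs_l2 (\<lambda>t. rep_l2 f t / sin_p t) \<star> h_distr \<alpha> \<beta> w = IFT (mult_l2 hc (FT (mult_l2 (\<lambda>t. 1 / sin_p t) f)))"
    using l2_convolution_eq[OF borel_measurable_hc bounded_hc, of "abs_l2 (\<lambda>t. rep_l2 f t / sin_p t)"]
    by (simp add: h_distr_def hc_def[abs_def] mult_l2_def[of "\<lambda>t. 1 / sin_p t"])
  show ?thesis
    unfolding frame_op_eq frame_form_def conv
    using rep_mult_l2[OF multiplier_measurable(2) bounded_sin_pm(4), of "of_real (pi / \<alpha>)"]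
    by eventually_elim simp
qed

lemma frame_inv_eq:
  "frame_inv f = scaleC_l2 (of_real (\<alpha> / pi)) (mult_l2 sin_p (IFT (mult_l2 (\<lambda>\<xi>. 1 / hc \<xi>) (FT (mult_l2 sin_m f)))))"
proof -
  have "mult_l2 (\<lambda>t. of_real (\<alpha> / pi) * sin_m t) f = scaleC_l2 (of_real (\<alpha> / pi)) (mult_l2 sin_m f)"
    unfolding mult_l2_def abs_l2_scaleC[OF sq_integrable_mult_rep[OF borel_measurable_sin_pm(2) bounded_sin_m]]
    by (simp only: mult.assoc)
  then show ?thesis
    unfolding frame_inv_def
    by (simp only: FT_scaleC IFT_scaleC mult_l2_scaleC[OF multiplier_measurable(5) bounded_inverse_hc]
        mult_l2_scaleC[OF borel_measurable_sin_pm(1) bounded_sin_p])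
qed

lemma rep_frame_inv:
  "AE t in lborel. rep_l2 (frame_inv f) t =
     of_real (\<alpha> / pi) * sin_p t * rep_l2 (IFT (mult_l2 (\<lambda>\<xi>. 1 / hc \<xi>) (FT (mult_l2 sin_m f)))) t"
  using rep_l2_scaleC[of "of_real (\<alpha> / pi)" "mult_l2 sin_p (IFT (mult_l2 (\<lambda>\<xi>. 1 / hc \<xi>) (FT (mult_l2 sin_m f))))"]
    rep_mult_l2[OF borel_measurable_sin_pm(1) bounded_sin_p, of "IFT (mult_l2 (\<lambda>\<xi>. 1 / hc \<xi>) (FT (mult_l2 sin_m f)))"]
  unfolding frame_inv_eq by eventually_elim simp

lemma frame_inv_convolution:
  "AE t in lborel. rep_l2 (frame_inv f) t =
     of_real (\<alpha> / pi) * sin_p t * rep_l2 (abs_l2 (\<lambda>x. rep_l2 f x * sin_m x) \<star> h_tilde_distr \<alpha> \<beta> w) t"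
proof -
  have "abs_l2 (\<lambda>x. rep_l2 f x * sin_m x) \<star> h_tilde_distr \<alpha> \<beta> w = IFT (mult_l2 (\<lambda>\<xi>. 1 / hc \<xi>) (FT (mult_l2 sin_m f)))"
    using l2_convolution_eq[OF multiplier_measurable(5) bounded_inverse_hc, of "abs_l2 (\<lambda>x. rep_l2 f x * sin_m x)"]
    by (simp add: h_tilde_distr_def hc_def[abs_def] mult_l2_def[of sin_m] mult.commute)
  then show ?thesis using rep_frame_inv by simp
qed

section \<open>The canonical dual window in closed form\<close>

definition "dual_weight s = 1 / (1 + exp (s * (4 * pi * w * \<beta>)))" for s :: real

text \<open>The quotient of \<open>cell 0 0\<close> by \<open>h_hat\<close>, see
  \<open>AE_dual_hat\<close>. Intervals are written as centre plus or minus radius to fit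
  \<open>integral_exp_symmetric_Ico\<close>; the outer two have length
  \<open>1 / \<alpha> - \<beta>\<close>, the \<epsilon> of the final formula. There the central
  interval overlaps the translate with index 1 (on the right) or -1 (on the left), which produces
  the weights.\<close>

definition "dual_hat \<eta> =
  indicator {0 - (\<beta> - 1 / (2 * \<alpha>))..<0 + (\<beta> - 1 / (2 * \<alpha>))} \<eta> * exp (complex_of_real (- 2 * pi * w) * of_real \<eta>)
  + of_real (dual_weight (-1)) * (indicator {\<beta> / 2 - (1 / \<alpha> - \<beta>) / 2..<\<beta> / 2 + (1 / \<alpha> - \<beta>) / 2} \<eta> * exp (complex_of_real (- 2 * pi * w) * of_real \<eta>))
  + of_real (dual_weight 1) * (indicator {- \<beta> / 2 - (1 / \<alpha> - \<beta>) / 2..<- \<beta> / 2 + (1 / \<alpha> - \<beta>) / 2} \<eta> * exp (complex_of_real (- 2 * pi * w) * of_real \<eta>))"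

lemma integrable_dual_hat: "integrable lborel dual_hat"
  unfolding dual_hat_def[abs_def]
  by (intro Bochner_Integration.integrable_add integrable_mult_right integrable_Ico_exp)

text \<open>With \<open>E = exp (2 * pi * w * \<eta>)\<close>, the numerator is
  \<open>pi * E\<close> and every active term of \<open>h_hat\<close> is \<open>pi * E * E\<close>
  times a constant depending only on its index. The quotient is therefore \<open>1 / E\<close> times
  a weight determined by the overlapping neighbours.\<close>

lemma h_hat_quotient:
  assumes S: "h_supp \<eta> = insert 0 S" "S = {} \<or> S = {1} \<or> S = {-1}"
    and \<eta>: "\<eta> \<in> {- (1 / (2 * \<alpha>))..<1 / (2 * \<alpha>)}"
  shows "cell 0 0 \<eta> / hc \<eta> = of_real (exp (- 2 * pi * w * \<eta>) *
    (if S = {} then 1 else if S = {1} then dual_weight (-1) else dual_weight 1))"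
proof -
  define E where "E = exp (2 * pi * w * \<eta>)"
  have E: "E > 0" by (simp add: E_def)
  have h_term: "h_term m \<eta> = E * E * exp (- of_int m * (4 * pi * w * \<beta>))" if "m \<in> h_supp \<eta>" for m
    using that unfolding h_supp_def h_term_def E_def by (simp add: exp_add[symmetric] algebra_simps)
  have "0 \<notin> S" using S(2) by auto
  then have h: "h_hat \<alpha> \<beta> w \<eta> = pi * (E * E * (1 + (\<Sum>m\<in>S. exp (- of_int m * (4 * pi * w * \<beta>)))))"
  proof -
    have "finite S" using S(2) by auto
    have "(\<Sum>m\<in>h_supp \<eta>. h_term m \<eta>) = (\<Sum>m\<in>insert 0 S. E * E * exp (- of_int m * (4 * pi * w * \<beta>)))"
      unfolding S(1)[symmetric] by (intro sum.cong refl h_term)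
    also have "\<dots> = E * E * (1 + (\<Sum>m\<in>S. exp (- of_int m * (4 * pi * w * \<beta>))))"
      unfolding sum_distrib_left[symmetric] using \<open>finite S\<close> \<open>0 \<notin> S\<close> by simp
    finally show ?thesis unfolding h_hat_eq_sum by (rule arg_cong)
  qed
  have "2 * of_real pi * \<i> * (- of_real (\<alpha> * of_int 0) - \<i> * of_real w) * of_real (\<eta> - \<beta> * of_int 0)
      = complex_of_real (2 * pi * w * \<eta>)"
    by simp
  then have c: "cell 0 0 \<eta> = of_real (pi * E)"
    using \<eta> unfolding cell_def E_def by (simp only: exp_of_real) (simp add: sgn_m_def)
  have Einv: "exp (- 2 * pi * w * \<eta>) = 1 / E"
    by (simp add: E_def exp_minus field_simps)
  have "cell 0 0 \<eta> / hc \<eta> = of_real (pi * E / (pi * (E * E * (1 + (\<Sum>m\<in>S. exp (- of_int m * (4 * pi * w * \<beta>)))))))"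
    unfolding c hc_def h of_real_divide ..
  also have "pi * E / (pi * (E * E * (1 + (\<Sum>m\<in>S. exp (- of_int m * (4 * pi * w * \<beta>)))))) =
      1 / E * (1 / (1 + (\<Sum>m\<in>S. exp (- of_int m * (4 * pi * w * \<beta>)))))"
    using E by simp
  also have "1 / (1 + (\<Sum>m\<in>S. exp (- of_int m * (4 * pi * w * \<beta>)))) =
      (if S = {} then 1 else if S = {1} then dual_weight (-1) else dual_weight 1)"
    using S(2) by (auto simp: dual_weight_def)
  finally show ?thesis unfolding Einv .
qed

text \<open>Away from finitely many breakpoints, each of the three pieces has a fixed set of
  overlapping translates, and \<open>h_hat_quotient\<close> evaluates it.\<close>

lemma AE_dual_hat:
  assumes half: "\<alpha> * \<beta> \<ge> 1 / 2"
  shows "AE \<eta> in lborel. cell 0 0 \<eta> / hc \<eta> = dual_hat \<eta>"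
proof -
  define r where "r = 1 / (2 * \<alpha>)"
  \<comment> \<open>\<open>d\<close> is the left end of the central interval translated by
    \<open>\<beta>\<close>, and \<open>- d\<close> the right end of its translate by
    \<open>- \<beta>\<close>. The bounds \<alpha>\<beta> \<ge> 1/2 and \<alpha>\<beta> \<le> 1
    amount to \<open>0 \<le> d\<close> and \<open>d \<le> r\<close>: the two neighbours have
    disjoint interiors, and each meets the central interval.\<close>
  define d where "d = \<beta> - r"
  have r: "r > 0" using \<alpha> by (simp add: r_def)
  have rr: "1 / \<alpha> = 2 * r" using \<alpha> by (simp add: r_def)
  have d0: "0 \<le> d" using half \<alpha> by (simp add: d_def r_def field_simps)
  have dr: "d \<le> r" using \<alpha>\<beta> \<alpha> by (simp add: d_def r_def field_simps)
  have ends: "\<beta> / 2 - (1 / \<alpha> - \<beta>) / 2 = d" "\<beta> / 2 + (1 / \<alpha> - \<beta>) / 2 = r"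
    "- \<beta> / 2 - (1 / \<alpha> - \<beta>) / 2 = - r" "- \<beta> / 2 + (1 / \<alpha> - \<beta>) / 2 = - d"
    unfolding rr d_def by (simp_all add: field_simps)
  have e: "exp (complex_of_real (- 2 * pi * w) * of_real \<eta>) = of_real (exp (- 2 * pi * w * \<eta>))" for \<eta>
    by (simp only: of_real_mult[symmetric] exp_of_real)
  have D: "dual_hat \<eta> = of_real (exp (- 2 * pi * w * \<eta>)) *
     (indicator {-d..<d} \<eta> + of_real (dual_weight (-1)) * indicator {d..<r} \<eta> + of_real (dual_weight 1) * indicator {-r..<-d} \<eta>)" for \<eta>
    unfolding dual_hat_def ends e r_def[symmetric] d_def[symmetric] by (simp add: algebra_simps)
  have mem: "m \<in> h_supp \<eta> \<longleftrightarrow> - r \<le> \<eta> - \<beta> * of_int m \<and> \<eta> - \<beta> * of_int m \<le> r" for m \<eta>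
    by (simp add: h_supp_def r_def)
  \<comment> \<open>Since \<open>\<beta> = r + d\<close> with \<open>d \<ge> 0\<close>, translates
    by two or more steps miss the open central interval.\<close>
  have sub: "h_supp \<eta> \<subseteq> {- 1, 0, 1}" if \<eta>: "- r < \<eta>" "\<eta> < r" for \<eta>
  proof
    fix m assume m: "m \<in> h_supp \<eta>"
    have "\<not> m \<ge> 2"
    proof
      assume "m \<ge> 2"
      then have "\<beta> * 2 \<le> \<beta> * of_int m" using \<beta> by (intro mult_left_mono) auto
      then show False using m \<eta> d0 unfolding mem d_def by linarith
    qed
    moreover have "\<not> m \<le> - 2"
    proof
      assume "m \<le> - 2"
      then have "\<beta> * of_int m \<le> \<beta> * (- 2)" using \<beta> by (intro mult_left_mono) auto
      then show False using m \<eta> d0 unfolding mem d_def by linarith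
    qed
    ultimately have "m = - 1 \<or> m = 0 \<or> m = 1" by linarith
    then show "m \<in> {- 1, 0, 1}" by blast
  qed
  show ?thesis
    using AE_lborel_singleton[of 0] AE_lborel_singleton[of r] AE_lborel_singleton[of "- r"]
      AE_lborel_singleton[of d] AE_lborel_singleton[of "- d"]
  proof eventually_elim
    case (elim \<eta>)
    consider "\<eta> < - r \<or> r < \<eta>" | "- r < \<eta>" "\<eta> < - d" | "- d < \<eta>" "\<eta> < d" | "d < \<eta>" "\<eta> < r"
      using elim by linarith
    then show ?case
    proof cases
      case 1
      then show ?thesis
        using d0 dr r unfolding D cell_def r_def[symmetric] by (auto simp: indicator_def)
    next
      case 2
      have "0 \<in> h_supp \<eta>" "-1 \<in> h_supp \<eta>" "1 \<notin> h_supp \<eta>"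
        using 2 d0 dr r unfolding mem d_def by auto
      moreover have "h_supp \<eta> \<subseteq> {- 1, 0, 1}"
        using 2 d0 dr by (intro sub) linarith+
      ultimately have "h_supp \<eta> = insert 0 {-1}" by blast
      from h_hat_quotient[OF this] show ?thesis
        using 2 d0 dr r unfolding D r_def[symmetric] by (auto simp: indicator_def)
    next
      case 3
      have "0 \<in> h_supp \<eta>" "-1 \<notin> h_supp \<eta>" "1 \<notin> h_supp \<eta>"
        using 3 d0 dr r unfolding mem d_def by auto
      moreover have "h_supp \<eta> \<subseteq> {- 1, 0, 1}"
        using 3 d0 dr by (intro sub) linarith+
      ultimately have "h_supp \<eta> = insert 0 {}" by blast
      from h_hat_quotient[OF this] show ?thesis
        using 3 d0 dr r unfolding D r_def[symmetric] by (auto simp: indicator_def)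
    next
      case 4
      have "0 \<in> h_supp \<eta>" "-1 \<notin> h_supp \<eta>" "1 \<in> h_supp \<eta>"
        using 4 d0 dr r unfolding mem d_def by auto
      moreover have "h_supp \<eta> \<subseteq> {- 1, 0, 1}"
        using 4 d0 dr by (intro sub) linarith+
      ultimately have "h_supp \<eta> = insert 0 {1}" by blast
      from h_hat_quotient[OF this] show ?thesis
        using 4 d0 dr r unfolding D r_def[symmetric] by (auto simp: indicator_def)
    qed
  qed
qed

text \<open>The central interval gives the first sine quotient. The outer two give the same second
  quotient with factors \<open>exp P\<close> and \<open>exp (- P)\<close>, and their weighted sum is
  \<open>(exp P * Y + inverse (exp P * Y)) / (Y + 1 / Y)\<close>, the cosine over the hyperbolic
  cosine.\<close>

lemma inv_fourier_dual_hat: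
  assumes half: "\<alpha> * \<beta> \<ge> 1 / 2"
  defines "\<epsilon> \<equiv> 1 / \<alpha> - \<beta>"
  shows "inv_fourier dual_hat t =
    sin (of_real (pi * (\<beta> - \<epsilon>)) * (of_real t + \<i> * of_real w)) / (of_real pi * (of_real t + \<i> * of_real w))
    + cos (of_real (pi * \<beta>) * (of_real t - \<i> * of_real w)) / of_real (cosh (2 * pi * w * \<beta>))
      * (sin (of_real (pi * \<epsilon>) * (of_real t + \<i> * of_real w)) / (of_real pi * (of_real t + \<i> * of_real w)))"
proof -
  define z where "z = complex_of_real t + \<i> * complex_of_real w"
  have z: "z \<noteq> 0" using w by (simp add: z_def complex_eq_iff)
  let ?e = "\<lambda>\<eta>. exp (2 * of_real pi * \<i> * z * of_real \<eta>)"
  define I where "I a b \<eta> = indicator {a - b..<a + b} \<eta> * ?e \<eta>" for a b \<eta> :: real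
  have "exp (complex_of_real (- 2 * pi * w) * of_real \<eta>) * ec (t * \<eta>) = ?e \<eta>" for \<eta>
    unfolding ec_exp exp_add[symmetric] z_def
    by (intro arg_cong[where f = exp]) (simp add: algebra_simps)
  then have "inv_fourier dual_hat t = (LINT \<eta>|lborel. I 0 (\<beta> - 1 / (2 * \<alpha>)) \<eta>
      + of_real (dual_weight (-1)) * I (\<beta> / 2) (\<epsilon> / 2) \<eta> + of_real (dual_weight 1) * I (- \<beta> / 2) (\<epsilon> / 2) \<eta>)"
    unfolding inv_fourier_ec dual_hat_def I_def \<epsilon>_def
    by (intro Bochner_Integration.integral_cong refl) (simp only: distrib_right mult.assoc)
  also have "\<dots> = (LINT \<eta>|lborel. I 0 (\<beta> - 1 / (2 * \<alpha>)) \<eta>)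
      + of_real (dual_weight (-1)) * (LINT \<eta>|lborel. I (\<beta> / 2) (\<epsilon> / 2) \<eta>)
      + of_real (dual_weight 1) * (LINT \<eta>|lborel. I (- \<beta> / 2) (\<epsilon> / 2) \<eta>)"
    using integrable_Ico_exp unfolding I_def by simp
  finally have split: "inv_fourier dual_hat t = \<dots>" .
  have J0: "(LINT \<eta>|lborel. I 0 (\<beta> - 1 / (2 * \<alpha>)) \<eta>) = sin (of_real (pi * (\<beta> - \<epsilon>)) * z) / (of_real pi * z)"
  proof -
    have nn: "\<beta> - 1 / (2 * \<alpha>) \<ge> 0" using half \<alpha> by (simp add: field_simps)
    have eq: "2 * pi * (\<beta> - 1 / (2 * \<alpha>)) = pi * (\<beta> - \<epsilon>)"
      using \<alpha> by (simp add: \<epsilon>_def field_simps)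
    show ?thesis
      unfolding I_def using integral_exp_symmetric_Ico[OF z nn, of 0] unfolding eq
      by (simp only: of_real_0 mult_zero_right exp_zero mult_1_left)
  qed
  have J: "(LINT \<eta>|lborel. I a (\<epsilon> / 2) \<eta>) = exp (2 * of_real pi * \<i> * z * of_real a) * (sin (of_real (pi * \<epsilon>) * z) / (of_real pi * z))" for a
  proof -
    have nn: "\<epsilon> / 2 \<ge> 0" using \<alpha>\<beta> \<alpha> by (simp add: \<epsilon>_def field_simps)
    have eq: "2 * pi * (\<epsilon> / 2) = pi * \<epsilon>" by simp
    show ?thesis
      unfolding I_def using integral_exp_symmetric_Ico[OF z nn, of a] unfolding eq
      by (simp only: times_divide_eq_right)
  qed
  define P where "P = of_real pi * \<i> * z * of_real \<beta>"
  define Y where "Y = exp (2 * pi * w * \<beta>)"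
  have Y: "Y > 0" by (simp add: Y_def)
  have YY: "exp (4 * pi * w * \<beta>) = Y * Y" by (simp add: Y_def exp_add[symmetric])
  have weights: "dual_weight (-1) = Y * Y / (Y * Y + 1)" "dual_weight 1 = 1 / (Y * Y + 1)"
    using Y by (simp_all add: dual_weight_def YY exp_minus divide_simps add_ac)
  have ch: "cosh (2 * pi * w * \<beta>) = (Y * Y + 1) / (2 * Y)"
    unfolding cosh_field_def exp_minus Y_def[symmetric] using Y by (simp add: field_simps)
  \<comment> \<open>Multiplying \<open>exp P\<close> by \<open>Y\<close> adds
    \<open>2 * pi * w * \<beta>\<close> to the exponent, which turns the phase \<open>t + iw\<close>
    of \<open>P\<close> into \<open>t - iw\<close>; this is how the opposite sign gets into the
    cosine.\<close>
  have "cos (of_real (pi * \<beta>) * (of_real t - \<i> * of_real w)) = (exp (P + of_real (2 * pi * w * \<beta>)) + exp (- (P + of_real (2 * pi * w * \<beta>)))) / 2"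
  proof -
    have "\<i> * (of_real (pi * \<beta>) * (of_real t - \<i> * of_real w)) = P + of_real (2 * pi * w * \<beta>)"
      unfolding P_def z_def by (simp add: algebra_simps)
    then show ?thesis by (simp add: cos_exp_eq)
  qed
  also have "\<dots> = (exp P * of_real Y + inverse (exp P * of_real Y)) / 2"
    unfolding exp_minus exp_add exp_of_real Y_def ..
  finally have cosQ: "cos (of_real (pi * \<beta>) * (of_real t - \<i> * of_real w)) = (exp P * of_real Y + inverse (exp P * of_real Y)) / 2" .
  have gen: "A * A / (A * A + 1) * a + 1 / (A * A + 1) * inverse a = (a * A + inverse (a * A)) / 2 / ((A * A + 1) / (2 * A))"
    if "A \<noteq> 0" "a \<noteq> 0" "A * A + 1 \<noteq> 0" for A a :: complex
    using that by (simp add: divide_simps)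
  have "of_real (dual_weight (-1)) * exp P + of_real (dual_weight 1) * inverse (exp P)
      = cos (of_real (pi * \<beta>) * (of_real t - \<i> * of_real w)) / of_real (cosh (2 * pi * w * \<beta>))"
  proof -
    have "complex_of_real (Y * Y + 1) \<noteq> 0"
      unfolding of_real_eq_0_iff using Y by (metis add_pos_pos mult_pos_pos less_irrefl zero_less_one)
    then show ?thesis
      unfolding cosQ weights ch using gen[of "of_real Y" "exp P"] Y by simp
  qed
  moreover have "2 * of_real pi * \<i> * z * of_real (\<beta> / 2) = P" "2 * of_real pi * \<i> * z * of_real (- \<beta> / 2) = - P"
    by (simp_all add: P_def)
  ultimately show ?thesis
    unfolding split J0 J z_def[symmetric] by (simp only: exp_minus distrib_right[symmetric] mult.assoc[symmetric] add.assoc)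
qed

text \<open>The window is the atom with both indices zero, so \<open>sin_m\<close> times it is the
  inverse transform of \<open>cell 0 0\<close>. The \<open>FT\<close> in the inverse operator
  cancels, and only the quotient by \<open>h_hat\<close> remains to be transformed back.\<close>

lemma AE_canonical_dual_window:
  assumes half: "\<alpha> * \<beta> \<ge> 1 / 2"
  shows "AE t in lborel. rep_l2 (canonical_dual_window \<alpha> \<beta> w) t = of_real (\<alpha> / pi) * sin_p t * inv_fourier dual_hat t"
proof -
  note c = sq_integrable_cell[of 0 0] csq_integrable[OF csq_cell[of 0 0]]
  have quot: "sq_integrable (\<lambda>\<xi>. 1 / hc \<xi> * cell 0 0 \<xi>)"
    by (rule sq_integrable_bounded_mult[OF c(1) multiplier_measurable(5) bounded_inverse_hc])
  have AE: "AE \<xi> in lborel. 1 / hc \<xi> * cell 0 0 \<xi> = dual_hat \<xi>"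
    using AE_dual_hat[OF half] by eventually_elim simp
  have d: "sq_integrable dual_hat"
    using integrable_dual_hat by (intro sq_integrable_cong_AE[OF quot _ AE]) auto
  have "cauchy_window w = abs_l2 (cauchy_atom \<alpha> \<beta> w 0 0)"
    unfolding cauchy_window_def by (intro arg_cong[where f = abs_l2]) (simp add: cauchy_atom_def fun_eq_iff)
  then have "mult_l2 sin_m (cauchy_window w) = abs_l2 (inv_fourier (cell 0 0))"
    using mult_l2_abs[OF borel_measurable_sin_pm(2) bounded_sin_m sq_integrable_cauchy_atom[of 0 0]]
    by (simp add: inv_fourier_cell[abs_def])
  then have "mult_l2 sin_m (cauchy_window w) = IFT (abs_l2 (cell 0 0))"
    by (simp add: IFT_abs_eq[OF c])
  then have "IFT (mult_l2 (\<lambda>\<xi>. 1 / hc \<xi>) (FT (mult_l2 sin_m (cauchy_window w)))) = IFT (abs_l2 (\<lambda>\<xi>. 1 / hc \<xi> * cell 0 0 \<xi>))"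
    by (simp only: FT_IFT mult_l2_abs[OF multiplier_measurable(5) bounded_inverse_hc c(1)])
  also have "abs_l2 (\<lambda>\<xi>. 1 / hc \<xi> * cell 0 0 \<xi>) = abs_l2 dual_hat"
    by (rule abs_l2_eqI[OF quot d AE])
  also have "IFT (abs_l2 dual_hat) = abs_l2 (inv_fourier dual_hat)"
    by (rule IFT_abs_eq[OF d integrable_dual_hat])
  finally have eq: "IFT (mult_l2 (\<lambda>\<xi>. 1 / hc \<xi>) (FT (mult_l2 sin_m (cauchy_window w)))) = abs_l2 (inv_fourier dual_hat)" .
  show ?thesis
    unfolding canonical_dual_window_def inv_frame_op
    using rep_frame_inv[of "cauchy_window w"] rep_abs_l2[OF sq_integrable_inv_fourier[OF d integrable_dual_hat]]
    unfolding eq by eventually_elim simp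
qed

end



theorem theorem1p2:
  fixes \<alpha> \<beta> w :: real
  assumes "w > 0" and "\<alpha> > 0" and "\<beta> > 0" and "\<alpha> * \<beta> \<le> 1"
  shows
    "(\<forall>f::l2. AE x in lborel.
        rep_l2 (frame_op \<alpha> \<beta> w f) x =
          of_real pi / (of_real \<alpha> * sin (of_real (pi / \<alpha>) * (of_real x - \<i> * of_real w))) *
          rep_l2 (abs_l2 (\<lambda>t. rep_l2 f t / sin (of_real (pi / \<alpha>) * (of_real t + \<i> * of_real w)))
                  \<star> h_distr \<alpha> \<beta> w) x)
     \<and> bij (frame_op \<alpha> \<beta> w)
     \<and> (\<forall>f::l2. AE t in lborel.
        rep_l2 (inv (frame_op \<alpha> \<beta> w) f) t =
          of_real (\<alpha> / pi) * sin (of_real (pi / \<alpha>) * (of_real t + \<i> * of_real w)) *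
          rep_l2 (abs_l2 (\<lambda>x. rep_l2 f x * sin (of_real (pi / \<alpha>) * (of_real x - \<i> * of_real w)))
                  \<star> h_tilde_distr \<alpha> \<beta> w) t)
     \<and> (\<alpha> * \<beta> \<ge> 1 / 2 \<longrightarrow>
        (let \<epsilon> = 1 / \<alpha> - \<beta> in AE t in lborel.
          rep_l2 (canonical_dual_window \<alpha> \<beta> w) t =
            of_real (\<alpha> / pi) * sin (of_real (pi / \<alpha>) * (of_real t + \<i> * of_real w)) *
            (sin (of_real (pi * (\<beta> - \<epsilon>)) * (of_real t + \<i> * of_real w))
                 / (of_real pi * (of_real t + \<i> * of_real w))
             + cos (of_real (pi * \<beta>) * (of_real t - \<i> * of_real w))
                 / of_real (cosh (2 * pi * w * \<beta>))
               * (sin (of_real (pi * \<epsilon>) * (of_real t + \<i> * of_real w))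
                 / (of_real pi * (of_real t + \<i> * of_real w))))))"
proof -
  interpret cauchy_gabor \<alpha> \<beta> w
    using assms by unfold_locales
  have "bij (frame_op \<alpha> \<beta> w)" by (rule bij_frame_op)
  moreover have "AE t in lborel.
      rep_l2 (canonical_dual_window \<alpha> \<beta> w) t =
        of_real (\<alpha> / pi) * sin (of_real (pi / \<alpha>) * (of_real t + \<i> * of_real w)) * inv_fourier dual_hat t"
    if "\<alpha> * \<beta> \<ge> 1 / 2"
    using AE_canonical_dual_window[OF that] unfolding sin_p_def .
  ultimately show ?thesis
    using frame_op_convolution frame_inv_convolution
    unfolding sin_p_def sin_m_def inv_frame_op[symmetric] Let_def
    by (simp only: inv_fourier_dual_hat simp_thms) blast
qed

end
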